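(* Let $H$ be a complex Hilbert space with $\dim H<\infty$, let $n=2\ell$, and let $A(\lambda)=A_0+\lambda A_1+\dots+\lambda^nA_n$ be an operator pencil in $H$ such that (i) $\operatorname{Im}(A(\lambda)x,x)\le 0$ for all $x\in H$ and all $\lambda\in\mathbb R$; (ii) $\operatorname{Ker}A_n=\{0\}$; (iii) there is a point $\lambda_0\in\mathbb R$ such that $0\notin\theta(A(\lambda_0))$. Then for any given initial vectors $\varphi_0,\dots,\varphi_{\ell-1}\in H$ there exists a unique solution $v(z)$, $z\ge0$, of the problem $$A_0v-iA_1v'+\dots+(-i)^nA_nv^{(n)}=0,\qquad (-i)^jv^{(j)}(0)=\varphi_j,\quad j=0,1,\dots,\ell-1,$$ which satisfies the generalized Mandelstam radiation principle at $+\infty$.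
   Context: Notation. $\theta(B)=\{(Bu,u):\|u\|=1\}$ is the numerical range of $B$; $[\gamma]$ is the largest integer $\le\gamma$; $A^*(\lambda)=[A(\bar\lambda)]^*$; $(\cdot,z)w$ is the operator $x\mapsto (x,z)w$. Chains. Vectors $w^0\ne0,w^1,\dots,w^p$ form a chain of eigen and associated vectors of length $p+1$ at the eigenvalue $c$ if $\sum_{j=0}^{s}\frac1{j!}A^{(j)}(c)w^{s-j}=0$ for $s=0,\dots,p$. A canonical system at $c$ is a family of chains $w_k^0,\dots,w_k^{p_k}$ $(k=1,\dots,N)$ such that $\{w_k^0\}$ is a basis of $\operatorname{Ker}A(c)$ and $\sum_k(p_k+1)$ is the maximal possible. The principal part of $A^{-1}(\lambda)$ at $c$ then has the form $$\sum_{k=1}^N\sum_{s=0}^{p_k}\frac{\sum_{r=0}^{s}(\cdot,z_k^{s-r})w_k^{r}}{(\lambda-c)^{p_k+1-s}},$$ where $z_k^0,\dots,z_k^{p_k}$ is a canonical system of $A^*(\lambda)$ at $\bar c$, uniquely determined by $\{w_k^h\}$ and called the adjoint canonical system. Elementary solutions and derived chains. Given a canonical system at $c=\lambda_k$, put $v_k^h(z)=e^{i\lambda_kz}\sum_{r=0}^h\frac{(iz)^r}{r!}w_k^{h-r}$. The Keldysh derived chain of length $n$ corresponding to $w_k^h$ is $\tilde w_k^h=\{v_k^h(0),-i(v_k^h)'(0),\dots,(-i)^{n-1}(v_k^h)^{(n-1)}(0)\}\in H^n$, and $\tilde z_k^h$ is formed in the same way from the adjoint chains at $\bar c$. Regular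 canonical systems and sign characteristics. Let $c$ be a real eigenvalue. A canonical system at $c$ is called regular if for every $k$ with $p_k=2\ell_k$ even there is $\varepsilon_k\in\{1,-1\}$ such that $\tilde z_k^{\ell_k}-\varepsilon_k\tilde w_k^{\ell_k}$ belongs to the span of $\{\tilde w_j^h:\ 1\le j\le N,\ 0\le h\le[(p_j-1)/2]\}$ (nothing is taken from a chain with $p_j=0$). Regular systems exist for pencils satisfying (i). The numbers $\varepsilon_k$ are the sign characteristics; for chains of even length ($p_k$ odd) one puts $\varepsilon_k=0$. Generalized Mandelstam radiation principle at $+\infty$. Fix regular canonical systems at the real eigenvalues (numbered according to geometric multiplicity). A solution $v(z)$ satisfies the principle if $v=v_1+v_0$, where $v_0^{(j)}(z)\to0$ as $z\to\infty$ for $j=0,\dots,n-1$, and $v_1$ is a finite linear combination of the elementary solutions $v_k^h(z)$ with $\lambda_k\in\mathbb R$ and $0\le h\le[(p_k+\varepsilon_k)/2]$ (if $p_k=0$ and $\varepsilon_k=-1$, no solution with this $k$ is admitted). *)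

theory Defs
  imports "HOL-Complex_Analysis.Complex_Analysis"
begin

text \<open>
  The inner product is linear in its first argument and antilinear in the second.
\<close>

class complex_inner = real_normed_vector +
  fixes scaleC :: "complex \<Rightarrow> 'a \<Rightarrow> 'a"  (infixr \<open>*\<^sub>C\<close> 75)
    and cinner :: "'a \<Rightarrow> 'a \<Rightarrow> complex"
  assumes scaleC_add_right: "a *\<^sub>C (x + y) = a *\<^sub>C x + a *\<^sub>C y"
    and scaleC_add_left: "(a + b) *\<^sub>C x = a *\<^sub>C x + b *\<^sub>C x"
    and scaleC_scaleC: "a *\<^sub>C (b *\<^sub>C x) = (a * b) *\<^sub>C x"
    and scaleR_scaleC: "r *\<^sub>R x = complex_of_real r *\<^sub>C x"
    and cinner_commute: "cinner x y = cnj (cinner y x)"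
    and cinner_add_left: "cinner (x + y) z = cinner x z + cinner y z"
    and cinner_scaleC_left: "cinner (a *\<^sub>C x) y = a * cinner x y"
    and cinner_pos: "x \<noteq> 0 \<Longrightarrow> 0 < Re (cinner x x)"
    and norm_eq_sqrt_cinner: "norm x = sqrt (Re (cinner x x))"

global_interpretation complex_vector: vector_space "(*\<^sub>C) :: complex \<Rightarrow> 'a::complex_inner \<Rightarrow> 'a"
proof
  fix x :: 'a
  show "1 *\<^sub>C x = x"
    using scaleR_scaleC[of 1 x] by simp
qed (simp_all add: scaleC_add_right scaleC_add_left scaleC_scaleC)

class fin_complex_hilbert = complex_inner + complete_space +
  assumes finite_dimensional:
    "\<exists>B. finite B \<and> (\<forall>x. \<exists>a. x = (\<Sum>b\<in>B. a b *\<^sub>C b))"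

instantiation complex :: fin_complex_hilbert
begin

definition scaleC_complex :: "complex \<Rightarrow> complex \<Rightarrow> complex" where
  "scaleC_complex a x = a * x"

definition cinner_complex :: "complex \<Rightarrow> complex \<Rightarrow> complex" where
  "cinner_complex x y = x * cnj y"

instance
proof
  show "\<exists>B. finite B \<and> (\<forall>x::complex. \<exists>a. x = (\<Sum>b\<in>B. a b *\<^sub>C b))"
    by (intro exI[of _ "{1}"]) (auto simp: scaleC_complex_def)
  fix x :: complex
  show "x \<noteq> 0 \<Longrightarrow> 0 < Re (cinner x x)"
    by (simp add: cinner_complex_def complex_neq_0 flip: power2_eq_square)
  show "norm x = sqrt (Re (cinner x x))"
    by (simp add: cinner_complex_def norm_complex_def power2_eq_square)
qed (auto simp: scaleC_complex_def cinner_complex_def algebra_simps scaleR_conv_of_real)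

end

instantiation vec :: (fin_complex_hilbert, finite) fin_complex_hilbert
begin

definition scaleC_vec :: "complex \<Rightarrow> 'a ^ 'b \<Rightarrow> 'a ^ 'b" where
  "scaleC_vec a x = (\<chi> i. a *\<^sub>C (x $ i))"

definition cinner_vec :: "'a ^ 'b \<Rightarrow> 'a ^ 'b \<Rightarrow> complex" where
  "cinner_vec x y = (\<Sum>i\<in>UNIV. cinner (x $ i) (y $ i))"

instance
proof
  obtain B :: "'a set" where B: "finite B" "\<And>x. \<exists>a. x = (\<Sum>b\<in>B. a b *\<^sub>C b)"
    using finite_dimensional by blast
  then obtain a where a: "\<And>x. x = (\<Sum>b\<in>B. a x b *\<^sub>C b)" by metis
  define e :: "'b \<times> 'a \<Rightarrow> 'a ^ 'b" where "e = (\<lambda>(i, b). axis i b)"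
  let ?S = "UNIV \<times> (B - {0})"
  have inj: "inj_on e ?S"
    by (auto simp: inj_on_def e_def axis_eq_axis)
  have "\<exists>c. x = (\<Sum>b\<in>e ` ?S. c b *\<^sub>C b)" for x :: "'a ^ 'b"
  proof
    let ?g = "\<lambda>(i, b). a (x $ i) b"
    have "(\<Sum>b\<in>e ` ?S. (?g \<circ> the_inv_into ?S e) b *\<^sub>C b) = (\<Sum>q\<in>?S. ?g q *\<^sub>C e q)"
      by (subst sum.reindex[OF inj]) (auto simp: the_inv_into_f_f[OF inj] intro!: sum.cong)
    also have "\<dots> = x"
    proof (subst vec_eq_iff, intro allI)
      fix j
      have "(\<Sum>q\<in>?S. ?g q *\<^sub>C e q) $ j = (\<Sum>i\<in>UNIV. \<Sum>b\<in>B - {0}. a (x $ i) b *\<^sub>C (axis i b $ j))"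
        by (simp add: sum.cartesian_product scaleC_vec_def e_def case_prod_unfold)
      also have "\<dots> = (\<Sum>i\<in>UNIV. if i = j then \<Sum>b\<in>B - {0}. a (x $ i) b *\<^sub>C b else 0)"
        by (intro sum.cong) (auto simp: axis_def)
      also have "\<dots> = (\<Sum>b\<in>B - {0}. a (x $ j) b *\<^sub>C b)" by simp
      also have "\<dots> = (\<Sum>b\<in>B. a (x $ j) b *\<^sub>C b)"
        using B(1) by (intro sum.mono_neutral_left) auto
      finally show "(\<Sum>q\<in>?S. ?g q *\<^sub>C e q) $ j = x $ j" using a[of "x $ j"] by simp
    qed
    finally show "x = (\<Sum>b\<in>e ` ?S. (?g \<circ> the_inv_into ?S e) b *\<^sub>C b)" ..
  qed
  then show "\<exists>B. finite B \<and> (\<forall>x::'a ^ 'b. \<exists>a. x = (\<Sum>b\<in>B. a b *\<^sub>C b))"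
    using B(1) by (intro exI[of _ "e ` ?S"]) auto
  have nn: "0 \<le> Re (cinner y y)" for y :: 'a
    using norm_ge_zero[of y] unfolding norm_eq_sqrt_cinner by simp
  fix x :: "'a ^ 'b"
  show "norm x = sqrt (Re (cinner x x))"
    using nn by (simp add: norm_vec_def L2_set_def cinner_vec_def norm_eq_sqrt_cinner)
  show "x \<noteq> 0 \<Longrightarrow> 0 < Re (cinner x x)"
  proof -
    assume "x \<noteq> 0"
    then obtain j where "x $ j \<noteq> 0" by (auto simp: vec_eq_iff)
    then show ?thesis
      using nn cinner_pos by (auto simp: cinner_vec_def intro!: sum_pos2[of _ j])
  qed
  fix y :: "'a ^ 'b"
  show "cinner x y = cnj (cinner y x)"
    by (simp add: cinner_vec_def flip: cinner_commute)
qed (auto simp: vec_eq_iff scaleC_vec_def cinner_vec_def scaleC_add_right scaleC_add_left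
      scaleC_scaleC scaleR_scaleC cinner_add_left cinner_scaleC_left sum.distrib sum_distrib_left)

end

definition pencil :: "(nat \<Rightarrow> 'a \<Rightarrow> 'a) \<Rightarrow> nat \<Rightarrow> complex \<Rightarrow> 'a::complex_inner \<Rightarrow> 'a" where
  "pencil A n c x = (\<Sum>k\<le>n. c ^ k *\<^sub>C A k x)"

definition numerical_range :: "('a::complex_inner \<Rightarrow> 'a) \<Rightarrow> complex set" where
  "numerical_range B = {cinner (B u) u | u. norm u = 1}"

definition cadjoint :: "('a::complex_inner \<Rightarrow> 'a) \<Rightarrow> 'a \<Rightarrow> 'a" where
  "cadjoint T = (SOME S. \<forall>x y. cinner (T x) y = cinner x (S y))"

definition adjoint_function :: "(complex \<Rightarrow> 'a \<Rightarrow> 'a) \<Rightarrow> complex \<Rightarrow> 'a::complex_inner \<Rightarrow> 'a" where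
  "adjoint_function F c = cadjoint (F (cnj c))"

text \<open>
  \<^const>\<open>deriv\<close> covers only scalar functions; here the values are vectors and the differential
  is required to be complex linear.
\<close>

definition cderiv :: "(complex \<Rightarrow> 'a::complex_inner) \<Rightarrow> complex \<Rightarrow> 'a" where
  "cderiv g c = (SOME D. (g has_derivative (\<lambda>h. h *\<^sub>C D)) (at c))"

definition op_deriv :: "nat \<Rightarrow> (complex \<Rightarrow> 'a \<Rightarrow> 'a) \<Rightarrow> complex \<Rightarrow> 'a::complex_inner \<Rightarrow> 'a" where
  "op_deriv j F c x = (cderiv ^^ j) (\<lambda>b. F b x) c"

definition eigenvalue :: "(complex \<Rightarrow> 'a \<Rightarrow> 'a::complex_inner) \<Rightarrow> complex \<Rightarrow> bool" where
  "eigenvalue F c \<longleftrightarrow> (\<exists>x. x \<noteq> 0 \<and> F c x = 0)"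

text \<open>
  A chain of length \<open>p + 1\<close> consists of the values of \<open>w\<close> on \<open>{0..p}\<close>. The chains of a
  system are numbered by \<open>{1..N}\<close>; \<open>w k h\<close> is the vector $w_k^h$.
\<close>

definition chain :: "(complex \<Rightarrow> 'a \<Rightarrow> 'a) \<Rightarrow> complex \<Rightarrow> nat \<Rightarrow> (nat \<Rightarrow> 'a::complex_inner) \<Rightarrow> bool" where
  "chain F c p w \<longleftrightarrow> w 0 \<noteq> 0 \<and>
     (\<forall>s\<le>p. (\<Sum>j\<le>s. (1 / fact j) *\<^sub>C op_deriv j F c (w (s - j))) = 0)"

definition chain_system ::
  "(complex \<Rightarrow> 'a \<Rightarrow> 'a) \<Rightarrow> complex \<Rightarrow> nat \<Rightarrow> (nat \<Rightarrow> nat) \<Rightarrow> (nat \<Rightarrow> nat \<Rightarrow> 'a::complex_inner) \<Rightarrow> bool" where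
  "chain_system F c N p w \<longleftrightarrow>
     (\<forall>k\<in>{1..N}. chain F c (p k) (w k)) \<and>
     inj_on (\<lambda>k. w k 0) {1..N} \<and>
     complex_vector.independent ((\<lambda>k. w k 0) ` {1..N}) \<and>
     complex_vector.span ((\<lambda>k. w k 0) ` {1..N}) = {x. F c x = 0}"

definition canonical_system ::
  "(complex \<Rightarrow> 'a \<Rightarrow> 'a) \<Rightarrow> complex \<Rightarrow> nat \<Rightarrow> (nat \<Rightarrow> nat) \<Rightarrow> (nat \<Rightarrow> nat \<Rightarrow> 'a::complex_inner) \<Rightarrow> bool" where
  "canonical_system F c N p w \<longleftrightarrow>
     chain_system F c N p w \<and>
     (\<forall>N' p' w'. chain_system F c N' p' w' \<longrightarrow>
        (\<Sum>k=1..N'. p' k + 1) \<le> (\<Sum>k=1..N. p k + 1))"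

definition principal_part ::
  "complex \<Rightarrow> nat \<Rightarrow> (nat \<Rightarrow> nat) \<Rightarrow> (nat \<Rightarrow> nat \<Rightarrow> 'a) \<Rightarrow> (nat \<Rightarrow> nat \<Rightarrow> 'a) \<Rightarrow>
     complex \<Rightarrow> 'a::complex_inner \<Rightarrow> 'a" where
  "principal_part c N p w z b x =
     (\<Sum>k=1..N. \<Sum>s\<le>p k. (1 / (b - c) ^ (p k + 1 - s)) *\<^sub>C
        (\<Sum>r\<le>s. cinner x (z k (s - r)) *\<^sub>C w k r))"

text \<open>
  That \<^term>\<open>principal_part c N p w z\<close> is the principal part at \<open>c\<close> of the inverse of \<open>F\<close>
  is expressed by saying that the difference of the two extends holomorphically to \<open>c\<close>.
\<close>

definition adjoint_canonical_system ::
  "(complex \<Rightarrow> 'a \<Rightarrow> 'a) \<Rightarrow> complex \<Rightarrow> nat \<Rightarrow> (nat \<Rightarrow> nat) \<Rightarrow> (nat \<Rightarrow> nat \<Rightarrow> 'a) \<Rightarrow>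
     (nat \<Rightarrow> nat \<Rightarrow> 'a::complex_inner) \<Rightarrow> bool" where
  "adjoint_canonical_system F c N p w z \<longleftrightarrow>
     canonical_system (adjoint_function F) (cnj c) N p z \<and>
     (\<forall>x. \<exists>r>0. \<exists>G. (\<forall>b\<in>ball c r. \<exists>D. (G has_derivative (\<lambda>h. h *\<^sub>C D)) (at b)) \<and>
        (\<forall>b\<in>ball c r - {c}. bij (F b) \<and> inv (F b) x = principal_part c N p w z b x + G b))"

definition elementary_solution :: "complex \<Rightarrow> (nat \<Rightarrow> 'a::complex_inner) \<Rightarrow> nat \<Rightarrow> real \<Rightarrow> 'a" where
  "elementary_solution c w h t =
     exp (\<i> * c * of_real t) *\<^sub>C (\<Sum>r\<le>h. ((\<i> * of_real t) ^ r / fact r) *\<^sub>C w (h - r))"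

text \<open>On \<open>{0..}\<close> the derivatives at \<open>0\<close> are one-sided.\<close>

definition higher_deriv_on :: "real set \<Rightarrow> nat \<Rightarrow> (real \<Rightarrow> 'a::real_normed_vector) \<Rightarrow> real \<Rightarrow> 'a" where
  "higher_deriv_on S j = (\<lambda>f t. vector_derivative f (at t within S)) ^^ j"

text \<open>
  A vector of the $n$-fold power of $H$ is given by its components with index \<open>j < n\<close>; the
  length \<open>n\<close> enters only where derived chains are compared.
\<close>

definition derived_chain :: "complex \<Rightarrow> (nat \<Rightarrow> 'a::complex_inner) \<Rightarrow> nat \<Rightarrow> nat \<Rightarrow> 'a" where
  "derived_chain c w h j = (- \<i>) ^ j *\<^sub>C higher_deriv_on UNIV j (elementary_solution c w h) 0"

text \<open>
  Integer division by 2 rounds down, so it is the integer part $[\cdot/2]$; in particular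
  \<open>(int (p k) - 1) div 2 = -1\<close> for \<open>p k = 0\<close>, and such a chain contributes nothing to the span.
\<close>

definition sign_characteristics ::
  "(complex \<Rightarrow> 'a \<Rightarrow> 'a) \<Rightarrow> nat \<Rightarrow> real \<Rightarrow> nat \<Rightarrow> (nat \<Rightarrow> nat) \<Rightarrow>
     (nat \<Rightarrow> nat \<Rightarrow> 'a::complex_inner) \<Rightarrow> (nat \<Rightarrow> int) \<Rightarrow> bool" where
  "sign_characteristics F n c N p w \<epsilon> \<longleftrightarrow>
     (\<exists>z. adjoint_canonical_system F (of_real c) N p w z \<and>
        (\<forall>k\<in>{1..N}. if even (p k) then \<epsilon> k \<in> {1, -1} \<and>
           (\<exists>a. \<forall>i<n.
              derived_chain (of_real c) (z k) (p k div 2) i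
                - of_int (\<epsilon> k) *\<^sub>C derived_chain (of_real c) (w k) (p k div 2) i
              = (\<Sum>j=1..N. \<Sum>h | int h \<le> (int (p j) - 1) div 2.
                   a j h *\<^sub>C derived_chain (of_real c) (w j) h i))
         else \<epsilon> k = 0))"

definition regular_canonical_system ::
  "(complex \<Rightarrow> 'a \<Rightarrow> 'a) \<Rightarrow> nat \<Rightarrow> real \<Rightarrow> nat \<Rightarrow> (nat \<Rightarrow> nat) \<Rightarrow>
     (nat \<Rightarrow> nat \<Rightarrow> 'a::complex_inner) \<Rightarrow> bool" where
  "regular_canonical_system F n c N p w \<longleftrightarrow>
     canonical_system F (of_real c) N p w \<and> (\<exists>\<epsilon>. sign_characteristics F n c N p w \<epsilon>)"

definition solution ::
  "(nat \<Rightarrow> 'a \<Rightarrow> 'a) \<Rightarrow> nat \<Rightarrow> (real \<Rightarrow> 'a::complex_inner) \<Rightarrow> bool" where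
  "solution A n v \<longleftrightarrow>
     (\<forall>j<n. \<forall>t\<ge>0. (higher_deriv_on {0..} j v has_vector_derivative
        higher_deriv_on {0..} (Suc j) v t) (at t within {0..})) \<and>
     (\<forall>t\<ge>0. (\<Sum>j\<le>n. (- \<i>) ^ j *\<^sub>C A j (higher_deriv_on {0..} j v t)) = 0)"

text \<open>
  The chosen systems are indexed by the real eigenvalues \<open>c\<close>: \<open>w c k\<close>, for \<open>k \<in> {1..N c}\<close>,
  are the chains at \<open>c\<close>, and \<open>\<epsilon> c k\<close> are their sign characteristics.
\<close>

definition radiation_principle ::
  "(complex \<Rightarrow> 'a \<Rightarrow> 'a) \<Rightarrow> nat \<Rightarrow> (real \<Rightarrow> nat) \<Rightarrow> (real \<Rightarrow> nat \<Rightarrow> nat) \<Rightarrow>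
     (real \<Rightarrow> nat \<Rightarrow> nat \<Rightarrow> 'a) \<Rightarrow> (real \<Rightarrow> nat \<Rightarrow> int) \<Rightarrow> (real \<Rightarrow> 'a::complex_inner) \<Rightarrow> bool" where
  "radiation_principle F n N p w \<epsilon> v \<longleftrightarrow>
     (\<exists>v\<^sub>1 v\<^sub>0.
        (\<forall>t\<ge>0. v t = v\<^sub>1 t + v\<^sub>0 t) \<and>
        (\<forall>j<n. (higher_deriv_on {0..} j v\<^sub>0 \<longlongrightarrow> 0) at_top) \<and>
        (\<exists>I a. finite I \<and>
           I \<subseteq> {(c, k, h). eigenvalue F (of_real c) \<and> k \<in> {1..N c} \<and>
                   int h \<le> (int (p c k) + \<epsilon> c k) div 2} \<and>
           (\<forall>t\<ge>0. v\<^sub>1 t = (\<Sum>(c, k, h)\<in>I. a c k h *\<^sub>C elementary_solution (of_real c) (w c k) h t))))"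

end

theory Submission
  imports Defs "HOL-Library.Function_Algebras" "HOL-Computational_Algebra.Fundamental_Theorem_Algebra"
begin

text \<open>
  Put \<open>D = -\<i> d/dt\<close>. The data \<open>y j = (D^j v)(0)\<close> of a solution of \<open>A(D) v = 0\<close> satisfy the recurrence
  \<open>\<Sum>k\<le>n. A k (y (j + k)) = 0\<close>, and since \<open>A n\<close> is injective the first \<open>n\<close> entries of \<open>y\<close> are arbitrary.
  Decomposing the space of these sequences under the shift writes every solution as a sum of
  exponential polynomials, one for each eigenvalue (\<open>root_decomposition\<close>); the generating function
  \<open>U(\<lambda>) = \<Sum>j. y j / \<lambda>^(j + 1)\<close> is then a partial fraction with \<open>A(\<lambda>) U(\<lambda>) = q(\<lambda>)\<close>, a polynomial whose
  degree is less than \<open>l\<close> exactly when the first half of the data vanishes.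

  Uniqueness. Let \<open>y\<close> be the data of a solution which has vanishing first half and satisfies the radiation
  principle. Then \<open>f(\<lambda>) = (q(\<lambda>), U(\<lambda>\<^sup>*))\<close>, with \<open>\<lambda>\<^sup>*\<close> the complex conjugate, is a rational function without poles in
  the open upper half plane, it is \<open>O(\<lambda>\<^sup>-\<^sup>2)\<close> at infinity, and on the real axis it equals \<open>(A(\<lambda>) U, U)\<close>,
  whose imaginary part is nonpositive. The choice of the admitted elementary solutions means that the
  poles of \<open>f\<close> at real eigenvalues are simple with nonnegative residues
  (\<open>residue_at_real_eigenvalue\<close>). For such a function the maximum principle, applied to
  \<open>(\<lambda>\<^sup>2 + 1) f(\<lambda>)\<close> and evaluated at \<open>\<i>\<close>, leaves only \<open>f = 0\<close> (\<open>half_plane_rigidity\<close>). Near the point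
  where the numerical range omits zero this forces \<open>q = 0\<close>, hence \<open>y = 0\<close> on the first \<open>n\<close> places
  (\<open>half_data_determine\<close>).

  The local statement about residues rests on two facts. The principal part of the inverse pencil
  expresses the coefficients of a solution in the elementary solutions through the adjoint chains;
  and by the Cauchy--Schwarz inequality for the form of \<open>-Im A(\<lambda>)\<close> a dissipative pencil is symmetric along a chain up
  to half of its length, so that the adjoint chains may be replaced by the chains themselves there. Regularity
  compares the two middle vectors and gives the residue \<open>\<epsilon> |a|\<^sup>2\<close>.

  Existence. The same rigidity holds with the other half plane and the opposite signs. A linear map
  \<open>reflect\<close> has as kernel the solutions that satisfy the radiation principle and takes values in the
  space belonging to the opposite signs. Both spaces meet the space \<open>P\<close> of solutions with vanishing first
  half of the data only in zero; therefore the first half of \<open>reflect y\<close>, for \<open>y\<close> in \<open>P\<close>, is an injective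
  function between spaces of the same dimension, hence surjective, and every solution can be corrected by
  an element of \<open>P\<close> so that it satisfies the radiation principle (\<open>outgoing_exists\<close>).

  Finally, the remainder of a solution of the differential equation which satisfies the radiation principle
  tends to zero, and this excludes poles of its \<open>U\<close> in the closed lower half plane
  (\<open>decaying_solution_bound\<close>); the sequences of data therefore capture all solutions in question.
\<close>

section \<open>Finite-dimensional inner product spaces\<close>

lemma cinner_zero_left [simp]: "cinner 0 (y::'a::complex_inner) = 0"
  using cinner_add_left[of 0 0 y] by simp

lemma cinner_add_right: "cinner x (y + z) = cinner x y + cinner (x::'a::complex_inner) z"
  using cinner_commute[of x "y + z"] cinner_commute[of x y] cinner_commute[of x z]
  by (simp add: cinner_add_left)

lemma cinner_zero_right [simp]: "cinner (y::'a::complex_inner) 0 = 0"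
  using cinner_commute[of y 0] by simp

lemma cinner_scaleC_right: "cinner x (a *\<^sub>C y) = cnj a * cinner (x::'a::complex_inner) y"
  using cinner_commute[of x "a *\<^sub>C y"] cinner_commute[of x y] by (simp add: cinner_scaleC_left)

lemma cinner_minus_left: "cinner (- x) y = - cinner (x::'a::complex_inner) y"
  using cinner_add_left[of x "- x" y] by (simp add: add_eq_0_iff)

lemma cinner_diff_left: "cinner (x - y) z = cinner x z - cinner (y::'a::complex_inner) z"
  using cinner_add_left[of x "- y" z] by (simp add: cinner_minus_left)

lemma cinner_sum_left: "cinner (\<Sum>i\<in>I. f i) y = (\<Sum>i\<in>I. cinner (f i) (y::'a::complex_inner))"
  by (induction I rule: infinite_finite_induct) (auto simp: cinner_add_left)

lemma cinner_sum_right: "cinner x (\<Sum>i\<in>I. f i) = (\<Sum>i\<in>I. cinner (x::'a::complex_inner) (f i))"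
  by (induction I rule: infinite_finite_induct) (auto simp: cinner_add_right)

lemma Im_cinner_self [simp]: "Im (cinner x (x::'a::complex_inner)) = 0"
proof -
  have "Im (cinner x x) = - Im (cinner x x)"
    by (metis cinner_commute complex_cnj cnj.simps(2))
  then show ?thesis by simp
qed

lemma cinner_self: "cinner x x = of_real ((norm (x::'a::complex_inner))\<^sup>2)"
proof (cases "x = 0")
  case False
  then have "0 < Re (cinner x x)" by (rule cinner_pos)
  then have "(norm x)\<^sup>2 = Re (cinner x x)" unfolding norm_eq_sqrt_cinner by simp
  then show ?thesis by (simp add: complex_eq_iff)
qed simp

lemma scaleC_zero_right [simp]: "a *\<^sub>C (0::'a::complex_inner) = 0"
  by (rule complex_vector.scale_zero_right)

lemma norm_scaleC [simp]: "norm (a *\<^sub>C x) = norm a * norm (x::'a::complex_inner)"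
proof -
  have "cinner (a *\<^sub>C x) (a *\<^sub>C x) = (a * cnj a) * cinner x x"
    by (simp add: cinner_scaleC_left cinner_scaleC_right)
  also have "\<dots> = of_real ((norm a * norm x)\<^sup>2)"
    by (simp only: complex_norm_square[symmetric] cinner_self power_mult_distrib of_real_mult)
  finally have "of_real ((norm (a *\<^sub>C x))\<^sup>2) = (of_real ((norm a * norm x)\<^sup>2) :: complex)"
    by (simp only: cinner_self)
  then have "(norm (a *\<^sub>C x))\<^sup>2 = (norm a * norm x)\<^sup>2" by (simp only: of_real_eq_iff)
  then show ?thesis by (simp add: power2_eq_iff_nonneg)
qed

text \<open>
  The form is only assumed to be nonnegative because it is needed for the imaginary part of a
  dissipative operator, which may degenerate.
\<close>

lemma Cauchy_Schwarz_semidefinite: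
  fixes \<Gamma> :: "'a::complex_inner \<Rightarrow> 'a \<Rightarrow> complex"
  assumes add: "\<And>x y z. \<Gamma> (x + y) z = \<Gamma> x z + \<Gamma> y z"
    and scale: "\<And>a x y. \<Gamma> (a *\<^sub>C x) y = a * \<Gamma> x y"
    and herm: "\<And>x y. \<Gamma> x y = cnj (\<Gamma> y x)"
    and nonneg: "\<And>x. 0 \<le> Re (\<Gamma> x x)"
  shows "(norm (\<Gamma> x y))\<^sup>2 \<le> Re (\<Gamma> x x) * Re (\<Gamma> y y)"
proof -
  have add2: "\<Gamma> z (x + y) = \<Gamma> z x + \<Gamma> z y" for x y z
    using herm[of z "x + y"] herm[of z x] herm[of z y] by (simp add: add)
  have scale2: "\<Gamma> x (a *\<^sub>C y) = cnj a * \<Gamma> x y" for a x y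
    using herm[of x "a *\<^sub>C y"] herm[of x y] by (simp add: scale)
  have key: "0 \<le> Re (\<Gamma> x x) + 2 * s * (norm (\<Gamma> x y))\<^sup>2 + s\<^sup>2 * (norm (\<Gamma> x y))\<^sup>2 * Re (\<Gamma> y y)" for s :: real
  proof -
    define a where "a = of_real s * \<Gamma> x y"
    have im: "Im (\<Gamma> z z) = 0" for z
      using herm[of z z] by (metis cnj.simps(2) eq_neg_iff_add_eq_0 mult_2 mult_eq_0_iff zero_neq_numeral)
    have "\<Gamma> (x + a *\<^sub>C y) (x + a *\<^sub>C y) = \<Gamma> x x + cnj a * \<Gamma> x y + a * cnj (\<Gamma> x y) + a * cnj a * \<Gamma> y y"
      using herm[of y x] by (simp add: add add2 scale scale2 algebra_simps)
    moreover have "a * cnj (\<Gamma> x y) = of_real (s * (norm (\<Gamma> x y))\<^sup>2)"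
      unfolding a_def by (simp add: complex_norm_square[unfolded of_real_power] mult.assoc)
    moreover have "cnj a * \<Gamma> x y = of_real (s * (norm (\<Gamma> x y))\<^sup>2)"
      unfolding a_def by (simp add: complex_norm_square[unfolded of_real_power] mult.assoc mult.commute[of "cnj _" "\<Gamma> x y"])
    moreover have "a * cnj a = of_real (s\<^sup>2 * (norm (\<Gamma> x y))\<^sup>2)"
      unfolding a_def using complex_norm_square[of "\<Gamma> x y"] by (simp add: power2_eq_square mult_ac)
    ultimately have "\<Gamma> (x + a *\<^sub>C y) (x + a *\<^sub>C y) = \<Gamma> x x + of_real (2 * s * (norm (\<Gamma> x y))\<^sup>2)
        + of_real (s\<^sup>2 * (norm (\<Gamma> x y))\<^sup>2) * \<Gamma> y y"
      by simp
    then have "Re (\<Gamma> (x + a *\<^sub>C y) (x + a *\<^sub>C y)) = Re (\<Gamma> x x) + 2 * s * (norm (\<Gamma> x y))\<^sup>2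
        + s\<^sup>2 * (norm (\<Gamma> x y))\<^sup>2 * Re (\<Gamma> y y)"
      by (simp only: plus_complex.sel Re_complex_of_real times_complex.sel Im_complex_of_real im mult_zero_left mult_zero_right diff_zero)
    then show ?thesis using nonneg by metis
  qed
  define G where "G = (norm (\<Gamma> x y))\<^sup>2"
  have G0: "0 \<le> G" by (simp add: G_def)
  show ?thesis
  proof (cases "Re (\<Gamma> y y) = 0")
    case True
    have "0 \<le> Re (\<Gamma> x x) + 2 * s * G" for s using key[of s] True by (simp add: G_def)
    from this[of "- (Re (\<Gamma> x x) + 1) / (2 * G)"] have "G = 0" by (cases "G = 0") (auto simp: field_simps)
    then show ?thesis using True by (simp add: G_def)
  next
    case False
    then have pos: "Re (\<Gamma> y y) > 0" using nonneg[of y] by simp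
    have "0 \<le> Re (\<Gamma> x x) + 2 * (- 1 / Re (\<Gamma> y y)) * G + (- 1 / Re (\<Gamma> y y))\<^sup>2 * G * Re (\<Gamma> y y)"
      using key[of "- 1 / Re (\<Gamma> y y)"] by (simp add: G_def)
    also have "\<dots> = Re (\<Gamma> x x) - G / Re (\<Gamma> y y)"
      using pos by (simp add: field_simps power2_eq_square)
    finally show ?thesis using pos by (simp add: G_def field_simps)
  qed
qed

lemma norm_cinner_le: "norm (cinner x y) \<le> norm x * norm (y::'a::complex_inner)"
proof -
  have "(norm (cinner x y))\<^sup>2 \<le> Re (cinner x x) * Re (cinner y y)"
    by (rule Cauchy_Schwarz_semidefinite)
      (auto simp: cinner_add_left cinner_scaleC_left cinner_self simp flip: cinner_commute)
  also have "\<dots> = (norm x * norm y)\<^sup>2" by (simp add: cinner_self power_mult_distrib)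
  finally show ?thesis by (rule power2_le_imp_le) simp
qed

lemma bounded_bilinear_scaleC: "bounded_bilinear ((*\<^sub>C) :: complex \<Rightarrow> 'a \<Rightarrow> 'a::complex_inner)"
proof
  show "\<exists>K. \<forall>a x. norm (a *\<^sub>C (x::'a)) \<le> norm a * norm x * K" by (intro exI[of _ 1]) simp
qed (auto simp: scaleC_add_left scaleC_add_right scaleC_scaleC mult.commute scaleR_conv_of_real scaleR_scaleC[where ?'a='a])

lemma bounded_bilinear_cinner: "bounded_bilinear (cinner :: 'a \<Rightarrow> 'a \<Rightarrow> complex)"
  for dummy :: "'a::complex_inner"
proof
  show "\<exists>K. \<forall>a x. norm (cinner a (x::'a)) \<le> norm a * norm x * K"
    by (intro exI[of _ 1]) (auto simp: norm_cinner_le)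
qed (auto simp: cinner_add_left cinner_add_right scaleR_scaleC[where ?'a='a] cinner_scaleC_left
    cinner_scaleC_right scaleR_conv_of_real)

lemmas tendsto_scaleC [tendsto_intros] = bounded_bilinear.tendsto[OF bounded_bilinear_scaleC]
lemmas tendsto_cinner [tendsto_intros] = bounded_bilinear.tendsto[OF bounded_bilinear_cinner]
lemmas has_vector_derivative_scaleC =
  bounded_bilinear.has_vector_derivative[OF bounded_bilinear_scaleC]

abbreviation clinear :: "('a::complex_inner \<Rightarrow> 'a) \<Rightarrow> bool" where
  "clinear \<equiv> Vector_Spaces.linear (*\<^sub>C) (*\<^sub>C)"

lemma clinearI:
  assumes "\<And>x y. T (x + y) = T x + T y" "\<And>a x. T (a *\<^sub>C x) = a *\<^sub>C T x"
  shows "clinear T"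
  by unfold_locales (use assms in auto)

lemma clinear_rules:
  assumes "clinear T"
  shows "T (x + y) = T x + T y" "T (a *\<^sub>C x) = a *\<^sub>C T x" "T 0 = 0" "T (- x) = - T x"
    "T (x - y) = T x - T y" "T (\<Sum>i\<in>I. g i) = (\<Sum>i\<in>I. T (g i))"
proof -
  interpret T: Vector_Spaces.linear "(*\<^sub>C)" "(*\<^sub>C)" T by (rule assms)
  show "T (x + y) = T x + T y" "T (a *\<^sub>C x) = a *\<^sub>C T x" "T 0 = 0" "T (- x) = - T x"
    "T (x - y) = T x - T y" "T (\<Sum>i\<in>I. g i) = (\<Sum>i\<in>I. T (g i))"
    by (auto simp: T.add T.scale T.zero T.neg T.diff T.sum)
qed

lemma orthonormal_spanning_set:
  assumes "finite (B::'a::complex_inner set)"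
  obtains E where "finite E" "\<And>e e'. e \<in> E \<Longrightarrow> e' \<in> E \<Longrightarrow> cinner e e' = (if e = e' then 1 else 0)"
    "\<And>b. b \<in> B \<Longrightarrow> b = (\<Sum>e\<in>E. cinner b e *\<^sub>C e)"
proof -
  have "\<exists>E. finite E \<and> (\<forall>e\<in>E. \<forall>e'\<in>E. cinner e e' = (if e = e' then 1 else 0)) \<and>
      (\<forall>b\<in>B. b = (\<Sum>e\<in>E. cinner b e *\<^sub>C e))"
    using assms
  proof induction
    case empty
    show ?case by (intro exI[of _ "{}"]) auto
  next
    case (insert b B)
    then obtain E where E: "finite E" "\<And>e e'. e \<in> E \<Longrightarrow> e' \<in> E \<Longrightarrow> cinner e e' = (if e = e' then 1 else 0)"
      "\<And>b. b \<in> B \<Longrightarrow> b = (\<Sum>e\<in>E. cinner b e *\<^sub>C e)" by metis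
    define r where "r = b - (\<Sum>e\<in>E. cinner b e *\<^sub>C e)"
    show ?case
    proof (cases "r = 0")
      case True
      then show ?thesis using E by (intro exI[of _ E]) (auto simp: r_def)
    next
      case False
      define n where "n = of_real (1 / norm r) *\<^sub>C r"
      have r_e: "cinner r e = 0" if "e \<in> E" for e
      proof -
        have "(\<Sum>e'\<in>E. cinner b e' * cinner e' e) = (\<Sum>e'\<in>E. if e' = e then cinner b e else 0)"
          by (rule sum.cong) (simp_all add: E(2) that)
        then show ?thesis
          using that E(1) by (simp add: r_def cinner_diff_left cinner_sum_left cinner_scaleC_left)
      qed
      have n_e: "cinner n e = 0" "cinner e n = 0" if "e \<in> E" for e
        using r_e[OF that] cinner_commute[of e n] by (simp_all add: n_def cinner_scaleC_left)
      have nn: "cinner n n = 1"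
        using False by (simp add: n_def cinner_scaleC_left cinner_scaleC_right cinner_self power2_eq_square norm_divide)
      have n_notin: "n \<notin> E"
        using n_e nn by force
      have b_n: "cinner b n *\<^sub>C n = r"
      proof -
        have "b = r + (\<Sum>e\<in>E. cinner b e *\<^sub>C e)" by (simp add: r_def)
        then have "cinner b n = cinner r n + cinner (\<Sum>e\<in>E. cinner b e *\<^sub>C e) n"
          by (metis cinner_add_left)
        also have "\<dots> = of_real (norm r)"
          using False by (simp add: cinner_sum_left cinner_scaleC_left n_e n_def cinner_scaleC_right
              cinner_self power2_eq_square) (simp add: r_e cinner_commute[of _ r])
        finally show ?thesis using False by (simp add: n_def scaleC_scaleC)
      qed
      show ?thesis
      proof (intro exI[of _ "insert n E"] conjI ballI)
        fix b' assume "b' \<in> insert b B"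
        then show "b' = (\<Sum>e\<in>insert n E. cinner b' e *\<^sub>C e)"
        proof
          assume "b' = b"
          then show ?thesis using E(1) n_notin b_n by (simp add: r_def)
        next
          assume b': "b' \<in> B"
          then have "cinner b' n = cinner (\<Sum>e\<in>E. cinner b' e *\<^sub>C e) n" using E(3) by metis
          then have "cinner b' n = 0" by (simp add: cinner_sum_left cinner_scaleC_left n_e)
          then show ?thesis using E(1) n_notin E(3)[OF b'] by simp
        qed
      qed (use E nn n_e n_notin in auto)
    qed
  qed
  then show ?thesis using that by metis
qed

lemma orthonormal_basis:
  obtains E :: "'a::fin_complex_hilbert set" where "finite E" "\<And>x. x = (\<Sum>e\<in>E. cinner x e *\<^sub>C e)"
    "\<And>e. e \<in> E \<Longrightarrow> norm e = 1"
proof -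
  obtain B :: "'a set" where B: "finite B" "\<And>x. \<exists>a. x = (\<Sum>b\<in>B. a b *\<^sub>C b)"
    using finite_dimensional by blast
  obtain E where E: "finite E" "\<And>e e'. e \<in> E \<Longrightarrow> e' \<in> E \<Longrightarrow> cinner e e' = (if e = e' then 1 else 0)"
    "\<And>b. b \<in> B \<Longrightarrow> b = (\<Sum>e\<in>E. cinner b e *\<^sub>C e)"
    using orthonormal_spanning_set[OF B(1)] by metis
  have "x = (\<Sum>e\<in>E. cinner x e *\<^sub>C e)" for x
  proof -
    obtain a where x: "x = (\<Sum>b\<in>B. a b *\<^sub>C b)" using B(2) by blast
    have "(\<Sum>e\<in>E. cinner x e *\<^sub>C e) = (\<Sum>b\<in>B. a b *\<^sub>C (\<Sum>e\<in>E. cinner b e *\<^sub>C e))"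
      unfolding x by (simp add: cinner_sum_left cinner_scaleC_left complex_vector.scale_sum_left
          complex_vector.scale_sum_right scaleC_scaleC) (rule sum.swap)
    also have "\<dots> = x" unfolding x using E(3) by (intro sum.cong) auto
    finally show ?thesis by simp
  qed
  moreover have "norm e = 1" if "e \<in> E" for e
    using E(2)[OF that that] norm_eq_sqrt_cinner[of e] by simp
  ultimately show ?thesis using that E(1) by blast
qed

lemma clinear_bounded:
  fixes T :: "'a::fin_complex_hilbert \<Rightarrow> 'a"
  assumes "clinear T"
  obtains K where "K \<ge> 0" "\<And>x. norm (T x) \<le> K * norm x"
proof -
  obtain E :: "'a set" where E: "finite E" "\<And>x. x = (\<Sum>e\<in>E. cinner x e *\<^sub>C e)"
    "\<And>e. e \<in> E \<Longrightarrow> norm e = 1"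
    using orthonormal_basis by blast
  show ?thesis
  proof
    show "0 \<le> (\<Sum>e\<in>E. norm (T e))" by (simp add: sum_nonneg)
    fix x
    have "T x = (\<Sum>e\<in>E. cinner x e *\<^sub>C T e)"
      by (subst E(2)) (simp add: clinear_rules[OF assms])
    also have "norm \<dots> \<le> (\<Sum>e\<in>E. norm (cinner x e) * norm (T e))"
      by (rule order_trans[OF norm_sum]) simp
    also have "\<dots> \<le> (\<Sum>e\<in>E. norm x * norm (T e))"
      using E(3) norm_cinner_le[of x] by (intro sum_mono mult_right_mono) (auto, metis mult.right_neutral)
    finally show "norm (T x) \<le> (\<Sum>e\<in>E. norm (T e)) * norm x"
      by (simp add: sum_distrib_left mult.commute)
  qed
qed

lemma clinear_bounded_linear:
  fixes T :: "'a::fin_complex_hilbert \<Rightarrow> 'a"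
  assumes "clinear T"
  shows "bounded_linear T"
proof -
  obtain K where "\<And>x. norm (T x) \<le> K * norm x" using clinear_bounded[OF assms] by blast
  then show ?thesis
    by (intro bounded_linear_intro[where K = K])
      (auto simp: clinear_rules[OF assms] scaleR_scaleC mult.commute)
qed

text \<open>
  This is stated for the span of a finite set because it is applied both to a finite-dimensional space and
  to the sequences supported on an initial segment, whose ambient space has infinite dimension.
\<close>

lemma (in vector_space) linear_inj_span_surj:
  assumes lin: "Vector_Spaces.linear scale scale f"
    and B: "finite B" and sub: "f ` span B \<subseteq> span B" and inj: "inj_on f (span B)"
  shows "f ` span B = span B"
proof -
  interpret f: Vector_Spaces.linear scale scale f by (rule lin)
  obtain C where C: "C \<subseteq> span B" "independent C" "span B \<subseteq> span C"
    using maximal_independent_subset[of "span B"] by blast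
  have spanC: "span C = span B"
    using C(1,3) by (metis span_mono span_span subset_antisym)
  have finC: "finite C" using independent_span_bound[OF B C(2,1)] by simp
  have injC: "inj_on f (span C)" using inj spanC by simp
  have indep: "independent (f ` C)"
    using f.independent_inj_on_image[OF C(2) injC] .
  have card: "card (f ` C) = card C"
    by (rule card_image) (rule inj_on_subset[OF injC span_superset])
  have fC: "f ` C \<subseteq> span C" using sub spanC span_superset by blast
  have "span C \<subseteq> span (f ` C)"
  proof
    fix y assume y: "y \<in> span C"
    show "y \<in> span (f ` C)"
    proof (rule ccontr)
      assume n: "y \<notin> span (f ` C)"
      then have "independent (insert y (f ` C))" using indep by (simp add: independent_insertI)
      then have "card (insert y (f ` C)) \<le> card C"
        using independent_span_bound[OF finC] y fC by blast
      moreover have "y \<notin> f ` C" using n span_base by blast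
      ultimately show False using card finC by simp
    qed
  qed
  then have "span B \<subseteq> f ` span B" using f.span_image[of C] spanC by simp
  then show ?thesis using sub by blast
qed

lemma clinear_inj_inverse:
  fixes T :: "'a::fin_complex_hilbert \<Rightarrow> 'a"
  assumes T: "clinear T" and inj: "\<And>x. T x = 0 \<Longrightarrow> x = 0"
  obtains T' where "clinear T'" "\<And>x. T (T' x) = x" "\<And>x. T' (T x) = x"
proof -
  obtain E :: "'a set" where E: "finite E" "\<And>x. x = (\<Sum>e\<in>E. cinner x e *\<^sub>C e)"
    using orthonormal_basis by metis
  have span: "complex_vector.span E = UNIV"
  proof -
    have "x \<in> complex_vector.span E" for x
      by (subst E(2)) (intro complex_vector.span_sum complex_vector.span_scale complex_vector.span_base)
    then show ?thesis by auto
  qed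
  have injT: "inj T"
    by (rule injI) (metis T clinear_rules(5) inj right_minus_eq)
  have "surj T"
    using complex_vector.linear_inj_span_surj[OF T E(1)] injT by (simp add: span)
  show ?thesis
  proof (rule that[of "inv T"])
    show TT: "T (inv T x) = x" "inv T (T x) = x" for x
      using \<open>surj T\<close> injT by (auto simp: surj_f_inv_f)
    show "clinear (inv T)"
      by (rule clinearI; rule injD[OF injT]) (simp_all add: TT clinear_rules[OF T])
  qed
qed

lemma clinear_inj_lower_bound:
  fixes T :: "'a::fin_complex_hilbert \<Rightarrow> 'a"
  assumes T: "clinear T" and inj: "\<And>x. T x = 0 \<Longrightarrow> x = 0"
  obtains \<kappa> where "\<kappa> > 0" "\<And>x. \<kappa> * norm x \<le> norm (T x)"
proof -
  obtain T' where T': "clinear T'" "\<And>x. T' (T x) = x" using clinear_inj_inverse[OF T inj] by metis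
  obtain K where K: "K \<ge> 0" "\<And>x. norm (T' x) \<le> K * norm x" using clinear_bounded[OF T'(1)] by blast
  show ?thesis
  proof (rule that[of "1 / (K + 1)"])
    fix x
    have "norm x \<le> K * norm (T x)" using K(2)[of "T x"] T'(2) by simp
    also have "\<dots> \<le> (K + 1) * norm (T x)" by (simp add: algebra_simps)
    finally show "1 / (K + 1) * norm x \<le> norm (T x)" using K(1) by (simp add: field_simps)
  qed (use K in simp)
qed


section \<open>Sequences under the shift\<close>

definition shift :: "nat \<Rightarrow> (nat \<Rightarrow> 'a) \<Rightarrow> nat \<Rightarrow> 'a" where
  "shift g y = (\<lambda>j. y (g + j))"

lemma shift_0 [simp]: "shift 0 y = y" by (simp add: shift_def)
lemma shift_shift [simp]: "shift g (shift h y) = shift (h + g) y" by (simp add: shift_def add_ac)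
lemma shift_apply [simp]: "shift g y j = y (g + j)" by (simp add: shift_def)
lemma shift_zero [simp]: "shift g (\<lambda>_. c) = (\<lambda>_. c)" by (simp add: shift_def)

text \<open>
  \<open>geo c \<xi> j\<close> is the entry at \<open>0\<close> of \<open>(c + shift)^j \<xi>\<close>; see \<open>geo_explicit\<close>. It is the value at \<open>0\<close> of
  \<open>D^j\<close> of the exponential polynomial with exponent \<open>c\<close> and coefficients \<open>\<xi>\<close>.
\<close>

primrec geo :: "complex \<Rightarrow> (nat \<Rightarrow> 'a::complex_inner) \<Rightarrow> nat \<Rightarrow> 'a" where
  "geo c \<xi> 0 = \<xi> 0"
| "geo c \<xi> (Suc j) = c *\<^sub>C geo c \<xi> j + geo c (shift 1 \<xi>) j"

lemma geo_zero [simp]: "geo c (\<lambda>_. 0) j = 0"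
  by (induction j) (auto)

lemma shift_add: "shift g (\<lambda>m. \<xi> m + \<eta> m) = (\<lambda>m. shift g \<xi> m + shift g \<eta> m)"
  by (simp add: shift_def)

lemma geo_add: "geo c (\<lambda>m. \<xi> m + \<eta> m) j = geo c \<xi> j + geo c \<eta> j"
  by (induction j arbitrary: \<xi> \<eta>) (auto simp: scaleC_add_right shift_def algebra_simps)

lemma geo_scaleC: "geo c (\<lambda>m. a *\<^sub>C \<xi> m) j = a *\<^sub>C geo c \<xi> j"
  by (induction j arbitrary: \<xi>) (auto simp: scaleC_add_right scaleC_scaleC shift_def mult.commute)

lemma geo_diff: "geo c (\<lambda>m. \<xi> m - \<eta> m) j = geo c \<xi> j - geo c \<eta> j"
  using geo_add[of c "\<lambda>m. \<xi> m - \<eta> m" \<eta> j] by (simp add: algebra_simps)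

lemma geo_explicit: "geo c \<xi> j = (\<Sum>m\<le>j. (of_nat (j choose m) * c ^ (j - m)) *\<^sub>C \<xi> m)"
proof (induction j arbitrary: \<xi>)
  case (Suc j)
  have 1: "(\<Sum>m\<le>j. (of_nat (j choose m) * c ^ (Suc j - m)) *\<^sub>C \<xi> m) =
      c ^ Suc j *\<^sub>C \<xi> 0 + (\<Sum>m\<le>j. (of_nat (j choose Suc m) * c ^ (j - m)) *\<^sub>C \<xi> (Suc m))"
  proof -
    have "(\<Sum>m\<le>j. (of_nat (j choose m) * c ^ (Suc j - m)) *\<^sub>C \<xi> m) =
        (\<Sum>m\<le>Suc j. (of_nat (j choose m) * c ^ (Suc j - m)) *\<^sub>C \<xi> m)"
      by simp
    also have "\<dots> = (of_nat (j choose 0) * c ^ (Suc j - 0)) *\<^sub>C \<xi> 0 +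
        (\<Sum>m\<le>j. (of_nat (j choose Suc m) * c ^ (Suc j - Suc m)) *\<^sub>C \<xi> (Suc m))"
      by (rule sum.atMost_Suc_shift)
    finally show ?thesis by simp
  qed
  have 2: "c *\<^sub>C (\<Sum>m\<le>j. (of_nat (j choose m) * c ^ (j - m)) *\<^sub>C \<xi> m) =
      (\<Sum>m\<le>j. (of_nat (j choose m) * c ^ (Suc j - m)) *\<^sub>C \<xi> m)"
    by (auto simp: complex_vector.scale_sum_right scaleC_scaleC Suc_diff_le mult_ac intro!: sum.cong)
  have "geo c \<xi> (Suc j) = c ^ Suc j *\<^sub>C \<xi> 0 +
      (\<Sum>m\<le>j. (of_nat (j choose Suc m) * c ^ (j - m)) *\<^sub>C \<xi> (Suc m)) +
      (\<Sum>m\<le>j. (of_nat (j choose m) * c ^ (j - m)) *\<^sub>C \<xi> (Suc m))"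
    unfolding geo.simps Suc.IH 2 1 by (simp add: shift_def)
  also have "\<dots> = c ^ Suc j *\<^sub>C \<xi> 0 +
      (\<Sum>m\<le>j. (of_nat (Suc j choose Suc m) * c ^ (Suc j - Suc m)) *\<^sub>C \<xi> (Suc m))"
    unfolding add.assoc sum.distrib[symmetric]
    by (simp add: scaleC_add_left[symmetric] distrib_right add.commute)
  also have "\<dots> = (\<Sum>m\<le>Suc j. (of_nat (Suc j choose m) * c ^ (Suc j - m)) *\<^sub>C \<xi> m)"
    by (simp only: sum.atMost_Suc_shift binomial_n_0 of_nat_1 mult_1_left diff_zero)
  finally show ?case .
qed simp

text \<open>A polynomial acts on sequences by substituting the shift for the variable.\<close>

definition act :: "complex poly \<Rightarrow> (nat \<Rightarrow> 'a::complex_inner) \<Rightarrow> nat \<Rightarrow> 'a" where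
  "act p y j = (\<Sum>i\<le>degree p. coeff p i *\<^sub>C y (i + j))"

lemma act_upto: "degree p \<le> D \<Longrightarrow> act p y j = (\<Sum>i\<le>D. coeff p i *\<^sub>C y (i + j))"
  unfolding act_def by (rule sum.mono_neutral_left) (auto simp: coeff_eq_0)

lemma act_0 [simp]: "act 0 y = (\<lambda>_. 0)" by (rule ext) (simp add: act_def)

lemma act_zero [simp]: "act p (\<lambda>_. 0) = (\<lambda>_. 0)" by (rule ext) (simp add: act_def)

lemma act_add: "act (p + q) y j = act p y j + act q y j"
  using act_upto[of p "max (degree p) (degree q)" y j] act_upto[of q "max (degree p) (degree q)" y j]
    act_upto[of "p + q" "max (degree p) (degree q)" y j] degree_add_le_max[of p q]
  by (simp add: scaleC_add_left sum.distrib)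

lemma act_smult: "act (smult a p) y j = a *\<^sub>C act p y j"
  using act_upto[of "smult a p" "degree p" y j]
  by (simp add: degree_smult_le act_def complex_vector.scale_sum_right scaleC_scaleC)

lemma act_pCons: "act (pCons a p) y j = a *\<^sub>C y j + act p y (Suc j)"
proof -
  have "act (pCons a p) y j = (\<Sum>i\<le>Suc (degree p). coeff (pCons a p) i *\<^sub>C y (i + j))"
    by (rule act_upto) (rule degree_pCons_le)
  also have "\<dots> = a *\<^sub>C y j + act p y (Suc j)"
    by (subst sum.atMost_Suc_shift) (simp add: act_def)
  finally show ?thesis .
qed

lemma act_add_right: "act p (\<lambda>j. y j + z j) j = act p y j + act p z j"
  by (simp add: act_def scaleC_add_right sum.distrib)

lemma act_scaleC_right: "act p (\<lambda>j. a *\<^sub>C y j) j = a *\<^sub>C act p y j"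
  by (simp add: act_def complex_vector.scale_sum_right scaleC_scaleC mult.commute)

lemma act_1 [simp]: "act 1 y = y"
  by (rule ext) (simp add: act_def)

lemma act_mult: "act (p * q) y j = act p (act q y) j"
proof (induction p arbitrary: j)
  case 0
  then show ?case by simp
next
  case (pCons a p)
  show ?case by (simp add: act_add act_smult act_pCons pCons.IH)
qed

lemma act_linear_factor: "act [:- c, 1:] y j = y (Suc j) - c *\<^sub>C y j"
  by (simp add: act_pCons complex_vector.scale_minus_left)

lemma act_linear_factor_Suc: "act ([:- c, 1:] ^ Suc m) y j = act ([:- c, 1:] ^ m) (act [:- c, 1:] y) j"
  by (metis act_mult power_Suc2)

lemma act_dvd_eq_0:
  assumes "p dvd q" "\<And>j. act p y j = 0"
  shows "act q y j = 0"
proof -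
  obtain r where "q = r * p" using assms(1) by (auto simp: dvd_def mult.commute)
  moreover have "act p y = (\<lambda>_. 0)" using assms(2) by auto
  ultimately show ?thesis by (simp add: act_mult)
qed

text \<open>
  Taylor's formula for the shift: its \<open>j\<close>-th power is expanded in powers of the shift minus \<open>c\<close>.
\<close>

lemma eq_geo_act: "y j = geo c (\<lambda>m. act ([:- c, 1:] ^ m) y 0) j"
proof (induction j arbitrary: y)
  case (Suc j)
  have "shift 1 (\<lambda>m. act ([:- c, 1:] ^ m) y 0) = (\<lambda>m. act ([:- c, 1:] ^ m) (act [:- c, 1:] y) 0)"
    using act_linear_factor_Suc[of c _ y 0] by (simp add: shift_def)
  then have "geo c (\<lambda>m. act ([:- c, 1:] ^ m) y 0) (Suc j) = c *\<^sub>C y j + act [:- c, 1:] y j"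
    using Suc.IH[of y] Suc.IH[of "act [:- c, 1:] y"] by (simp del: power_Suc)
  then show ?case by (simp add: act_linear_factor)
qed simp

text \<open>
  For the first power this is division with remainder; raising \<open>1 - s = (X - c) r\<close> to the power \<open>M\<close>, where \<open>s\<close> is a
  multiple of \<open>b\<close>, gives the general case.
\<close>

lemma bezout_linear_power:
  fixes b :: "complex poly"
  assumes "poly b c \<noteq> 0"
  obtains u v where "u * [:- c, 1:] ^ M + v * b = 1"
proof -
  have "[:- c, 1:] dvd b - [:poly b c:]"
    by (simp add: poly_eq_0_iff_dvd[symmetric])
  then obtain r where r: "b - [:poly b c:] = [:- c, 1:] * r" by (rule dvdE)
  define s where "s = smult (1 / poly b c) b"
  have "1 - s = smult (- (1 / poly b c)) (b - [:poly b c:])"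
    using assms by (simp add: s_def smult_diff_right one_pCons)
  then have s: "1 - s = [:- c, 1:] * smult (- (1 / poly b c)) r" by (simp add: r)
  have "s dvd 1 - (1 - s) ^ M"
  proof (induction M)
    case (Suc M)
    have "1 - (1 - s) ^ Suc M = (1 - (1 - s) ^ M) + s * (1 - s) ^ M" by (simp add: algebra_simps)
    then show ?case using Suc by (metis dvd_add dvd_triv_left)
  qed simp
  moreover have "b dvd s" by (simp add: s_def dvd_smult)
  ultimately have "b dvd 1 - (1 - s) ^ M" by (rule dvd_trans[rotated])
  then obtain v where v: "1 - (1 - s) ^ M = b * v" by (rule dvdE)
  have "(smult (- (1 / poly b c)) r) ^ M * [:- c, 1:] ^ M + v * b = 1"
    using v s by (simp add: power_mult_distrib[symmetric] mult.commute) (simp add: algebra_simps)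
  then show ?thesis by (rule that)
qed

text \<open>Primary decomposition for the shift, with projections given by polynomials, hence linear.\<close>

lemma primary_decomposition:
  fixes S :: "complex set"
  assumes "finite S"
  obtains p where "\<And>(y :: nat \<Rightarrow> 'a::complex_inner) j.
      (\<And>j. act (\<Prod>c\<in>S. [:- c, 1:] ^ M) y j = 0) \<Longrightarrow> y j = (\<Sum>c\<in>S. act (p c) y j)"
    "\<And>(y :: nat \<Rightarrow> 'a) j c. (\<And>j. act (\<Prod>c\<in>S. [:- c, 1:] ^ M) y j = 0) \<Longrightarrow> c \<in> S \<Longrightarrow>
      act ([:- c, 1:] ^ M) (act (p c) y) j = 0"
proof -
  have "\<exists>p. \<forall>y :: nat \<Rightarrow> 'a. (\<forall>j. act (\<Prod>c\<in>S. [:- c, 1:] ^ M) y j = 0) \<longrightarrow>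
      (\<forall>j. y j = (\<Sum>c\<in>S. act (p c) y j)) \<and> (\<forall>c\<in>S. \<forall>j. act ([:- c, 1:] ^ M) (act (p c) y) j = 0)"
    using assms
  proof induction
    case empty
    show ?case by simp
  next
    case (insert c0 S)
    let ?b = "\<Prod>c\<in>S. [:- c, 1:] ^ M"
    let ?a = "[:- c0, 1:] ^ M"
    obtain p where p: "\<And>y :: nat \<Rightarrow> 'a. (\<forall>j. act ?b y j = 0) \<Longrightarrow>
      (\<forall>j. y j = (\<Sum>c\<in>S. act (p c) y j)) \<and> (\<forall>c\<in>S. \<forall>j. act ([:- c, 1:] ^ M) (act (p c) y) j = 0)"
      using insert.IH by metis
    have "poly ?b c0 \<noteq> 0" using insert by (auto simp: poly_prod)
    then obtain u v where uv: "u * ?a + v * ?b = 1" by (rule bezout_linear_power)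
    define p' where "p' c = (if c = c0 then v * ?b else p c * (u * ?a))" for c
    show ?case
    proof (intro exI[of _ p'] allI impI)
      fix y :: "nat \<Rightarrow> 'a" assume y: "\<forall>j. act (\<Prod>c\<in>insert c0 S. [:- c, 1:] ^ M) y j = 0"
      then have y0: "act (?a * ?b) y j = 0" for j using insert by simp
      have y1: "act ?b (act (u * ?a) y) j = 0" for j
        unfolding act_mult[symmetric] by (rule act_dvd_eq_0[OF _ y0]) (rule dvdI[of _ _ u], simp only: mult_ac)
      have y2: "act ?a (act (v * ?b) y) j = 0" for j
        unfolding act_mult[symmetric] by (rule act_dvd_eq_0[OF _ y0]) (rule dvdI[of _ _ v], simp only: mult_ac)
      have "y j = (\<Sum>c\<in>insert c0 S. act (p' c) y j)" for j
      proof -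
        have "y j = act (u * ?a) y j + act (v * ?b) y j"
          unfolding act_add[symmetric] uv by simp
        also have "act (u * ?a) y j = (\<Sum>c\<in>S. act (p c) (act (u * ?a) y) j)"
          using p[of "act (u * ?a) y"] y1 by blast
        also have "(\<Sum>c\<in>S. act (p c) (act (u * ?a) y) j) = (\<Sum>c\<in>S. act (p' c) y j)"
          using insert(2) by (intro sum.cong) (auto simp: p'_def act_mult)
        finally show ?thesis
          using insert(1,2) by (simp add: p'_def add.commute)
      qed
      moreover have "act ([:- c, 1:] ^ M) (act (p' c) y) j = 0" if "c \<in> insert c0 S" for c j
      proof (cases "c = c0")
        case True
        then show ?thesis using y2 by (simp add: p'_def)
      next
        case False
        have "act (p' c) y = act (p c) (act (u * ?a) y)"
          using False by (auto simp: p'_def act_mult)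
        then show ?thesis using p[of "act (u * ?a) y"] y1 that False by simp
      qed
      ultimately show "(\<forall>j. y j = (\<Sum>c\<in>insert c0 S. act (p' c) y j)) \<and>
        (\<forall>c\<in>insert c0 S. \<forall>j. act ([:- c, 1:] ^ M) (act (p' c) y) j = 0)" by blast
    qed
  qed
  then show ?thesis using that by metis
qed

lemma poly_dvd_prod_linear_powers:
  fixes P :: "complex poly"
  assumes "P \<noteq> 0"
  obtains S M where "finite S" "P dvd (\<Prod>c\<in>S. [:- c, 1:] ^ M)"
proof -
  have "\<exists>S M. finite S \<and> P dvd (\<Prod>c\<in>S. [:- c, 1:] ^ M)"
    using assms
  proof (induction "degree P" arbitrary: P)
    case 0
    then have "is_unit P" by (simp add: is_unit_iff_degree)
    then show ?case by (intro exI[of _ "{}"]) auto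
  next
    case (Suc d)
    then obtain c where "poly P c = 0"
      using fundamental_theorem_of_algebra[of P] constant_degree[of P] by (metis nat.distinct(1))
    then obtain r where r: "P = [:- c, 1:] * r" by (auto simp: poly_eq_0_iff_dvd)
    then have "r \<noteq> 0" using Suc by auto
    then have "degree r = d" using Suc(2) by (simp add: r degree_mult_eq del: mult_pCons_left)
    then obtain S M where SM: "finite S" "r dvd (\<Prod>c\<in>S. [:- c, 1:] ^ M)"
      using Suc(1)[of r] \<open>r \<noteq> 0\<close> by blast
    have "[:- c, 1:] * (\<Prod>c\<in>S. [:- c, 1:] ^ M) dvd (\<Prod>c\<in>insert c S. [:- c, 1:] ^ Suc M)"
    proof (cases "c \<in> S")
      case True
      have "(\<Prod>c\<in>S - {c}. [:- c, 1:] ^ M) dvd (\<Prod>c\<in>S - {c}. [:- c, 1:] ^ Suc M)"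
        by (rule prod_dvd_prod) (rule le_imp_power_dvd, simp)
      then have "[:- c, 1:] ^ Suc M * (\<Prod>c\<in>S - {c}. [:- c, 1:] ^ M) dvd
          [:- c, 1:] ^ Suc M * (\<Prod>c\<in>S - {c}. [:- c, 1:] ^ Suc M)"
        by (rule mult_dvd_mono[OF dvd_refl])
      moreover have "insert c S = S" using True by auto
      ultimately show ?thesis using SM(1) True
        by (simp add: prod.remove[of S c] mult.assoc[symmetric] power_Suc[symmetric] del: mult_pCons_left power_Suc)
    next
      case False
      have "(\<Prod>c\<in>S. [:- c, 1:] ^ M) dvd (\<Prod>c\<in>S. [:- c, 1:] ^ Suc M)"
        by (rule prod_dvd_prod) (rule le_imp_power_dvd, simp)
      then have "[:- c, 1:] * (\<Prod>c\<in>S. [:- c, 1:] ^ M) dvd [:- c, 1:] ^ Suc M * (\<Prod>c\<in>S. [:- c, 1:] ^ Suc M)"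
        by (rule mult_dvd_mono[rotated]) (metis dvd_triv_left power_Suc)
      then show ?thesis using SM(1) False by (simp del: mult_pCons_left power_Suc)
    qed
    moreover have "P dvd [:- c, 1:] * (\<Prod>c\<in>S. [:- c, 1:] ^ M)"
      unfolding r by (rule mult_dvd_mono[OF dvd_refl SM(2)])
    ultimately have "P dvd (\<Prod>c\<in>insert c S. [:- c, 1:] ^ Suc M)" by (rule dvd_trans[rotated])
    then show ?case using SM(1) by (intro exI[of _ "insert c S"] exI[of _ "Suc M"]) auto
  qed
  then show ?thesis using that by blast
qed

interpretation seqv: vector_space "\<lambda>a (y :: nat \<Rightarrow> 'a::complex_inner) j. a *\<^sub>C y j"
  by unfold_locales (auto simp: scaleC_add_left scaleC_add_right scaleC_scaleC fun_eq_iff)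

lemma sum_fun_apply: "(\<Sum>i\<in>I. f i) j = (\<Sum>i\<in>I. f i j)"
  by (induction I rule: infinite_finite_induct) auto

lemma act_sum_monom: "act (\<Sum>i\<in>I. monom (a i) (e i)) y j = (\<Sum>i\<in>I. a i *\<^sub>C y (e i + j))"
proof -
  have "act (monom a i) y j = a *\<^sub>C y (i + j)" for a i
  proof (induction i arbitrary: j)
    case (Suc i)
    then show ?case by (simp add: monom_Suc act_pCons)
  qed (simp add: monom_0 act_pCons)
  then show ?thesis by (induction I rule: infinite_finite_induct) (auto simp: act_add)
qed

text \<open>
  Too many shifts of \<open>y\<close> in a finite-dimensional space are linearly dependent; a relation among them is an
  annihilating polynomial.
\<close>

lemma annihilator_exists:
  fixes B :: "(nat \<Rightarrow> 'a::complex_inner) set"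
  assumes B: "finite B" and sub: "\<And>i. shift i y \<in> seqv.span B"
  obtains p where "p \<noteq> 0" "\<And>j. act p y j = 0"
proof (cases "inj_on (\<lambda>i. shift i y) {..card B}")
  case False
  then obtain i k where ik: "i \<noteq> k" "shift i y = shift k y" by (auto simp: inj_on_def)
  let ?p = "monom 1 i + smult (- 1) (monom 1 k) :: complex poly"
  have "act ?p y j = 0" for j
    using fun_cong[OF ik(2), of j] act_sum_monom[of "\<lambda>_. 1" id "{i}" y j]
      act_sum_monom[of "\<lambda>_. 1" id "{k}" y j]
    by (simp only: act_add act_smult) (simp add: complex_vector.scale_minus_left)
  moreover have "?p \<noteq> 0"
  proof
    assume "?p = 0"
    then have "coeff ?p i = 0" by simp
    then show False using ik(1) by simp
  qed
  ultimately show ?thesis using that by blast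
next
  case True
  let ?S = "(\<lambda>i. shift i y) ` {..card B}"
  have "card ?S = Suc (card B)" using card_image[OF True] by simp
  moreover have "?S \<subseteq> seqv.span B" using sub by auto
  ultimately have "seqv.dependent ?S"
    using seqv.independent_span_bound[OF B] by force
  then obtain u where u: "\<exists>v\<in>?S. u v \<noteq> 0" "(\<Sum>v\<in>?S. (\<lambda>j. u v *\<^sub>C v j)) = (0 :: nat \<Rightarrow> 'a)"
    using seqv.dependent_finite[of ?S] by auto
  let ?p = "\<Sum>i\<le>card B. monom (u (shift i y)) i"
  have "act ?p y j = 0" for j
  proof -
    have "act ?p y j = (\<Sum>i\<le>card B. u (shift i y) *\<^sub>C shift i y j)"
      using act_sum_monom[of "\<lambda>i. u (shift i y)" "\<lambda>i. i" "{..card B}" y j] by simp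
    also have "\<dots> = (\<Sum>v\<in>?S. u v *\<^sub>C v j)"
      using sum.reindex[OF True, of "\<lambda>v. u v *\<^sub>C v j"] by simp
    also have "\<dots> = (\<Sum>v\<in>?S. (\<lambda>j. u v *\<^sub>C v j)) j" by (simp only: sum_fun_apply)
    finally show ?thesis by (simp only: u(2) zero_fun_def)
  qed
  moreover have "?p \<noteq> 0"
  proof
    assume p: "?p = 0"
    obtain i where "i \<le> card B" "u (shift i y) \<noteq> 0" using u(1) by auto
    then have "coeff ?p i \<noteq> 0" by (simp add: coeff_sum)
    then show False using p by simp
  qed
  ultimately show ?thesis using that by blast
qed

lemma annihilator_of_span_exists:
  fixes B :: "(nat \<Rightarrow> 'a::complex_inner) set"
  assumes B: "finite B" and sub: "\<And>i y. y \<in> B \<Longrightarrow> shift i y \<in> seqv.span B"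
  obtains p where "p \<noteq> 0" "\<And>y j. y \<in> seqv.span B \<Longrightarrow> act p y j = 0"
proof -
  have "\<forall>y\<in>B. \<exists>p. p \<noteq> 0 \<and> (\<forall>j. act p y j = 0)"
    using annihilator_exists[OF B] sub by metis
  then obtain P where P: "\<And>y. y \<in> B \<Longrightarrow> P y \<noteq> 0" "\<And>y j. y \<in> B \<Longrightarrow> act (P y) y j = 0" by metis
  let ?p = "\<Prod>y\<in>B. P y"
  have "act ?p y = (\<lambda>_. 0)" if "y \<in> B" for y
  proof
    have "P y dvd ?p" using B that by (rule dvd_prodI)
    then show "act ?p y j = 0" for j by (rule act_dvd_eq_0) (rule P(2)[OF that])
  qed
  moreover have "seqv.subspace {y :: nat \<Rightarrow> 'a. act ?p y = (\<lambda>_. 0)}"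
  proof (rule seqv.subspaceI)
    show "0 \<in> {y. act ?p y = (\<lambda>_. 0 :: 'a)}" by (simp add: zero_fun_def)
    fix x y :: "nat \<Rightarrow> 'a" assume "x \<in> {y. act ?p y = (\<lambda>_. 0)}" "y \<in> {y. act ?p y = (\<lambda>_. 0)}"
    then show "x + y \<in> {y. act ?p y = (\<lambda>_. 0)}"
      using act_add_right[of ?p x y] by (auto simp: plus_fun_def fun_eq_iff)
  next
    fix a and x :: "nat \<Rightarrow> 'a" assume "x \<in> {y. act ?p y = (\<lambda>_. 0)}"
    then show "(\<lambda>j. a *\<^sub>C x j) \<in> {y. act ?p y = (\<lambda>_. 0)}"
      using act_scaleC_right[of ?p a x] by (auto simp: fun_eq_iff)
  qed
  ultimately have "seqv.span B \<subseteq> {y. act ?p y = (\<lambda>_. 0)}"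
    by (intro seqv.span_minimal) auto
  moreover have "?p \<noteq> 0" using B P(1) by auto
  ultimately show ?thesis using that[of ?p] by (auto simp: fun_eq_iff)
qed


section \<open>Solutions of the recurrence\<close>

definition recurrence :: "(nat \<Rightarrow> 'a \<Rightarrow> 'a::complex_inner) \<Rightarrow> nat \<Rightarrow> (nat \<Rightarrow> 'a) \<Rightarrow> bool" where
  "recurrence A n y \<longleftrightarrow> (\<forall>j. (\<Sum>k\<le>n. A k (y (j + k))) = 0)"

text \<open>
  With \<open>A_s(c)\<close> for the Taylor coefficients of the pencil at \<open>c\<close>, the condition says
  \<open>\<Sum>s. A_s(c) (\<xi> (g + s)) = 0\<close> for all \<open>g\<close>: the sequence \<open>\<xi>\<close> is a Jordan chain read from its end. Written with \<open>geo\<close> it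
  needs no derivatives.
\<close>

definition root_seq :: "(nat \<Rightarrow> 'a \<Rightarrow> 'a::complex_inner) \<Rightarrow> nat \<Rightarrow> complex \<Rightarrow> (nat \<Rightarrow> 'a) \<Rightarrow> bool" where
  "root_seq A n c \<xi> \<longleftrightarrow> (\<forall>g. (\<Sum>k\<le>n. A k (geo c (shift g \<xi>) k)) = 0)"

text \<open>
  Continues given initial values by the recurrence, when \<open>T\<close> inverts the leading coefficient.
\<close>

fun extend :: "(nat \<Rightarrow> 'a \<Rightarrow> 'a) \<Rightarrow> ('a \<Rightarrow> 'a) \<Rightarrow> nat \<Rightarrow> (nat \<Rightarrow> 'a) \<Rightarrow> nat \<Rightarrow> 'a::complex_inner" where
  "extend A T n \<tau> j = (if j < n then \<tau> j else - T (\<Sum>k<n. A k (extend A T n \<tau> (j - n + k))))"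

declare extend.simps [simp del]

locale linear_pencil =
  fixes A :: "nat \<Rightarrow> 'a::fin_complex_hilbert \<Rightarrow> 'a" and n :: nat
  assumes lin: "\<And>k. k \<le> n \<Longrightarrow> clinear (A k)"
begin

lemma A_rules:
  assumes "k \<le> n"
  shows "A k (x + y) = A k x + A k y" "A k (a *\<^sub>C x) = a *\<^sub>C A k x" "A k 0 = 0" "A k (- x) = - A k x"
    "A k (x - y) = A k x - A k y" "A k (\<Sum>i\<in>I. g i) = (\<Sum>i\<in>I. A k (g i))"
  using clinear_rules[OF lin[OF assms]] by metis+

lemma recurrence_add: "recurrence A n y \<Longrightarrow> recurrence A n z \<Longrightarrow> recurrence A n (\<lambda>j. y j + z j)"
  by (simp add: recurrence_def A_rules sum.distrib)

lemma recurrence_diff: "recurrence A n y \<Longrightarrow> recurrence A n z \<Longrightarrow> recurrence A n (\<lambda>j. y j - z j)"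
  by (simp add: recurrence_def A_rules sum_subtractf)

lemma recurrence_scaleC: "recurrence A n y \<Longrightarrow> recurrence A n (\<lambda>j. a *\<^sub>C y j)"
  by (simp add: recurrence_def A_rules flip: complex_vector.scale_sum_right)

lemma recurrence_zero: "recurrence A n (\<lambda>j. 0)"
  by (simp add: recurrence_def A_rules)

lemma recurrence_shift: "recurrence A n y \<Longrightarrow> recurrence A n (shift g y)"
  by (simp add: recurrence_def flip: add.assoc)

lemma recurrence_sum: "(\<And>i. i \<in> I \<Longrightarrow> recurrence A n (y i)) \<Longrightarrow> recurrence A n (\<lambda>j. \<Sum>i\<in>I. y i j)"
  by (induction I rule: infinite_finite_induct) (auto simp: recurrence_zero recurrence_add)

lemma recurrence_act: "recurrence A n y \<Longrightarrow> recurrence A n (act p y)"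
  unfolding act_def
  by (intro recurrence_sum recurrence_scaleC) (use recurrence_shift in \<open>auto simp: shift_def\<close>)

text \<open>
  The entries at \<open>0\<close> of the powers of the shift minus \<open>c\<close> form the sequence by which \<open>eq_geo_act\<close> represents \<open>y\<close>; since
  these powers preserve the recurrence, all its shifts satisfy the condition.
\<close>

lemma recurrence_root_seq:
  assumes "recurrence A n y"
  shows "root_seq A n c (\<lambda>m. act ([:- c, 1:] ^ m) y 0)"
  unfolding root_seq_def
proof
  fix g
  define z where "z = act ([:- c, 1:] ^ g) y"
  have "shift g (\<lambda>m. act ([:- c, 1:] ^ m) y 0) = (\<lambda>m. act ([:- c, 1:] ^ m) z 0)"
    by (simp add: shift_def z_def power_add add.commute[of g] flip: act_mult)
  then have "geo c (shift g (\<lambda>m. act ([:- c, 1:] ^ m) y 0)) k = z k" for k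
    using eq_geo_act[of z k c] by simp
  then show "(\<Sum>k\<le>n. A k (geo c (shift g (\<lambda>m. act ([:- c, 1:] ^ m) y 0)) k)) = 0"
    using recurrence_act[OF assms, of "[:- c, 1:] ^ g"] unfolding z_def[symmetric] recurrence_def
    by (simp only:) (drule spec[of _ 0], simp only: add_0)
qed

lemma root_seq_zero: "root_seq A n c (\<lambda>_. 0)"
  by (simp add: root_seq_def A_rules)

lemma root_seq_add: "root_seq A n c \<xi> \<Longrightarrow> root_seq A n c \<eta> \<Longrightarrow> root_seq A n c (\<lambda>m. \<xi> m + \<eta> m)"
  by (simp add: root_seq_def shift_add geo_add A_rules sum.distrib del: shift_apply)

lemma shift_diff: "shift g (\<lambda>m. \<xi> m - \<eta> m) = (\<lambda>m. shift g \<xi> m - shift g \<eta> m)"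
  by (simp add: shift_def)

lemma root_seq_diff: "root_seq A n c \<xi> \<Longrightarrow> root_seq A n c \<eta> \<Longrightarrow> root_seq A n c (\<lambda>m. \<xi> m - \<eta> m)"
  by (simp add: root_seq_def shift_diff geo_diff A_rules sum_subtractf del: shift_apply)

lemma root_seq_scaleC: "root_seq A n c \<xi> \<Longrightarrow> root_seq A n c (\<lambda>m. a *\<^sub>C \<xi> m)"
proof -
  have "shift g (\<lambda>m. a *\<^sub>C \<xi> m) = (\<lambda>m. a *\<^sub>C shift g \<xi> m)" for g by (simp add: shift_def)
  then show "root_seq A n c \<xi> \<Longrightarrow> root_seq A n c (\<lambda>m. a *\<^sub>C \<xi> m)"
    by (simp add: root_seq_def geo_scaleC A_rules del: shift_apply flip: complex_vector.scale_sum_right)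
qed

lemma root_seq_sum: "(\<And>i. i \<in> I \<Longrightarrow> root_seq A n c (\<xi> i)) \<Longrightarrow> root_seq A n c (\<lambda>m. \<Sum>i\<in>I. \<xi> i m)"
  by (induction I rule: infinite_finite_induct) (auto simp: root_seq_zero root_seq_add)

lemma pencil_clinear: "clinear (pencil A n c)"
  by (rule clinearI)
    (simp_all add: pencil_def A_rules scaleC_add_right sum.distrib scaleC_scaleC mult.commute
      complex_vector.scale_sum_right)

lemma geo_eigen: "geo c (\<lambda>m. if m = 0 then x else 0) j = c ^ j *\<^sub>C x"
proof (induction j)
  case (Suc j)
  have "shift 1 (\<lambda>m. if m = 0 then x else 0) = (\<lambda>_. 0)" by (auto simp: shift_def)
  then show ?case by (simp add: Suc scaleC_scaleC)
qed simp

text \<open>The last nonzero entry of a finite root sequence is an eigenvector.\<close>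

lemma root_seq_eq_0:
  assumes root: "root_seq A n c \<xi>" and fin: "\<And>m. m \<ge> M \<Longrightarrow> \<xi> m = 0"
    and noneig: "\<not> eigenvalue (pencil A n) c"
  shows "\<xi> m = 0"
proof (rule ccontr)
  assume "\<xi> m \<noteq> 0"
  define g where "g = Max {m. \<xi> m \<noteq> 0}"
  have finS: "finite {m. \<xi> m \<noteq> 0}"
    by (rule finite_subset[of _ "{..<M}"]) (use fin not_le in auto)
  have "{m. \<xi> m \<noteq> 0} \<noteq> {}" using \<open>\<xi> m \<noteq> 0\<close> by blast
  from Max_in[OF finS this] have g1: "\<xi> g \<noteq> 0" unfolding g_def by blast
  have g2: "\<xi> m = 0" if "m > g" for m
  proof (rule ccontr)
    assume "\<xi> m \<noteq> 0"
    then have "m \<le> g" unfolding g_def by (intro Max_ge[OF finS]) blast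
    then show False using that by simp
  qed
  have "shift g \<xi> = (\<lambda>m. if m = 0 then \<xi> g else 0)" using g2 by (auto simp: shift_def)
  then have "pencil A n c (\<xi> g) = 0"
    using spec[OF root[unfolded root_seq_def], of g] by (simp add: pencil_def geo_eigen A_rules)
  then show False using noneig g1 by (auto simp: eigenvalue_def)
qed

end

locale regular_pencil = linear_pencil +
  assumes leading_inj: "\<And>x. A n x = 0 \<Longrightarrow> x = 0"
begin

lemma recurrence_eq_0:
  assumes y: "recurrence A n y" and 0: "\<And>j. j < n \<Longrightarrow> y j = 0"
  shows "y j = 0"
proof (induction j rule: less_induct)
  case (less j)
  show ?case
  proof (cases "j < n")
    case False
    have "(\<Sum>k\<le>n. A k (y (j - n + k))) = 0" using y by (auto simp: recurrence_def)
    moreover have "(\<Sum>k<n. A k (y (j - n + k))) = 0"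
      using less False by (intro sum.neutral) (auto simp: A_rules)
    ultimately have "A n (y j) = 0" using False by (simp add: lessThan_Suc_atMost[symmetric])
    then show ?thesis by (rule leading_inj)
  qed (rule 0)
qed

lemma recurrence_unique:
  assumes "recurrence A n y" "recurrence A n z" "\<And>j. j < n \<Longrightarrow> y j = z j"
  shows "y j = z j"
  using recurrence_eq_0[OF recurrence_diff[OF assms(1,2)], of j] assms(3) by auto

definition ext :: "(nat \<Rightarrow> 'a) \<Rightarrow> nat \<Rightarrow> 'a" where
  "ext = extend A (SOME T. clinear T \<and> (\<forall>x. A n (T x) = x)) n"

lemma ext_less: "j < n \<Longrightarrow> ext \<tau> j = \<tau> j"
  by (simp add: ext_def extend.simps)

lemma ext_recurrence: "recurrence A n (ext \<tau>)"
  unfolding recurrence_def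
proof
  fix j
  define T where "T = (SOME T. clinear T \<and> (\<forall>x. A n (T x) = x))"
  have "\<exists>T. clinear T \<and> (\<forall>x. A n (T x) = x)"
    by (rule clinear_inj_inverse[OF lin[OF order_refl] leading_inj]) auto
  then have T: "A n (T x) = x" for x unfolding T_def by (rule someI2_ex) auto
  have "ext \<tau> (j + n) = - T (\<Sum>k<n. A k (ext \<tau> (j + k)))"
    unfolding ext_def T_def[symmetric] by (subst extend.simps) simp
  then show "(\<Sum>k\<le>n. A k (ext \<tau> (j + k))) = 0"
    by (simp add: lessThan_Suc_atMost[symmetric] A_rules T)
qed

lemma ext_add: "ext (\<lambda>j. \<sigma> j + \<tau> j) j = ext \<sigma> j + ext \<tau> j"
  by (rule recurrence_unique[OF ext_recurrence recurrence_add[OF ext_recurrence ext_recurrence]])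
    (simp add: ext_less)

lemma ext_scaleC: "ext (\<lambda>j. a *\<^sub>C \<tau> j) j = a *\<^sub>C ext \<tau> j"
  by (rule recurrence_unique[OF ext_recurrence recurrence_scaleC[OF ext_recurrence]])
    (simp add: ext_less)

lemma recurrence_finite_span:
  obtains B where "finite B" "\<And>y. recurrence A n y \<longleftrightarrow> y \<in> seqv.span B"
proof -
  obtain E :: "'a set" where E: "finite E" "\<And>x. x = (\<Sum>e\<in>E. cinner x e *\<^sub>C e)"
    using orthonormal_basis by metis
  define b where "b = (\<lambda>(i, e :: 'a). ext (\<lambda>j. if j = i then e else 0))"
  let ?B = "b ` ({..<n} \<times> E)"
  have fin: "finite ({..<n} \<times> E)" using E(1) by simp
  have "y \<in> seqv.span ?B" if y: "recurrence A n y" for y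
  proof -
    have eq: "y j = (\<Sum>(i, e)\<in>{..<n} \<times> E. cinner (y i) e *\<^sub>C b (i, e) j)" for j
    proof (rule recurrence_unique[OF y])
      show "recurrence A n (\<lambda>j. \<Sum>(i, e)\<in>{..<n} \<times> E. cinner (y i) e *\<^sub>C b (i, e) j)"
        unfolding case_prod_unfold by (intro recurrence_sum recurrence_scaleC) (simp add: b_def case_prod_unfold ext_recurrence)
      fix j assume j: "j < n"
      have "(\<Sum>(i, e)\<in>{..<n} \<times> E. cinner (y i) e *\<^sub>C b (i, e) j) =
          (\<Sum>i<n. \<Sum>e\<in>E. cinner (y i) e *\<^sub>C (if j = i then e else 0))"
        unfolding b_def by (simp add: sum.cartesian_product ext_less[OF j])
      also have "\<dots> = (\<Sum>i<n. if i = j then \<Sum>e\<in>E. cinner (y i) e *\<^sub>C e else 0)"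
        by (intro sum.cong) auto
      also have "\<dots> = y j" using j E(2)[of "y j"] by simp
      finally show "y j = (\<Sum>(i, e)\<in>{..<n} \<times> E. cinner (y i) e *\<^sub>C b (i, e) j)" by simp
    qed
    have "y = (\<Sum>(i, e)\<in>{..<n} \<times> E. (\<lambda>j. cinner (y i) e *\<^sub>C b (i, e) j))"
    proof
      fix j
      show "y j = (\<Sum>(i, e)\<in>{..<n} \<times> E. (\<lambda>j. cinner (y i) e *\<^sub>C b (i, e) j)) j"
        using eq[of j] by (simp only: sum_fun_apply case_prod_unfold)
    qed
    also have "\<dots> \<in> seqv.span ?B"
      unfolding case_prod_unfold
      by (intro seqv.span_sum seqv.span_scale seqv.span_base) auto
    finally show ?thesis .
  qed
  moreover have "recurrence A n y" if "y \<in> seqv.span ?B" for y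
  proof -
    have "seqv.subspace {y. recurrence A n y}"
      using recurrence_add recurrence_scaleC recurrence_zero
      by (auto intro!: seqv.subspaceI simp: plus_fun_def zero_fun_def)
    moreover have "?B \<subseteq> {y. recurrence A n y}" by (auto simp: b_def ext_recurrence)
    ultimately show ?thesis using that seqv.span_minimal by blast
  qed
  moreover have "finite ?B" using fin by simp
  ultimately show ?thesis by (intro that[of ?B]) blast+
qed

text \<open>
  Every solution is a sum of root sequences, one for each eigenvalue. The projections are
  polynomials in the shift; therefore they are linear and preserve the recurrence.
\<close>

lemma root_decomposition:
  obtains S M R where "finite S" "\<And>c. eigenvalue (pencil A n) c \<Longrightarrow> c \<in> S"
    "\<And>y c. recurrence A n y \<Longrightarrow> root_seq A n c (R y c)"
    "\<And>y c m. recurrence A n y \<Longrightarrow> m \<ge> M \<Longrightarrow> R y c m = 0"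
    "\<And>y j. recurrence A n y \<Longrightarrow> y j = (\<Sum>c\<in>S. geo c (R y c) j)"
    "\<And>y z c m. R (\<lambda>j. y j + z j) c m = R y c m + R z c m"
    "\<And>a y c m. R (\<lambda>j. a *\<^sub>C y j) c m = a *\<^sub>C R y c m"
proof -
  obtain B where B: "finite B" "\<And>y. recurrence A n y \<longleftrightarrow> y \<in> seqv.span B"
    by (rule recurrence_finite_span) blast
  have "shift i y \<in> seqv.span B" if "y \<in> B" for i y
    using B(2) recurrence_shift seqv.span_base[OF that] by blast
  then obtain P where P: "P \<noteq> 0" "\<And>y j. y \<in> seqv.span B \<Longrightarrow> act P y j = 0"
    using annihilator_of_span_exists[OF B(1)] by metis
  obtain S M where SM: "finite S" "P dvd (\<Prod>c\<in>S. [:- c, 1:] ^ M)"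
    using poly_dvd_prod_linear_powers[OF P(1)] by metis
  have ann: "act (\<Prod>c\<in>S. [:- c, 1:] ^ M) y j = 0" if "recurrence A n y" for y j
    by (rule act_dvd_eq_0[OF SM(2) P(2)]) (use that B in auto)
  obtain p where p: "\<And>(y :: nat \<Rightarrow> 'a) j. (\<And>j. act (\<Prod>c\<in>S. [:- c, 1:] ^ M) y j = 0) \<Longrightarrow>
      y j = (\<Sum>c\<in>S. act (p c) y j)"
    "\<And>(y :: nat \<Rightarrow> 'a) j c. (\<And>j. act (\<Prod>c\<in>S. [:- c, 1:] ^ M) y j = 0) \<Longrightarrow> c \<in> S \<Longrightarrow>
      act ([:- c, 1:] ^ M) (act (p c) y) j = 0"
    using primary_decomposition[OF SM(1)] by metis
  define R where "R y c m = (if c \<in> S then act ([:- c, 1:] ^ m) (act (p c) y) 0 else 0)" for y :: "nat \<Rightarrow> 'a" and c m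
  show ?thesis
  proof (rule that[of S R M])
    show "finite S" by (rule SM)
  next
    fix c assume "eigenvalue (pencil A n) c"
    then obtain x where x: "x \<noteq> 0" "pencil A n c x = 0" by (auto simp: eigenvalue_def)
    have rec: "recurrence A n (\<lambda>j. c ^ j *\<^sub>C x)"
      unfolding recurrence_def
    proof
      fix j
      have "(\<Sum>k\<le>n. A k (c ^ (j + k) *\<^sub>C x)) = c ^ j *\<^sub>C pencil A n c x"
        by (simp add: pencil_def complex_vector.scale_sum_right A_rules scaleC_scaleC power_add)
      then show "(\<Sum>k\<le>n. A k (c ^ (j + k) *\<^sub>C x)) = 0" by (simp add: x)
    qed
    have geo_act: "act q (\<lambda>j. c ^ j *\<^sub>C x) 0 = poly q c *\<^sub>C x" for q
      by (simp add: act_def poly_altdef complex_vector.scale_sum_left scaleC_scaleC)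
    have "poly (\<Prod>c\<in>S. [:- c, 1:] ^ M) c = 0"
      using ann[OF rec, of 0] x by (simp add: geo_act)
    then show "c \<in> S" using SM(1) by (auto simp: poly_prod)
  next
    fix y c assume "recurrence A n y"
    then show "root_seq A n c (R y c)"
      using recurrence_root_seq[OF recurrence_act, of y c "p c"] root_seq_zero[of c]
      unfolding R_def by (cases "c \<in> S") simp_all
  next
    fix y c m assume "recurrence A n y" "M \<le> m"
    then have "act ([:- c, 1:] ^ m) (act (p c) y) 0 = 0" if "c \<in> S"
      by (intro act_dvd_eq_0[OF le_imp_power_dvd, of M m] p(2) ann that)
    then show "R y c m = 0" by (simp add: R_def)
  next
    fix y j assume y: "recurrence A n y"
    have "(\<Sum>c\<in>S. geo c (R y c) j) = (\<Sum>c\<in>S. act (p c) y j)"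
      unfolding R_def by (intro sum.cong) (simp_all add: eq_geo_act[symmetric])
    then show "y j = (\<Sum>c\<in>S. geo c (R y c) j)" using p(1)[of y j] ann[OF y] by simp
  next
    fix y z :: "nat \<Rightarrow> 'a" and c m
    have "act (p c) (\<lambda>j. y j + z j) = (\<lambda>j. act (p c) y j + act (p c) z j)"
      by (rule ext) (rule act_add_right)
    then show "R (\<lambda>j. y j + z j) c m = R y c m + R z c m"
      by (simp add: R_def act_add_right)
  next
    fix a and y :: "nat \<Rightarrow> 'a" and c m
    have "act (p c) (\<lambda>j. a *\<^sub>C y j) = (\<lambda>j. a *\<^sub>C act (p c) y j)"
      by (rule ext) (rule act_scaleC_right)
    then show "R (\<lambda>j. a *\<^sub>C y j) c m = a *\<^sub>C R y c m"
      by (simp add: R_def act_scaleC_right)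
  qed
qed

end


section \<open>Analytic tools\<close>

text \<open>
  The lowest nonzero coefficient dominates near zero. Orders of vanishing are used throughout in this form, with
  estimates on one side of zero only.
\<close>

lemma coefficients_eq_0_if_small:
  fixes a :: "nat \<Rightarrow> 'b::real_normed_vector"
  assumes \<delta>: "\<delta> > 0" and small: "\<And>t. 0 < t \<Longrightarrow> t < \<delta> \<Longrightarrow> norm (\<Sum>g<D. t ^ g *\<^sub>R a g) \<le> K * t ^ p"
    and g: "g < D" "g < p"
  shows "a g = 0"
  using g
proof (induction g rule: less_induct)
  case (less g)
  have *: "norm (\<Sum>h\<in>{g..<D}. t ^ (h - g) *\<^sub>R a h) \<le> K * t ^ (p - g)" if t: "0 < t" "t < \<delta>" for t
  proof -
    have "(\<Sum>h<D. t ^ h *\<^sub>R a h) = (\<Sum>h\<in>{g..<D}. t ^ h *\<^sub>R a h)"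
      using less by (intro sum.mono_neutral_right) auto
    also have "\<dots> = t ^ g *\<^sub>R (\<Sum>h\<in>{g..<D}. t ^ (h - g) *\<^sub>R a h)"
      by (simp add: scaleR_sum_right power_add[symmetric])
    finally have "t ^ g * norm (\<Sum>h\<in>{g..<D}. t ^ (h - g) *\<^sub>R a h) \<le> t ^ g * (K * t ^ (p - g))"
      using small[OF t] less(3) t by (simp add: power_add[symmetric] mult.left_commute)
    then show ?thesis using t by simp
  qed
  have "((\<lambda>t. norm (\<Sum>h\<in>{g..<D}. t ^ (h - g) *\<^sub>R a h)) \<longlongrightarrow>
      norm (\<Sum>h\<in>{g..<D}. 0 ^ (h - g) *\<^sub>R a h)) (at_right 0)"
    by (intro tendsto_intros tendsto_ident_at)
  moreover have "((\<lambda>t. K * t ^ (p - g)) \<longlongrightarrow> K * 0 ^ (p - g)) (at_right (0 :: real))"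
    by (intro tendsto_intros tendsto_ident_at)
  moreover have "eventually (\<lambda>t. norm (\<Sum>h\<in>{g..<D}. t ^ (h - g) *\<^sub>R a h) \<le> K * t ^ (p - g)) (at_right 0)"
    unfolding eventually_at_right_field using \<delta> * by blast
  ultimately have "norm (\<Sum>h\<in>{g..<D}. 0 ^ (h - g) *\<^sub>R a h) \<le> K * 0 ^ (p - g)"
    by (intro tendsto_le[of "at_right (0::real)"]) auto
  moreover have "(\<Sum>h\<in>{g..<D}. 0 ^ (h - g) *\<^sub>R a h) = a g"
  proof -
    have "(\<Sum>h\<in>{g..<D}. 0 ^ (h - g) *\<^sub>R a h) = (\<Sum>h\<in>{g..<D}. if h = g then a g else 0)"
      by (intro sum.cong) (auto simp: power_0_left)
    then show ?thesis using less(2) by simp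
  qed
  ultimately show "a g = 0" using less(3) by (simp add: power_0_left)
qed

text \<open>
  The function is only bounded, so the half plane needs a Phragmen--Lindelof argument: the factor
  \<open>1 / (w + \<i>)\<close> makes \<open>exp (-\<i> N g(w))\<close> small at infinity, and its influence at a fixed point disappears as
  \<open>N\<close> grows.
\<close>

lemma half_plane_maximum:
  assumes hol: "g holomorphic_on {z. 0 < Im z}" and cont: "continuous_on {z. 0 \<le> Im z} g"
    and bdd: "\<And>z. 0 \<le> Im z \<Longrightarrow> norm (g z) \<le> C"
    and real: "\<And>x::real. Im (g (of_real x)) \<le> 0" and z: "0 < Im z"
  shows "Im (g z) \<le> 0"
proof (rule ccontr)
  assume "\<not> Im (g z) \<le> 0"
  then have pos: "Im (g z) > 0" by simp
  obtain N :: nat where N: "norm (z + \<i>) < real N * Im (g z)" using reals_Archimedean3[OF pos] by blast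
  define h where "h w = exp (- \<i> * of_nat N * g w) / (w + \<i>)" for w
  have nz: "w + \<i> \<noteq> 0" if "0 \<le> Im w" for w using that by (auto simp: complex_eq_iff)
  have norm_h: "norm (h w) = exp (real N * Im (g w)) / norm (w + \<i>)" for w
    by (simp add: h_def norm_divide)
  define r where "r = norm z + exp (real N * C) + 2"
  define S where "S = {z. 0 < Im z} \<inter> ball 0 r"
  have openS: "open S" unfolding S_def by (intro open_Int open_halfspace_Im_gt open_ball)
  have closS: "closure S \<subseteq> {z. 0 \<le> Im z} \<inter> cball 0 r"
  proof (rule closure_minimal)
    have "{z. 0 \<le> Im z} = {z. Im z \<ge> 0}" by auto
    then show "closed ({z. 0 \<le> Im z} \<inter> cball 0 r)"
      using closed_halfspace_Im_ge[of 0] by (intro closed_Int) auto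
  qed (auto simp: S_def)
  have "norm (h z) \<le> 1"
  proof (rule maximum_modulus_frontier[of h S])
    show "h holomorphic_on interior S"
      unfolding h_def interior_open[OF openS]
      by (intro holomorphic_intros holomorphic_on_subset[OF hol]) (use nz in \<open>auto simp: S_def\<close>)
    show "continuous_on (closure S) h"
      unfolding h_def
      by (intro continuous_intros continuous_on_subset[OF cont]) (use nz closS in auto)
    show "bounded S" by (auto simp: S_def)
    show "z \<in> S" using z by (auto simp: S_def r_def add_pos_pos)
    fix w assume "w \<in> frontier S"
    then have w: "0 \<le> Im w" "norm w \<le> r" "w \<notin> S"
      using closS by (auto simp: frontier_def interior_open[OF openS])
    have "exp (real N * Im (g w)) \<le> norm (w + \<i>)"
    proof (cases "Im w = 0")
      case True
      then have wr: "w = of_real (Re w)" by (simp add: complex_eq_iff)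
      then have "Im (g w) \<le> 0" using real[of "Re w"] by simp
      then have "exp (real N * Im (g w)) \<le> 1" by (simp add: mult_nonneg_nonpos)
      also have "1 \<le> norm (w + \<i>)"
        using abs_Im_le_cmod[of "w + \<i>"] True by simp
      finally show ?thesis .
    next
      case False
      then have "norm w = r" using w by (auto simp: S_def)
      have "Im (g w) \<le> C" using bdd[OF w(1)] abs_Im_le_cmod[of "g w"] by linarith
      then have "exp (real N * Im (g w)) \<le> exp (real N * C)" by (simp add: mult_left_mono)
      also have "\<dots> \<le> norm w - norm \<i>" unfolding \<open>norm w = r\<close> r_def by simp
      also have "\<dots> \<le> norm (w + \<i>)" by (metis norm_diff_ineq)
      finally show ?thesis .
    qed
    then show "norm (h w) \<le> 1" unfolding norm_h using nz[OF w(1)] by simp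
  qed
  then have "exp (real N * Im (g z)) \<le> norm (z + \<i>)"
    unfolding norm_h using nz[of z] z by (simp add: divide_le_eq)
  moreover have "real N * Im (g z) < exp (real N * Im (g z))"
    using exp_ge_add_one_self[of "real N * Im (g z)"] by linarith
  ultimately show False using N by linarith
qed

text \<open>
  The function \<open>g\<close> below is $(\lambda^2+1)f$ minus the poles of that product. It vanishes at
  \<open>\<i>\<close> up to the contribution of the residues, whose sign contradicts the maximum principle unless
  they are all zero.
\<close>

lemma half_plane_rigidity:
  fixes G :: "complex \<Rightarrow> complex" and R :: "real set" and \<rho> :: "real \<Rightarrow> real"
  assumes R: "finite R" and \<rho>: "\<And>c. c \<in> R \<Longrightarrow> 0 \<le> \<rho> c"
    and hol: "G holomorphic_on {z. 0 < Im z}" and cont: "continuous_on {z. 0 \<le> Im z} G"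
    and decay: "\<And>z. 0 \<le> Im z \<Longrightarrow> B \<le> norm z \<Longrightarrow>
      norm (G z + (\<Sum>c\<in>R. of_real (\<rho> c) / (z - of_real c))) \<le> K / (norm z)\<^sup>2"
    and real: "\<And>x. x \<notin> R \<Longrightarrow> Im (G (of_real x) + (\<Sum>c\<in>R. of_real (\<rho> c) / (of_real x - of_real c))) \<le> 0"
  shows "\<And>c. c \<in> R \<Longrightarrow> \<rho> c = 0" and "\<And>x::real. G (of_real x) = 0"
proof -
  define g where "g z = (z\<^sup>2 + 1) * G z + (\<Sum>c\<in>R. of_real (\<rho> c) * (z + of_real c))" for z
  have g_eq: "g z = (z\<^sup>2 + 1) * (G z + (\<Sum>c\<in>R. of_real (\<rho> c) / (z - of_real c)))
      - (\<Sum>c\<in>R. of_real (\<rho> c * (1 + c\<^sup>2)) / (z - of_real c))" if "z \<notin> of_real ` R" for z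
  proof -
    have "(z\<^sup>2 + 1) * (of_real (\<rho> c) / (z - of_real c)) - of_real (\<rho> c * (1 + c\<^sup>2)) / (z - of_real c)
        = of_real (\<rho> c) * (z + of_real c)" if "c \<in> R" for c
    proof -
      have "z - of_real c \<noteq> 0" using that \<open>z \<notin> of_real ` R\<close> by auto
      moreover have "(z\<^sup>2 + 1) * of_real (\<rho> c) - of_real (\<rho> c * (1 + c\<^sup>2)) =
          of_real (\<rho> c) * (z + of_real c) * (z - of_real c)"
        by (simp add: algebra_simps power2_eq_square)
      ultimately show ?thesis
        by (simp only: times_divide_eq_right diff_divide_distrib[symmetric]) simp
    qed
    then have "(\<Sum>c\<in>R. of_real (\<rho> c) * (z + of_real c)) =
      (\<Sum>c\<in>R. (z\<^sup>2 + 1) * (of_real (\<rho> c) / (z - of_real c)) - of_real (\<rho> c * (1 + c\<^sup>2)) / (z - of_real c))"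
      by (intro sum.cong) auto
    then show ?thesis
      by (simp only: g_def sum_subtractf sum_distrib_left[symmetric]) (simp add: algebra_simps)
  qed
  have ghol: "g holomorphic_on {z. 0 < Im z}" unfolding g_def by (intro holomorphic_intros hol)
  have gcont: "continuous_on {z. 0 \<le> Im z} g" unfolding g_def by (intro continuous_intros cont)
  have greal: "Im (g (of_real x)) \<le> 0" for x :: real
  proof -
    have 1: "Im (g (of_real x)) \<le> 0" if "x \<notin> R" for x :: real
    proof -
      have "of_real x \<notin> (of_real ` R :: complex set)" using that by auto
      then have "g (of_real x) = of_real (x\<^sup>2 + 1) * (G (of_real x) + (\<Sum>c\<in>R. of_real (\<rho> c) / (of_real x - of_real c)))
        - of_real (\<Sum>c\<in>R. \<rho> c * (1 + c\<^sup>2) / (x - c))"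
        by (subst g_eq) (auto simp: of_real_def[symmetric])
      then have "Im (g (of_real x)) = (x\<^sup>2 + 1) * Im (G (of_real x) + (\<Sum>c\<in>R. of_real (\<rho> c) / (of_real x - of_real c)))"
        by (simp only: minus_complex.sel Im_complex_of_real times_complex.sel Re_complex_of_real)
      also have "\<dots> \<le> 0" using real[OF that] by (intro mult_nonneg_nonpos) (auto simp: add_nonneg_nonneg)
      finally show ?thesis .
    qed
    have "((\<lambda>x. Im (g (of_real x))) \<longlongrightarrow> Im (g (of_real x))) (at x)"
    proof -
      have "continuous_on UNIV (\<lambda>x::real. Im (g (of_real x)))"
        by (intro continuous_intros continuous_on_compose2[OF gcont]) auto
      then show ?thesis by (simp add: continuous_on_def)
    qed
    moreover have "eventually (\<lambda>t. Im (g (of_real t)) \<le> 0) (at x)"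
    proof -
      have "eventually (\<lambda>t. t \<notin> R) (at x)"
        using islimpt_finite[OF R, of x] by (simp add: islimpt_iff_eventually)
      then show ?thesis by eventually_elim (rule 1)
    qed
    ultimately show ?thesis by (intro tendsto_upperbound) auto
  qed
  obtain C where gbdd: "\<And>z. 0 \<le> Im z \<Longrightarrow> norm (g z) \<le> C"
  proof -
    define C1 where "C1 = (\<Sum>c\<in>R. \<bar>\<rho> c * (1 + c\<^sup>2)\<bar>)"
    define b where "b = max 1 (max B (Max (insert 0 ((\<lambda>c. \<bar>c\<bar>) ` R)) + 1))"
    have b: "1 \<le> b" "B \<le> b" "\<And>c. c \<in> R \<Longrightarrow> \<bar>c\<bar> + 1 \<le> b"
      using R by (auto simp: b_def le_max_iff_disj)
    have "compact ({z. 0 \<le> Im z} \<inter> cball 0 b)"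
      using closed_halfspace_Im_ge[of 0] by (intro closed_Int_compact) auto
    then have "compact (g ` ({z. 0 \<le> Im z} \<inter> cball 0 b))"
      by (rule compact_continuous_image[rotated]) (rule continuous_on_subset[OF gcont], auto)
    then obtain C2 where C2: "\<And>z. 0 \<le> Im z \<Longrightarrow> norm z \<le> b \<Longrightarrow> norm (g z) \<le> C2"
      by (metis (no_types, lifting) IntI bounded_iff compact_imp_bounded image_eqI mem_Collect_eq mem_cball_0)
    have "norm (g z) \<le> 2 * \<bar>K\<bar> + C1" if z: "0 \<le> Im z" "b \<le> norm z" for z
    proof -
      have dist: "1 \<le> norm (z - of_real c)" if "c \<in> R" for c
        using norm_triangle_ineq2[of z "of_real c"] b(3)[OF that] z(2) by simp
      then have zR: "z \<notin> of_real ` R" by force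
      have "norm (g z) \<le> norm ((z\<^sup>2 + 1) * (G z + (\<Sum>c\<in>R. of_real (\<rho> c) / (z - of_real c))))
        + norm (\<Sum>c\<in>R. of_real (\<rho> c * (1 + c\<^sup>2)) / (z - of_real c))"
        unfolding g_eq[OF zR] by (rule norm_triangle_ineq4)
      also have "norm ((z\<^sup>2 + 1) * (G z + (\<Sum>c\<in>R. of_real (\<rho> c) / (z - of_real c)))) \<le>
          (2 * (norm z)\<^sup>2) * (\<bar>K\<bar> / (norm z)\<^sup>2)"
        unfolding norm_mult
      proof (rule mult_mono)
        have "norm (z\<^sup>2 + 1) \<le> (norm z)\<^sup>2 + 1"
          using norm_triangle_ineq[of "z\<^sup>2" 1] by (simp add: norm_power)
        moreover have "1 \<le> (norm z)\<^sup>2" using z(2) b(1) by (simp add: power2_eq_square mult_ge1_I)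
        ultimately show "norm (z\<^sup>2 + 1) \<le> 2 * (norm z)\<^sup>2" by simp
        show "norm (G z + (\<Sum>c\<in>R. of_real (\<rho> c) / (z - of_real c))) \<le> \<bar>K\<bar> / (norm z)\<^sup>2"
          using decay[of z] z b(2) by (intro order_trans[OF decay]) (auto intro: divide_right_mono)
      qed auto
      also have "\<dots> = 2 * \<bar>K\<bar>" using z(2) b(1) by auto
      also have "norm (\<Sum>c\<in>R. of_real (\<rho> c * (1 + c\<^sup>2)) / (z - of_real c)) \<le> C1"
        unfolding C1_def
      proof (rule sum_norm_le)
        fix c assume "c \<in> R"
        have "norm (of_real (\<rho> c * (1 + c\<^sup>2)) / (z - of_real c)) = \<bar>\<rho> c * (1 + c\<^sup>2)\<bar> / norm (z - of_real c)"
          by (simp only: norm_divide norm_of_real)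
        also have "\<dots> \<le> \<bar>\<rho> c * (1 + c\<^sup>2)\<bar> / 1"
          using dist[OF \<open>c \<in> R\<close>] by (intro divide_left_mono) auto
        finally show "norm (of_real (\<rho> c * (1 + c\<^sup>2)) / (z - of_real c)) \<le> \<bar>\<rho> c * (1 + c\<^sup>2)\<bar>" by simp
      qed
      finally show ?thesis by simp
    qed
    then show ?thesis using that[of "max C2 (2 * \<bar>K\<bar> + C1)"] C2 by (metis le_max_iff_disj linorder_linear)
  qed
  have Img: "Im (g z) \<le> 0" if "0 < Im z" for z
    using half_plane_maximum[OF ghol gcont gbdd greal that] .
  have gi: "g \<i> = (\<Sum>c\<in>R. of_real (\<rho> c) * (\<i> + of_real c))" by (simp add: g_def)
  then have "Im (g \<i>) = (\<Sum>c\<in>R. \<rho> c)" by simp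
  then have "(\<Sum>c\<in>R. \<rho> c) \<le> 0" using Img[of \<i>] by simp
  then have "(\<Sum>c\<in>R. \<rho> c) = 0" using \<rho> by (intro antisym) (auto intro: sum_nonneg)
  then show \<rho>0: "\<rho> c = 0" if "c \<in> R" for c
    using that R \<rho> by (auto simp: sum_nonneg_eq_0_iff)
  then have "g \<i> = 0" by (simp add: gi)
  (* The Moebius map sends the closed lower half plane into the unit disc and 0 to the boundary point 1,
     so the maximum modulus principle applies at the interior point \<i>. *)
  define h where "h z = 1 / (1 + \<i> * g z)" for z
  have Re1: "1 \<le> Re (1 + \<i> * g z)" if "0 < Im z" for z using Img[OF that] by simp
  then have nz: "1 + \<i> * g z \<noteq> 0" if "0 < Im z" for z using that by (metis not_one_le_zero zero_complex.sel(1))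
  have "h constant_on {z. 0 < Im z}"
  proof (rule maximum_modulus_principle[of h _ "{z. 0 < Im z}" \<i>])
    show "h holomorphic_on {z. 0 < Im z}"
      unfolding h_def using nz by (intro holomorphic_intros ghol) auto
    show "connected {z. 0 < Im z}" using convex_halfspace_Im_gt[of 0] by (simp add: convex_connected)
    show "open {z. 0 < Im z}" using open_halfspace_Im_gt[of 0] by simp
    fix z assume "z \<in> {z. 0 < Im z}"
    then have "1 \<le> norm (1 + \<i> * g z)" using Re1[of z] complex_Re_le_cmod[of "1 + \<i> * g z"] by auto
    then show "norm (h z) \<le> norm (h \<i>)" by (simp add: h_def \<open>g \<i> = 0\<close> norm_divide divide_le_eq_1)
  qed (use open_halfspace_Im_gt[of 0] in auto)
  then have h1: "h z = 1" if "0 < Im z" for z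
    using that unfolding constant_on_def by (metis (mono_tags, lifting) \<open>g \<i> = 0\<close> add_0_right div_by_1 h_def
        imaginary_unit.sel(2) mem_Collect_eq mult_zero_right zero_less_one)
  have g0: "g z = 0" if "0 < Im z" for z
    using h1[OF that] nz[OF that] by (simp add: h_def)
  show "G (of_real x) = 0" for x :: real
  proof -
    let ?z = "\<lambda>t::real. Complex x t"
    have "continuous_on {0..} (\<lambda>t. g (?z t))"
      by (intro continuous_on_compose2[OF gcont]) (auto intro!: continuous_intros simp: Complex_eq)
    then have "((\<lambda>t. g (?z t)) \<longlongrightarrow> g (?z 0)) (at 0 within {0..})"
      by (simp add: continuous_on_def)
    then have "((\<lambda>t. g (?z t)) \<longlongrightarrow> g (?z 0)) (at_right 0)"
      by (rule tendsto_within_subset) auto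
    moreover have "eventually (\<lambda>t. g (?z t) = 0) (at_right 0)"
      by (rule eventually_at_rightI[of 0 1]) (auto simp: g0)
    then have "((\<lambda>t. g (?z t)) \<longlongrightarrow> 0) (at_right 0)" by (rule tendsto_eventually)
    ultimately have "g (?z 0) = 0"
      by (rule tendsto_unique[OF trivial_limit_at_right_real])
    moreover have "Complex x 0 = of_real x" by (simp add: complex_eq_iff)
    ultimately have "(of_real (x\<^sup>2 + 1)) * G (of_real x) = 0"
      using \<rho>0 by (simp add: g_def)
    moreover have "x\<^sup>2 + 1 \<noteq> 0" by (metis add_cancel_left_right add_nonneg_eq_0_iff zero_le_one zero_le_power2 zero_neq_one)
    ultimately show ?thesis by (simp only: mult_eq_0_iff of_real_eq_0_iff) simp
  qed
qed


section \<open>Partial fractions and the resolvent\<close>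

definition pole_part :: "complex \<Rightarrow> nat \<Rightarrow> (nat \<Rightarrow> 'a::complex_inner) \<Rightarrow> complex \<Rightarrow> 'a" where
  "pole_part c M \<xi> z = (\<Sum>m<M. (1 / (z - c) ^ Suc m) *\<^sub>C \<xi> m)"

definition partial_fraction ::
  "complex set \<Rightarrow> nat \<Rightarrow> (complex \<Rightarrow> nat \<Rightarrow> 'a::complex_inner) \<Rightarrow> complex \<Rightarrow> 'a" where
  "partial_fraction S M x z = (\<Sum>c\<in>S. pole_part c M (x c) z)"

text \<open>
  The polynomial part of \<open>A(z) (\<Sum>j. y j / z^(j + 1))\<close>. For \<open>y\<close> satisfying the recurrence it is the whole product
  (\<open>pencil_partial_fraction\<close>).
\<close>

definition numer :: "(nat \<Rightarrow> 'a \<Rightarrow> 'a::complex_inner) \<Rightarrow> nat \<Rightarrow> (nat \<Rightarrow> 'a) \<Rightarrow> complex \<Rightarrow> 'a" where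
  "numer A n y z = (\<Sum>k\<le>n. A k (\<Sum>j<k. z ^ (k - 1 - j) *\<^sub>C y j))"

definition numer_coeff :: "(nat \<Rightarrow> 'a \<Rightarrow> 'a::complex_inner) \<Rightarrow> nat \<Rightarrow> (nat \<Rightarrow> 'a) \<Rightarrow> nat \<Rightarrow> 'a" where
  "numer_coeff A n y i = (\<Sum>k\<le>n. if i < k then A k (y (k - 1 - i)) else 0)"

definition vpoly :: "nat \<Rightarrow> (nat \<Rightarrow> 'a::complex_inner) \<Rightarrow> complex \<Rightarrow> 'a" where
  "vpoly D a z = (\<Sum>i<D. z ^ i *\<^sub>C a i)"

text \<open>
  The Taylor coefficients at \<open>c\<close> of the polynomial \<open>vpoly D a\<close>.
\<close>

definition recenter :: "complex \<Rightarrow> nat \<Rightarrow> (nat \<Rightarrow> 'a::complex_inner) \<Rightarrow> nat \<Rightarrow> 'a" where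
  "recenter c D a m = (\<Sum>i<D. (of_nat (i choose m) * c ^ (i - m)) *\<^sub>C a i)"

lemma pole_part_add: "pole_part c M (\<lambda>m. \<xi> m + \<eta> m) z = pole_part c M \<xi> z + pole_part c M \<eta> z"
  by (simp add: pole_part_def scaleC_add_right sum.distrib)

lemma pole_part_zero [simp]: "pole_part c M (\<lambda>m. 0) z = 0"
  by (simp add: pole_part_def)

text \<open>
  This moves a polynomial to the eigenvalue at which it is paired with chains.
\<close>

lemma vpoly_recenter: "vpoly D a z = vpoly D (recenter c D a) (z - c)"
proof -
  have pow: "z ^ i = (\<Sum>m<D. of_nat (i choose m) * c ^ (i - m) * (z - c) ^ m)" if "i < D" for i
  proof -
    have "z ^ i = ((z - c) + c) ^ i" by simp
    also have "\<dots> = (\<Sum>m\<le>i. of_nat (i choose m) * (z - c) ^ m * c ^ (i - m))"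
      by (rule binomial_ring)
    also have "\<dots> = (\<Sum>m<D. of_nat (i choose m) * (z - c) ^ m * c ^ (i - m))"
      using that by (intro sum.mono_neutral_left) (auto simp: not_le)
    finally show ?thesis by (simp add: mult_ac)
  qed
  have "vpoly D a z = (\<Sum>i<D. \<Sum>m<D. (of_nat (i choose m) * c ^ (i - m) * (z - c) ^ m) *\<^sub>C a i)"
    unfolding vpoly_def by (intro sum.cong) (simp_all add: pow complex_vector.scale_sum_left)
  also have "\<dots> = (\<Sum>m<D. \<Sum>i<D. (of_nat (i choose m) * c ^ (i - m) * (z - c) ^ m) *\<^sub>C a i)"
    by (rule sum.swap)
  also have "\<dots> = vpoly D (recenter c D a) (z - c)"
    by (simp add: vpoly_def recenter_def complex_vector.scale_sum_right scaleC_scaleC mult_ac)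
  finally show ?thesis .
qed

lemma scaleC_of_real: "of_real r *\<^sub>C x = r *\<^sub>R (x :: 'a::complex_inner)"
  by (simp add: scaleR_scaleC)

lemma vpoly_eq_0_imp:
  assumes "\<And>t::real. 0 < t \<Longrightarrow> t < \<delta> \<Longrightarrow> vpoly D a (of_real t) = 0" "\<delta> > 0" "i < D"
  shows "a i = 0"
proof (rule coefficients_eq_0_if_small[where \<delta> = \<delta> and D = D and K = 0 and p = D])
  fix t :: real assume "0 < t" "t < \<delta>"
  then show "norm (\<Sum>g<D. t ^ g *\<^sub>R a g) \<le> 0 * t ^ D"
    using assms(1)[of t] unfolding vpoly_def of_real_power[symmetric] scaleC_of_real by simp
qed (use assms in auto)

text \<open>
  Approaching \<open>c\<close> along the ray of direction \<open>w\<close>, the term of highest order dominates all others.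
  The weak hypothesis, growth slower than that of a simple pole, is what decaying solutions provide.
\<close>

lemma pole_part_small_eq_0:
  fixes \<xi> :: "nat \<Rightarrow> 'a::complex_inner"
  assumes w: "norm w = 1" and \<delta>: "\<delta> > 0" and m: "m < M"
    and small: "\<And>\<epsilon>. \<epsilon> > 0 \<Longrightarrow> \<exists>\<delta>'>0. \<forall>t. 0 < t \<longrightarrow> t < \<delta>' \<longrightarrow> t * norm (pole_part c M \<xi> (c + of_real t * w)) \<le> \<epsilon>"
  shows "\<xi> m = 0"
proof (rule ccontr)
  assume "\<xi> m \<noteq> 0"
  define g where "g = Max {m. m < M \<and> \<xi> m \<noteq> 0}"
  have fin: "finite {m. m < M \<and> \<xi> m \<noteq> 0}" by simp
  have ne: "{m. m < M \<and> \<xi> m \<noteq> 0} \<noteq> {}" using m \<open>\<xi> m \<noteq> 0\<close> by blast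
  have g: "g < M" "\<xi> g \<noteq> 0" using Max_in[OF fin ne] unfolding g_def by auto
  have g_max: "\<xi> m = 0" if "g < m" "m < M" for m
    using Max_ge[OF fin, of m] that unfolding g_def by (metis (mono_tags, lifting) linorder_not_le mem_Collect_eq)
  have w0: "w \<noteq> 0" using w by auto
  let ?b = "\<lambda>m. (1 / w ^ Suc m) *\<^sub>C \<xi> m"
  have eq: "t ^ g *\<^sub>R (t *\<^sub>R pole_part c M \<xi> (c + of_real t * w)) = (\<Sum>m\<le>g. t ^ (g - m) *\<^sub>R ?b m)" if t: "0 < t" for t :: real
  proof -
    have "pole_part c M \<xi> (c + of_real t * w) = (\<Sum>m\<le>g. (1 / (of_real t * w) ^ Suc m) *\<^sub>C \<xi> m)"
      unfolding pole_part_def using g(1) by (intro sum.mono_neutral_cong_right) (auto simp: g_max)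
    also have "\<dots> = (\<Sum>m\<le>g. (1 / t ^ Suc m) *\<^sub>R ?b m)"
      by (intro sum.cong) (auto simp: scaleR_scaleC scaleC_scaleC power_mult_distrib)
    also have "t ^ g *\<^sub>R (t *\<^sub>R \<dots>) = (\<Sum>m\<le>g. t ^ (g - m) *\<^sub>R ?b m)"
    proof -
      have "t ^ g * t * (1 / t ^ Suc m) = t ^ (g - m)" if "m \<le> g" for m
      proof -
        have "t ^ g = t ^ (g - m) * t ^ m" using that by (simp flip: power_add)
        then show ?thesis using t by simp
      qed
      then have eq: "t ^ g *\<^sub>R t *\<^sub>R (1 / t ^ Suc m) *\<^sub>R v = t ^ (g - m) *\<^sub>R v" if "m \<le> g" for m and v :: 'a
        using that by (simp only: scaleR_scaleR mult.assoc[symmetric])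
      show ?thesis unfolding scaleR_sum_right by (intro sum.cong refl eq) simp
    qed
    finally show ?thesis .
  qed
  have "norm (?b g) \<le> 0"
  proof (rule field_le_epsilon)
    fix \<epsilon> :: real assume \<epsilon>: "\<epsilon> > 0"
    obtain \<delta>' where \<delta>': "\<delta>' > 0" "\<And>t. 0 < t \<Longrightarrow> t < \<delta>' \<Longrightarrow> t * norm (pole_part c M \<xi> (c + of_real t * w)) \<le> \<epsilon>"
      using small[OF \<epsilon>] by blast
    have "((\<lambda>t. norm (\<Sum>m\<le>g. t ^ (g - m) *\<^sub>R ?b m)) \<longlongrightarrow> norm (\<Sum>m\<le>g. 0 ^ (g - m) *\<^sub>R ?b m)) (at_right 0)"
      by (intro tendsto_intros tendsto_ident_at)
    moreover have "(\<Sum>m\<le>g. 0 ^ (g - m) *\<^sub>R ?b m) = (\<Sum>m\<le>g. if m = g then ?b g else 0)"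
      by (intro sum.cong) (auto simp: power_0_left)
    moreover have "eventually (\<lambda>t. norm (\<Sum>m\<le>g. t ^ (g - m) *\<^sub>R ?b m) \<le> \<epsilon>) (at_right 0)"
    proof (rule eventually_at_rightI[of 0 "min 1 \<delta>'"])
      fix t :: real assume t: "t \<in> {0<..<min 1 \<delta>'}"
      have "norm (\<Sum>m\<le>g. t ^ (g - m) *\<^sub>R ?b m) = t ^ g * (t * norm (pole_part c M \<xi> (c + of_real t * w)))"
        using t by (subst eq[symmetric]) auto
      also have "\<dots> \<le> 1 * \<epsilon>" using t \<delta>'(2)[of t] by (intro mult_mono) (auto simp: power_le_one)
      finally show "norm (\<Sum>m\<le>g. t ^ (g - m) *\<^sub>R ?b m) \<le> \<epsilon>" by simp
    qed (use \<delta>' in simp)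
    ultimately show "norm (?b g) \<le> 0 + \<epsilon>"
      by (intro tendsto_upperbound[of _ _ "at_right (0::real)"]) auto
  qed
  then show False using g(2) by (simp add: norm_divide norm_mult norm_power w)
qed

lemma pole_part_bounded_eq_0:
  fixes \<xi> :: "nat \<Rightarrow> 'a::complex_inner"
  assumes \<delta>: "\<delta> > 0" and m: "m < M"
    and bdd: "\<And>t. 0 < t \<Longrightarrow> t < \<delta> \<Longrightarrow> norm (pole_part c M \<xi> (c + of_real t)) \<le> K"
  shows "\<xi> m = 0"
proof (rule pole_part_small_eq_0[of 1 \<delta> m M c])
  fix \<epsilon> :: real assume "\<epsilon> > 0"
  define K' where "K' = max K 1"
  show "\<exists>\<delta>'>0. \<forall>t. 0 < t \<longrightarrow> t < \<delta>' \<longrightarrow> t * norm (pole_part c M \<xi> (c + of_real t * 1)) \<le> \<epsilon>"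
  proof (intro exI[of _ "min \<delta> (\<epsilon> / K')"] conjI allI impI)
    show "0 < min \<delta> (\<epsilon> / K')" using \<delta> \<open>\<epsilon> > 0\<close> by (simp add: K'_def)
    fix t assume t: "0 < t" "t < min \<delta> (\<epsilon> / K')"
    then have "t * norm (pole_part c M \<xi> (c + of_real t * 1)) \<le> (\<epsilon> / K') * K'"
      using bdd[of t] by (intro mult_mono) (auto simp: K'_def)
    then show "t * norm (pole_part c M \<xi> (c + of_real t * 1)) \<le> \<epsilon>" by (simp add: K'_def)
  qed
qed (use assms in auto)

text \<open>Away from its own pole every other term of a partial fraction is bounded.\<close>

lemma pole_part_continuous: "c \<noteq> b \<Longrightarrow> isCont (pole_part c M \<xi>) b"
  unfolding pole_part_def isCont_def
  by (intro tendsto_intros) (auto intro!: tendsto_intros)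

lemma isCont_bounded_near:
  fixes F :: "complex \<Rightarrow> 'b::real_normed_vector"
  assumes "isCont F b"
  obtains \<delta> K where "\<delta> > 0" "K \<ge> 0" "\<And>z. dist z b < \<delta> \<Longrightarrow> norm (F z) \<le> K"
proof -
  obtain \<delta> where \<delta>: "\<delta> > 0" "\<And>z. dist z b < \<delta> \<Longrightarrow> dist (F z) (F b) < 1"
    using assms unfolding continuous_at_eps_delta by (metis zero_less_one)
  show ?thesis
  proof (rule that[of \<delta> "norm (F b) + 1"])
    fix z assume "dist z b < \<delta>"
    then have "norm (F z - F b) < 1" using \<delta>(2) by (simp add: dist_norm)
    then show "norm (F z) \<le> norm (F b) + 1" using norm_triangle_sub[of "F z" "F b"] by simp
  qed (use \<delta> in auto)
qed

lemma partial_fraction_split: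
  assumes "finite S"
  shows "partial_fraction S M x z = (if c \<in> S then pole_part c M (x c) z else 0)
    + partial_fraction (S - {c}) M x z"
  using assms by (auto simp: partial_fraction_def sum.remove)

lemma partial_fraction_continuous: "b \<notin> S \<Longrightarrow> isCont (partial_fraction S M x) b"
  unfolding partial_fraction_def by (intro continuous_intros pole_part_continuous) auto

context linear_pencil
begin

lemma numer_vpoly: "numer A n y z = vpoly n (numer_coeff A n y) z"
proof -
  have "A k (\<Sum>j<k. z ^ (k - 1 - j) *\<^sub>C y j) = (\<Sum>i<n. if i < k then z ^ i *\<^sub>C A k (y (k - 1 - i)) else 0)"
    if "k \<le> n" for k
  proof -
    have "A k (\<Sum>j<k. z ^ (k - 1 - j) *\<^sub>C y j) = (\<Sum>j<k. z ^ (k - Suc j) *\<^sub>C A k (y j))"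
      by (simp add: A_rules[OF that])
    also have "\<dots> = (\<Sum>j<k. z ^ (k - Suc (k - Suc j)) *\<^sub>C A k (y (k - Suc j)))"
      by (rule sum.nat_diff_reindex[symmetric])
    also have "\<dots> = (\<Sum>i<k. z ^ i *\<^sub>C A k (y (k - 1 - i)))"
      by (intro sum.cong) auto
    also have "\<dots> = (\<Sum>i<n. if i < k then z ^ i *\<^sub>C A k (y (k - 1 - i)) else 0)"
      using that by (intro sum.mono_neutral_cong_left) auto
    finally show ?thesis .
  qed
  then have "numer A n y z = (\<Sum>k\<le>n. \<Sum>i<n. if i < k then z ^ i *\<^sub>C A k (y (k - 1 - i)) else 0)"
    unfolding numer_def by (intro sum.cong) auto
  also have "\<dots> = vpoly n (numer_coeff A n y) z"
    unfolding vpoly_def numer_coeff_def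
    by (subst sum.swap) (auto simp: complex_vector.scale_sum_right intro!: sum.cong)
  finally show ?thesis .
qed

lemma numer_coeff_add: "numer_coeff A n (\<lambda>j. y j + z j) i = numer_coeff A n y i + numer_coeff A n z i"
  unfolding numer_coeff_def sum.distrib[symmetric] by (intro sum.cong) (auto simp: A_rules)

lemma numer_coeff_scaleC: "numer_coeff A n (\<lambda>j. a *\<^sub>C y j) i = a *\<^sub>C numer_coeff A n y i"
  unfolding numer_coeff_def complex_vector.scale_sum_right by (intro sum.cong) (auto simp: A_rules)

lemma numer_add: "numer A n (\<lambda>j. y j + z j) b = numer A n y b + numer A n z b"
  by (simp add: numer_vpoly vpoly_def numer_coeff_add scaleC_add_right sum.distrib)

lemma numer_zero: "numer A n (\<lambda>j. 0) b = 0"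
  by (simp add: numer_def A_rules)

lemma numer_sum: "numer A n (\<lambda>j. \<Sum>i\<in>I. y i j) b = (\<Sum>i\<in>I. numer A n (y i) b)"
  by (induction I rule: infinite_finite_induct) (auto simp: numer_zero numer_add)

text \<open>
  The coefficient of \<open>z^i\<close> involves only \<open>y j\<close> with \<open>j \<le> n - 1 - i\<close>; this is where the order \<open>n = 2 l\<close> splits into two
  equal halves.
\<close>

lemma numer_coeff_high:
  assumes "n = 2 * l" "\<And>j. j < l \<Longrightarrow> y j = 0" "l \<le> i"
  shows "numer_coeff A n y i = 0"
  unfolding numer_coeff_def using assms by (intro sum.neutral) (auto simp: A_rules)

end

text \<open>
  Division of \<open>z^k\<close> times a pole part into polynomial and pole part. In the induction on \<open>k\<close> the factor \<open>z - c\<close>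
  lowers all pole orders by one, so that the sum telescopes.
\<close>

lemma power_pole_part:
  fixes \<xi> :: "nat \<Rightarrow> 'a::complex_inner"
  assumes "z \<noteq> c" and fin: "\<And>m. m \<ge> M \<Longrightarrow> \<xi> m = 0"
  shows "z ^ k *\<^sub>C pole_part c M \<xi> z = (\<Sum>j<k. z ^ (k - 1 - j) *\<^sub>C geo c \<xi> j)
    + pole_part c M (\<lambda>g. geo c (shift g \<xi>) k) z"
proof (induction k)
  case 0
  show ?case by (simp add: pole_part_def)
next
  case (Suc k)
  let ?G = "\<lambda>g. geo c (shift g \<xi>) k"
  have tele: "(z - c) *\<^sub>C pole_part c M ?G z = ?G 0 + pole_part c M (\<lambda>g. ?G (Suc g)) z"
  proof -
    have "(\<Sum>g<M. (1 / (z - c) ^ g) *\<^sub>C ?G g - (1 / (z - c) ^ Suc g) *\<^sub>C ?G (Suc g)) =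
        (1 / (z - c) ^ 0) *\<^sub>C ?G 0 - (1 / (z - c) ^ M) *\<^sub>C ?G M"
      by (rule sum_lessThan_telescope')
    moreover have "shift M \<xi> = (\<lambda>_. 0)" using fin by (auto simp: shift_def)
    ultimately have "(\<Sum>g<M. (1 / (z - c) ^ g) *\<^sub>C ?G g) - pole_part c M (\<lambda>g. ?G (Suc g)) z = ?G 0"
      by (simp add: pole_part_def sum_subtractf)
    moreover have "(z - c) *\<^sub>C pole_part c M ?G z = (\<Sum>g<M. (1 / (z - c) ^ g) *\<^sub>C ?G g)"
      using assms(1) by (simp add: pole_part_def complex_vector.scale_sum_right scaleC_scaleC)
    ultimately show ?thesis by (simp add: algebra_simps)
  qed
  have geoS: "(\<lambda>g. geo c (shift g \<xi>) (Suc k)) = (\<lambda>g. c *\<^sub>C ?G g + ?G (Suc g))" by (simp add: fun_eq_iff)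
  have "z ^ Suc k *\<^sub>C pole_part c M \<xi> z = z *\<^sub>C (\<Sum>j<k. z ^ (k - 1 - j) *\<^sub>C geo c \<xi> j) + z *\<^sub>C pole_part c M ?G z"
    by (simp add: scaleC_scaleC[symmetric] Suc scaleC_add_right del: shift_apply)
  also have "z *\<^sub>C pole_part c M ?G z = c *\<^sub>C pole_part c M ?G z + (?G 0 + pole_part c M (\<lambda>g. ?G (Suc g)) z)"
    unfolding tele[symmetric] by (simp flip: scaleC_add_left)
  also have "z *\<^sub>C (\<Sum>j<k. z ^ (k - 1 - j) *\<^sub>C geo c \<xi> j) = (\<Sum>j<k. z ^ (Suc k - 1 - j) *\<^sub>C geo c \<xi> j)"
    unfolding complex_vector.scale_sum_right scaleC_scaleC
  proof (intro sum.cong refl)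
    fix j assume "j \<in> {..<k}"
    then have "Suc k - 1 - j = Suc (k - 1 - j)" by auto
    then show "(z * z ^ (k - 1 - j)) *\<^sub>C geo c \<xi> j = z ^ (Suc k - 1 - j) *\<^sub>C geo c \<xi> j"
      by (simp only: power_Suc)
  qed
  also have "c *\<^sub>C pole_part c M ?G z + (?G 0 + pole_part c M (\<lambda>g. ?G (Suc g)) z) =
      ?G 0 + pole_part c M (\<lambda>g. geo c (shift g \<xi>) (Suc k)) z"
    unfolding geoS by (simp add: pole_part_def scaleC_add_right sum.distrib scaleC_scaleC
        complex_vector.scale_sum_right mult.commute)
  finally show ?case by (simp del: shift_apply geo.simps(2))
qed

context linear_pencil
begin

lemma pencil_pole_part:
  assumes "z \<noteq> c" "root_seq A n c \<xi>" "\<And>m. m \<ge> M \<Longrightarrow> \<xi> m = 0"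
  shows "pencil A n z (pole_part c M \<xi> z) = numer A n (geo c \<xi>) z"
proof -
  have "pencil A n z (pole_part c M \<xi> z) = (\<Sum>k\<le>n. A k (z ^ k *\<^sub>C pole_part c M \<xi> z))"
    by (simp add: pencil_def A_rules)
  also have "\<dots> = numer A n (geo c \<xi>) z + (\<Sum>k\<le>n. A k (pole_part c M (\<lambda>g. geo c (shift g \<xi>) k) z))"
    unfolding numer_def sum.distrib[symmetric]
    by (intro sum.cong) (auto simp: power_pole_part[OF assms(1,3)] A_rules)
  also have "(\<Sum>k\<le>n. A k (pole_part c M (\<lambda>g. geo c (shift g \<xi>) k) z)) =
      pole_part c M (\<lambda>g. \<Sum>k\<le>n. A k (geo c (shift g \<xi>) k)) z"
    unfolding pole_part_def by (simp add: A_rules complex_vector.scale_sum_right) (rule sum.swap)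
  also have "\<dots> = 0" using assms(2) by (simp add: root_seq_def)
  finally show ?thesis by simp
qed

lemma pencil_partial_fraction:
  assumes "z \<notin> S" "\<And>c. c \<in> S \<Longrightarrow> root_seq A n c (x c)" "\<And>c m. m \<ge> M \<Longrightarrow> x c m = 0"
  shows "pencil A n z (partial_fraction S M x z) = numer A n (\<lambda>j. \<Sum>c\<in>S. geo c (x c) j) z"
proof -
  have "pencil A n z (partial_fraction S M x z) = (\<Sum>c\<in>S. pencil A n z (pole_part c M (x c) z))"
    unfolding partial_fraction_def by (rule clinear_rules(6)[OF pencil_clinear])
  also have "\<dots> = (\<Sum>c\<in>S. numer A n (geo c (x c)) z)"
    using assms by (intro sum.cong refl pencil_pole_part) auto
  finally show ?thesis by (simp add: numer_sum)
qed

lemma coefficients_bounded: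
  obtains C where "\<And>k x. k \<le> n \<Longrightarrow> norm (A k x) \<le> C k * norm x" "\<And>k. k \<le> n \<Longrightarrow> 0 \<le> C k"
proof -
  have "\<exists>C\<ge>0. \<forall>x. norm (A k x) \<le> C * norm x" if "k \<le> n" for k
    using clinear_bounded[OF lin[OF that]] by metis
  then show ?thesis using that by metis
qed

lemma pencil_bounded:
  obtains K where "K \<ge> 0" "\<And>z x. norm z \<le> r \<Longrightarrow> norm (pencil A n z x) \<le> K * norm x"
proof -
  obtain C where C: "\<And>k x. k \<le> n \<Longrightarrow> norm (A k x) \<le> C k * norm x" "\<And>k. k \<le> n \<Longrightarrow> 0 \<le> C k"
    by (rule coefficients_bounded) blast
  show ?thesis
  proof (rule that[of "\<Sum>k\<le>n. \<bar>r\<bar> ^ k * C k"])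
    show "0 \<le> (\<Sum>k\<le>n. \<bar>r\<bar> ^ k * C k)" using C(2) by (intro sum_nonneg) auto
    fix z :: complex and x assume z: "norm z \<le> r"
    have "norm (pencil A n z x) \<le> (\<Sum>k\<le>n. norm z ^ k * norm (A k x))"
      unfolding pencil_def by (rule order_trans[OF norm_sum]) (simp add: norm_power)
    also have "\<dots> \<le> (\<Sum>k\<le>n. \<bar>r\<bar> ^ k * (C k * norm x))"
      using C z by (intro sum_mono mult_mono power_mono) auto
    finally show "norm (pencil A n z x) \<le> (\<Sum>k\<le>n. \<bar>r\<bar> ^ k * C k) * norm x"
      by (simp add: sum_distrib_right mult.assoc)
  qed
qed

text \<open>Injectivity of the pencil at a point persists nearby, with a uniform lower bound.\<close>

lemma pencil_lower_bound_near:
  assumes "\<not> eigenvalue (pencil A n) b"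
  obtains \<delta> \<kappa> where "\<delta> > 0" "\<kappa> > 0" "\<And>z x. dist z b < \<delta> \<Longrightarrow> \<kappa> * norm x \<le> norm (pencil A n z x)"
proof -
  obtain \<kappa> where \<kappa>: "\<kappa> > 0" "\<And>x. \<kappa> * norm x \<le> norm (pencil A n b x)"
    using clinear_inj_lower_bound[OF pencil_clinear] assms unfolding eigenvalue_def by metis
  obtain C where C: "\<And>k x. k \<le> n \<Longrightarrow> norm (A k x) \<le> C k * norm x" "\<And>k. k \<le> n \<Longrightarrow> 0 \<le> C k"
    by (rule coefficients_bounded) blast
  have "((\<lambda>z. \<Sum>k\<le>n. norm (z ^ k - b ^ k) * C k) \<longlongrightarrow> (\<Sum>k\<le>n. norm (b ^ k - b ^ k) * C k)) (at b)"
    by (intro tendsto_intros)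
  then have "eventually (\<lambda>z. (\<Sum>k\<le>n. norm (z ^ k - b ^ k) * C k) < \<kappa> / 2) (at b)"
    using \<kappa>(1) by (intro order_tendstoD(2)) auto
  then obtain \<delta> where \<delta>: "\<delta> > 0" "\<And>z. z \<noteq> b \<Longrightarrow> dist z b < \<delta> \<Longrightarrow> (\<Sum>k\<le>n. norm (z ^ k - b ^ k) * C k) < \<kappa> / 2"
    unfolding eventually_at by blast
  show ?thesis
  proof (rule that[of \<delta> "\<kappa> / 2"])
    fix z x assume z: "dist z b < \<delta>"
    have small: "(\<Sum>k\<le>n. norm (z ^ k - b ^ k) * C k) \<le> \<kappa> / 2"
      using \<delta>(2)[OF _ z] \<kappa>(1) by (cases "z = b") auto
    have "norm (pencil A n z x - pencil A n b x) = norm (\<Sum>k\<le>n. (z ^ k - b ^ k) *\<^sub>C A k x)"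
      by (simp add: pencil_def complex_vector.scale_left_diff_distrib sum_subtractf)
    also have "\<dots> \<le> (\<Sum>k\<le>n. norm (z ^ k - b ^ k) * (C k * norm x))"
      using C by (intro sum_norm_le) (auto intro!: mult_left_mono)
    also have "\<dots> = (\<Sum>k\<le>n. norm (z ^ k - b ^ k) * C k) * norm x" by (simp add: sum_distrib_right mult.assoc)
    also have "\<dots> \<le> \<kappa> / 2 * norm x" by (rule mult_right_mono[OF small]) simp
    finally have "norm (pencil A n b x) \<le> norm (pencil A n z x) + \<kappa> / 2 * norm x"
      using norm_triangle_sub[of "pencil A n b x" "pencil A n z x"] by (simp add: norm_minus_commute)
    then show "\<kappa> / 2 * norm x \<le> norm (pencil A n z x)" using \<kappa>(2)[of x] by linarith
  qed (use \<delta> \<kappa> in auto)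
qed

end

context regular_pencil
begin

text \<open>
  The leading term dominates at infinity. Together with the degree of the numerator this yields the
  quadratic decay of \<open>f\<close>.
\<close>

lemma pencil_lower_bound_infinity:
  obtains r \<kappa> where "r \<ge> 1" "\<kappa> > 0" "\<And>z x. r \<le> norm z \<Longrightarrow> \<kappa> * norm z ^ n * norm x \<le> norm (pencil A n z x)"
proof -
  obtain \<kappa> where \<kappa>: "\<kappa> > 0" "\<And>x. \<kappa> * norm x \<le> norm (A n x)"
    using clinear_inj_lower_bound[OF lin[OF order_refl] leading_inj] by metis
  obtain C where C: "\<And>k x. k \<le> n \<Longrightarrow> norm (A k x) \<le> C k * norm x" "\<And>k. k \<le> n \<Longrightarrow> 0 \<le> C k"
    by (rule coefficients_bounded) blast
  define Q where "Q = (\<Sum>k<n. C k)"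
  have Q: "0 \<le> Q" unfolding Q_def using C(2) by (intro sum_nonneg) auto
  show ?thesis
  proof (rule that[of "max 1 (2 * Q / \<kappa>)" "\<kappa> / 2"])
    fix z :: complex and x :: 'a assume z: "max 1 (2 * Q / \<kappa>) \<le> norm z"
    have "norm (\<Sum>k<n. z ^ k *\<^sub>C A k x) \<le> (\<Sum>k<n. norm z ^ (n - 1) * (C k * norm x))"
    proof (rule sum_norm_le)
      fix k assume k: "k \<in> {..<n}"
      have "norm z ^ k \<le> norm z ^ (n - 1)" using z k by (intro power_increasing) auto
      then show "norm (z ^ k *\<^sub>C A k x) \<le> norm z ^ (n - 1) * (C k * norm x)"
        using C[of k] k by (auto simp: norm_power intro!: mult_mono)
    qed
    also have "\<dots> = norm z ^ (n - 1) * Q * norm x"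
      by (simp add: Q_def sum_distrib_left sum_distrib_right mult.assoc)
    also have "\<dots> \<le> \<kappa> / 2 * norm z ^ n * norm x"
    proof (cases "n = 0")
      case True
      then show ?thesis using \<kappa> by (simp add: Q_def)
    next
      case False
      have "Q \<le> \<kappa> / 2 * norm z" using z \<kappa>(1) by (simp add: field_simps)
      then have "norm z ^ (n - 1) * Q \<le> norm z ^ (n - 1) * (\<kappa> / 2 * norm z)"
        by (intro mult_left_mono) auto
      also have "\<dots> = \<kappa> / 2 * norm z ^ n" using False by (cases n) auto
      finally show ?thesis by (rule mult_right_mono) simp
    qed
    finally have low: "norm (\<Sum>k<n. z ^ k *\<^sub>C A k x) \<le> \<kappa> / 2 * norm z ^ n * norm x" .
    have "\<kappa> * norm z ^ n * norm x \<le> norm (z ^ n *\<^sub>C A n x)"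
      using mult_left_mono[OF \<kappa>(2)[of x], of "norm z ^ n"] by (simp add: norm_power mult_ac)
    also have "\<dots> = norm (pencil A n z x - (\<Sum>k<n. z ^ k *\<^sub>C A k x))"
      by (simp add: pencil_def lessThan_Suc_atMost[symmetric])
    also have "\<dots> \<le> norm (pencil A n z x) + norm (\<Sum>k<n. z ^ k *\<^sub>C A k x)" by (rule norm_triangle_ineq4)
    finally show "\<kappa> / 2 * norm z ^ n * norm x \<le> norm (pencil A n z x)" using low by linarith
  qed (use \<kappa> in auto)
qed

lemma numer_eq_0_imp:
  assumes "\<And>i. i < n \<Longrightarrow> numer_coeff A n y i = 0" "j < n"
  shows "y j = 0"
  using assms(2)
proof (induction j rule: less_induct)
  case (less j)
  have "numer_coeff A n y (n - 1 - j) = (\<Sum>k\<le>n. if k = n then A n (y j) else 0)"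
    unfolding numer_coeff_def using less by (intro sum.cong) (auto simp: A_rules)
  then have "A n (y j) = 0" using assms(1)[of "n - 1 - j"] less(2) by simp
  then show ?case by (rule leading_inj)
qed

text \<open>A partial fraction without numerator vanishes, so the decomposition into root sequences is unique.\<close>

lemma root_decomposition_unique:
  assumes S: "finite S" "\<And>c. eigenvalue (pencil A n) c \<Longrightarrow> c \<in> S"
    and root: "\<And>c. c \<in> S \<Longrightarrow> root_seq A n c (x c)" and fin: "\<And>c m. m \<ge> M \<Longrightarrow> x c m = 0"
    and zero: "\<And>j. j < n \<Longrightarrow> (\<Sum>c\<in>S. geo c (x c) j) = 0" and c: "c \<in> S"
  shows "x c m = 0"
proof (cases "m < M")
  case True
  have U0: "partial_fraction S M x z = 0" if "z \<notin> S" for z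
  proof -
    have "(\<Sum>j<k. z ^ (k - 1 - j) *\<^sub>C (\<Sum>c\<in>S. geo c (x c) j)) = 0" if "k \<le> n" for k
      using that by (intro sum.neutral) (auto simp: zero)
    then have "pencil A n z (partial_fraction S M x z) = 0"
      using pencil_partial_fraction[of z S x M] that root fin by (simp add: numer_def A_rules)
    then show ?thesis using S(2)[of z] that by (auto simp: eigenvalue_def)
  qed
  obtain \<delta>1 K where \<delta>1: "\<delta>1 > 0" "\<And>z. dist z c < \<delta>1 \<Longrightarrow> norm (partial_fraction (S - {c}) M x z) \<le> K"
    using isCont_bounded_near[OF partial_fraction_continuous[of c "S - {c}" M x]] by blast
  obtain \<delta>2 where \<delta>2: "\<delta>2 > 0" "\<And>z. z \<in> S \<Longrightarrow> z \<noteq> c \<Longrightarrow> \<delta>2 \<le> dist c z"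
    using finite_set_avoid[OF S(1), of c] by blast
  show ?thesis
  proof (rule pole_part_bounded_eq_0[of "min \<delta>1 \<delta>2" m M c])
    fix t :: real assume t: "0 < t" "t < min \<delta>1 \<delta>2"
    have d: "dist (c + of_real t) c = t" "dist c (c + of_real t) = t" using t by (auto simp: dist_norm)
    then have "c + of_real t \<notin> S" using \<delta>2(2)[of "c + of_real t"] t by auto
    then have "pole_part c M (x c) (c + of_real t) = - partial_fraction (S - {c}) M x (c + of_real t)"
      using U0 partial_fraction_split[OF S(1), of M x "c + of_real t" c] c by (simp add: eq_neg_iff_add_eq_0)
    then show "norm (pole_part c M (x c) (c + of_real t)) \<le> K"
      using \<delta>1(2)[of "c + of_real t"] d t by simp
  qed (use \<delta>1 \<delta>2 True in auto)
qed (simp add: fin)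

end


section \<open>Chains and elementary solutions\<close>

text \<open>
  The first \<open>h + 1\<close> vectors of a chain in reverse order: \<open>rev_chain w h m\<close> is the coefficient of \<open>t^m\<close> in the
  elementary solution and of the pole of order \<open>m + 1\<close> in its generating function.
\<close>

definition rev_chain :: "(nat \<Rightarrow> 'a::complex_inner) \<Rightarrow> nat \<Rightarrow> nat \<Rightarrow> 'a" where
  "rev_chain w h m = (if m \<le> h then w (h - m) else 0)"

lemma shift_rev_chain: "shift g (rev_chain w h) = (if g \<le> h then rev_chain w (h - g) else (\<lambda>_. 0))"
  by (auto simp: shift_def rev_chain_def fun_eq_iff)

lemma geo_rev_chain: "geo c (rev_chain w g) i = (\<Sum>m\<le>g. (of_nat (i choose m) * c ^ (i - m)) *\<^sub>C w (g - m))"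
proof -
  have "geo c (rev_chain w g) i = (\<Sum>m\<le>max g i. (of_nat (i choose m) * c ^ (i - m)) *\<^sub>C rev_chain w g m)"
    unfolding geo_explicit by (intro sum.mono_neutral_left) auto
  also have "\<dots> = (\<Sum>m\<le>g. (of_nat (i choose m) * c ^ (i - m)) *\<^sub>C w (g - m))"
    by (intro sum.mono_neutral_cong_right) (auto simp: rev_chain_def)
  finally show ?thesis .
qed

lemma cderiv_eq:
  assumes "(g has_derivative (\<lambda>h. h *\<^sub>C D)) (at c)"
  shows "cderiv g c = (D :: 'a::complex_inner)"
  unfolding cderiv_def
proof (rule some_equality, rule assms)
  fix D' assume "(g has_derivative (\<lambda>h. h *\<^sub>C D')) (at c)"
  then have "(\<lambda>h. h *\<^sub>C D') = (\<lambda>h. h *\<^sub>C D)" using assms by (rule has_derivative_unique)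
  from fun_cong[OF this, of 1] show "D' = D" by simp
qed

context linear_pencil
begin

lemma op_deriv_pencil:
  "op_deriv j (pencil A n) c x = fact j *\<^sub>R (\<Sum>k\<le>n. (of_nat (k choose j) * c ^ (k - j)) *\<^sub>C A k x)"
proof -
  have "(cderiv ^^ j) (\<lambda>b. pencil A n b x) =
      (\<lambda>b. \<Sum>k\<le>n. (fact j * of_nat (k choose j) * b ^ (k - j)) *\<^sub>C A k x)"
  proof (induction j)
    case 0
    then show ?case by (simp add: pencil_def)
  next
    case (Suc j)
    show ?case
    proof
      fix b
      have "((\<lambda>b. (fact j * of_nat (k choose j) * b ^ (k - j)) *\<^sub>C A k x) has_derivative
          (\<lambda>h. h *\<^sub>C ((fact (Suc j) * of_nat (k choose Suc j) * b ^ (k - Suc j)) *\<^sub>C A k x))) (at b)" for k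
      proof -
        have coef: "of_nat (k choose j) * of_nat (k - j) = (of_nat (Suc j) * of_nat (k choose Suc j) :: complex)"
          by (metis binomial_absorb_comp binomial_absorption mult.commute of_nat_mult)
        have "((\<lambda>b. fact j * of_nat (k choose j) * b ^ (k - j)) has_field_derivative
            (fact j * of_nat (k choose j) * (of_nat (k - j) * b ^ (k - j - Suc 0)))) (at b)"
          by (auto intro!: derivative_eq_intros)
        also have "fact j * of_nat (k choose j) * (of_nat (k - j) * b ^ (k - j - Suc 0)) =
            fact (Suc j) * of_nat (k choose Suc j) * b ^ (k - Suc j)"
        proof -
          have "fact j * of_nat (k choose j) * (of_nat (k - j) * b ^ (k - j - Suc 0)) =
              fact j * (of_nat (k choose j) * of_nat (k - j)) * b ^ (k - j - Suc 0)"
            by (simp only: mult.assoc)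
          also have "\<dots> = fact (Suc j) * of_nat (k choose Suc j) * b ^ (k - Suc j)"
            unfolding coef by simp
          finally show ?thesis .
        qed
        finally have "((\<lambda>b. fact j * of_nat (k choose j) * b ^ (k - j)) has_derivative
            (\<lambda>h. (fact (Suc j) * of_nat (k choose Suc j) * b ^ (k - Suc j)) * h)) (at b)"
          by (simp only: has_field_derivative_def)
        from bounded_linear.has_derivative[OF bounded_bilinear.bounded_linear_left[OF bounded_bilinear_scaleC, of "A k x"] this]
        show ?thesis by (simp add: scaleC_scaleC mult.commute)
      qed
      then have "((\<lambda>b. \<Sum>k\<le>n. (fact j * of_nat (k choose j) * b ^ (k - j)) *\<^sub>C A k x) has_derivative
          (\<lambda>h. \<Sum>k\<le>n. h *\<^sub>C ((fact (Suc j) * of_nat (k choose Suc j) * b ^ (k - Suc j)) *\<^sub>C A k x))) (at b)"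
        by (intro has_derivative_sum)
      then show "(cderiv ^^ Suc j) (\<lambda>b. pencil A n b x) b =
          (\<Sum>k\<le>n. (fact (Suc j) * of_nat (k choose Suc j) * b ^ (k - Suc j)) *\<^sub>C A k x)"
        unfolding complex_vector.scale_sum_right[symmetric] funpow.simps comp_def Suc.IH by (rule cderiv_eq)
    qed
  qed
  then show ?thesis
    by (simp add: op_deriv_def scaleR_scaleC complex_vector.scale_sum_right scaleC_scaleC mult.assoc)
qed

text \<open>
  The chain equations are the root sequence conditions after Taylor expansion of the powers of \<open>c\<close>.
\<close>

lemma chain_root_seq:
  assumes chain: "chain (pencil A n) c p w" and h: "h \<le> p"
  shows "root_seq A n c (rev_chain w h)"
proof -
  have "(\<Sum>k\<le>n. A k (geo c (rev_chain w s) k)) = 0" if s: "s \<le> p" for s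
  proof -
    have "(\<Sum>k\<le>n. A k (geo c (rev_chain w s) k)) =
        (\<Sum>k\<le>n. \<Sum>j\<le>s. (of_nat (k choose j) * c ^ (k - j)) *\<^sub>C A k (w (s - j)))"
    proof (intro sum.cong refl)
      fix k assume "k \<in> {..n}"
      then show "A k (geo c (rev_chain w s) k) = (\<Sum>j\<le>s. (of_nat (k choose j) * c ^ (k - j)) *\<^sub>C A k (w (s - j)))"
        by (simp add: geo_rev_chain A_rules)
    qed
    also have "\<dots> = (\<Sum>j\<le>s. (1 / fact j) *\<^sub>C op_deriv j (pencil A n) c (w (s - j)))"
      by (subst sum.swap) (simp add: op_deriv_pencil scaleR_scaleC scaleC_scaleC)
    also have "\<dots> = 0" using chain s by (simp add: chain_def)
    finally show ?thesis .
  qed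
  then show ?thesis
    unfolding root_seq_def shift_rev_chain using h by (auto simp: A_rules)
qed

end

definition exp_poly :: "complex \<Rightarrow> nat \<Rightarrow> (nat \<Rightarrow> 'a::complex_inner) \<Rightarrow> real \<Rightarrow> 'a" where
  "exp_poly c M \<xi> t = exp (\<i> * c * of_real t) *\<^sub>C (\<Sum>m<M. ((\<i> * of_real t) ^ m / fact m) *\<^sub>C \<xi> m)"

lemma exp_poly_zero [simp]: "exp_poly c M (\<lambda>_. 0) t = 0"
  by (simp add: exp_poly_def)

lemma exp_poly_add: "exp_poly c M (\<lambda>m. \<xi> m + \<eta> m) t = exp_poly c M \<xi> t + exp_poly c M \<eta> t"
  by (simp add: exp_poly_def scaleC_add_right sum.distrib)

lemma exp_poly_scaleC: "exp_poly c M (\<lambda>m. a *\<^sub>C \<xi> m) t = a *\<^sub>C exp_poly c M \<xi> t"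
  by (simp add: exp_poly_def complex_vector.scale_sum_right scaleC_scaleC mult_ac)

lemma exp_poly_sum: "exp_poly c M (\<lambda>m. \<Sum>i\<in>I. \<xi> i m) t = (\<Sum>i\<in>I. exp_poly c M (\<xi> i) t)"
  by (induction I rule: infinite_finite_induct) (auto simp: exp_poly_add)

lemma exp_poly_enlarge: "M \<le> M' \<Longrightarrow> (\<And>m. m \<ge> M \<Longrightarrow> \<xi> m = 0) \<Longrightarrow> exp_poly c M \<xi> t = exp_poly c M' \<xi> t"
  unfolding exp_poly_def by (intro arg_cong[where f = "(*\<^sub>C) _"] sum.mono_neutral_left) auto

lemma elementary_solution_exp_poly:
  assumes "h < M"
  shows "elementary_solution c w h = exp_poly c M (rev_chain w h)"
proof
  fix t
  have "exp_poly c M (rev_chain w h) t = exp_poly c (Suc h) (rev_chain w h) t"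
    using assms by (intro exp_poly_enlarge[symmetric]) (auto simp: rev_chain_def)
  then show "elementary_solution c w h t = exp_poly c M (rev_chain w h) t"
    by (simp add: elementary_solution_def exp_poly_def rev_chain_def lessThan_Suc_atMost)
qed

lemma exp_poly_has_vector_derivative:
  assumes fin: "\<And>m. m \<ge> M \<Longrightarrow> \<xi> m = 0"
  shows "(exp_poly c M \<xi> has_vector_derivative
    \<i> *\<^sub>C exp_poly c M (\<lambda>m. c *\<^sub>C \<xi> m + \<xi> (Suc m)) t) (at t within S)"
proof -
  let ?P = "\<lambda>t. \<Sum>m<M. ((\<i> * of_real t) ^ m / fact m) *\<^sub>C \<xi> m"
  have E: "((\<lambda>t. exp (\<i> * c * of_real t)) has_vector_derivative \<i> * c * exp (\<i> * c * of_real t)) (at t within S)"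
    by (auto intro!: derivative_eq_intros has_vector_derivative_real_field)
  have "((\<lambda>t. ((\<i> * of_real t) ^ m / fact m) *\<^sub>C \<xi> m) has_vector_derivative
      (if m = 0 then 0 else \<i> *\<^sub>C (((\<i> * of_real t) ^ (m - 1) / fact (m - 1)) *\<^sub>C \<xi> m))) (at t within S)" for m
  proof -
    have "((\<lambda>z. (\<i> * z) ^ m / fact m) has_field_derivative of_nat m * \<i> * (\<i> * of_real t) ^ (m - 1) / fact m) (at (of_real t))"
      by (auto intro!: derivative_eq_intros)
    then have "((\<lambda>t. (\<i> * of_real t) ^ m / fact m) has_vector_derivative
        of_nat m * \<i> * (\<i> * of_real t) ^ (m - 1) / fact m) (at t within S)"
      by (rule has_vector_derivative_real_field)
    from bounded_linear.has_vector_derivative[OF bounded_bilinear.bounded_linear_left[OF bounded_bilinear_scaleC, of "\<xi> m"] this]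
    show ?thesis
    proof (cases m)
      case (Suc m')
      have "of_nat m * \<i> * (\<i> * of_real t) ^ (m - 1) / fact m = \<i> * ((\<i> * of_real t) ^ (m - 1) / fact (m - 1))"
        unfolding Suc by (simp add: field_simps del: of_nat_Suc)
      then show ?thesis
        using \<open>((\<lambda>x. ((\<i> * of_real x) ^ m / fact m) *\<^sub>C \<xi> m) has_vector_derivative _) _\<close>
        by (simp add: Suc scaleC_scaleC)
    qed simp
  qed
  then have "(?P has_vector_derivative (\<Sum>m<M. if m = 0 then 0 else
      \<i> *\<^sub>C (((\<i> * of_real t) ^ (m - 1) / fact (m - 1)) *\<^sub>C \<xi> m))) (at t within S)"
    by (intro has_vector_derivative_sum)
  also have "(\<Sum>m<M. if m = 0 then 0 else \<i> *\<^sub>C (((\<i> * of_real t) ^ (m - 1) / fact (m - 1)) *\<^sub>C \<xi> m)) =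
      \<i> *\<^sub>C (\<Sum>m<M. ((\<i> * of_real t) ^ m / fact m) *\<^sub>C \<xi> (Suc m))"
  proof (cases M)
    case (Suc M')
    have "(\<Sum>m<Suc M'. if m = 0 then 0 else \<i> *\<^sub>C (((\<i> * of_real t) ^ (m - 1) / fact (m - 1)) *\<^sub>C \<xi> m)) =
        (\<Sum>m<M'. \<i> *\<^sub>C (((\<i> * of_real t) ^ m / fact m) *\<^sub>C \<xi> (Suc m)))"
      by (subst sum.lessThan_Suc_shift) simp
    moreover have "\<xi> (Suc M') = 0" using fin Suc by simp
    ultimately show ?thesis by (simp add: Suc complex_vector.scale_sum_right scaleC_add_right)
  qed simp
  finally have "(exp_poly c M \<xi> has_vector_derivative
      exp (\<i> * c * of_real t) *\<^sub>C (\<i> *\<^sub>C (\<Sum>m<M. ((\<i> * of_real t) ^ m / fact m) *\<^sub>C \<xi> (Suc m))) +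
      (\<i> * c * exp (\<i> * c * of_real t)) *\<^sub>C ?P t) (at t within S)"
    unfolding exp_poly_def using E by (intro has_vector_derivative_scaleC)
  also have "exp (\<i> * c * of_real t) *\<^sub>C (\<i> *\<^sub>C (\<Sum>m<M. ((\<i> * of_real t) ^ m / fact m) *\<^sub>C \<xi> (Suc m))) +
      (\<i> * c * exp (\<i> * c * of_real t)) *\<^sub>C ?P t = \<i> *\<^sub>C exp_poly c M (\<lambda>m. c *\<^sub>C \<xi> m + \<xi> (Suc m)) t"
    unfolding exp_poly_add exp_poly_scaleC by (simp add: exp_poly_def scaleC_scaleC scaleC_add_right mult_ac)
  finally show ?thesis .
qed

lemma higher_deriv_on_0: "higher_deriv_on S 0 f = f"
  by (simp add: higher_deriv_on_def)

lemma higher_deriv_on_Suc: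
  "higher_deriv_on S (Suc j) f t = vector_derivative (higher_deriv_on S j f) (at t within S)"
  by (simp add: higher_deriv_on_def)

lemma higher_deriv_on_eqI:
  assumes deriv: "\<And>j t. j < J \<Longrightarrow> t \<in> S \<Longrightarrow> (f j has_vector_derivative f (Suc j) t) (at t within S)"
    and limit: "\<And>t. t \<in> S \<Longrightarrow> at t within S \<noteq> bot"
    and start: "\<And>t. t \<in> S \<Longrightarrow> g t = f 0 t" and "j \<le> J" "t \<in> S"
  shows "higher_deriv_on S j g t = f j t"
  using assms(4,5)
proof (induction j arbitrary: t)
  case 0
  then show ?case by (simp add: higher_deriv_on_0 start)
next
  case (Suc j)
  have "(higher_deriv_on S j g has_vector_derivative f (Suc j) t) (at t within S)"
    by (rule has_vector_derivative_transform[OF _ _ deriv[of j t]]) (use Suc in auto)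
  then show ?case
    unfolding higher_deriv_on_Suc using limit Suc by (intro vector_derivative_within) auto
qed

lemma at_within_Ici_neq_bot: "t \<in> {0..} \<Longrightarrow> at t within {0::real..} \<noteq> bot"
proof -
  assume t: "t \<in> {0::real..}"
  have "t islimpt {0..}"
  proof (rule connected_imp_perfect)
    fix a :: real
    have "0 \<in> {0::real..}" "1 \<in> {0::real..}" by auto
    then show "{0::real..} \<noteq> {a}" by (metis singletonD zero_neq_one)
  qed (use t in auto)
  then show ?thesis by (simp add: trivial_limit_within)
qed

text \<open>
  On coefficients \<open>D\<close> acts as \<open>c + shift\<close>, so \<open>D^j\<close> produces the values of \<open>geo\<close> at the shifted sequences.
\<close>

lemma higher_deriv_exp_poly:
  fixes x :: "complex \<Rightarrow> nat \<Rightarrow> 'a::complex_inner"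
  assumes fin: "\<And>c m. m \<ge> M \<Longrightarrow> x c m = 0"
    and limit: "\<And>t. t \<in> S \<Longrightarrow> at t within S \<noteq> bot"
    and v: "\<And>t. t \<in> S \<Longrightarrow> v t = (\<Sum>c\<in>C. exp_poly c M (x c) t)" and t: "t \<in> S"
  shows "higher_deriv_on S j v t = \<i> ^ j *\<^sub>C (\<Sum>c\<in>C. exp_poly c M (\<lambda>m. geo c (shift m (x c)) j) t)"
    and "(higher_deriv_on S j v has_vector_derivative higher_deriv_on S (Suc j) v t) (at t within S)"
proof -
  define f where "f j t = \<i> ^ j *\<^sub>C (\<Sum>c\<in>C. exp_poly c M (\<lambda>m. geo c (shift m (x c)) j) t)" for j t
  have deriv: "(f j has_vector_derivative f (Suc j) t) (at t within S)" for j t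
  proof -
    have fin': "geo c (shift m (x c)) j = 0" if "m \<ge> M" for m c
    proof -
      have "shift m (x c) = (\<lambda>_. 0)" using fin that by (auto simp: shift_def)
      then show ?thesis by simp
    qed
    have "((\<lambda>t. \<Sum>c\<in>C. exp_poly c M (\<lambda>m. geo c (shift m (x c)) j) t) has_vector_derivative
        (\<Sum>c\<in>C. \<i> *\<^sub>C exp_poly c M (\<lambda>m. c *\<^sub>C geo c (shift m (x c)) j + geo c (shift (Suc m) (x c)) j) t)) (at t within S)"
      using fin' by (intro has_vector_derivative_sum exp_poly_has_vector_derivative)
    then have "((\<lambda>t. \<Sum>c\<in>C. exp_poly c M (\<lambda>m. geo c (shift m (x c)) j) t) has_vector_derivative
        \<i> *\<^sub>C (\<Sum>c\<in>C. exp_poly c M (\<lambda>m. geo c (shift m (x c)) (Suc j)) t)) (at t within S)"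
      by (simp add: complex_vector.scale_sum_right del: shift_apply)
    from bounded_linear.has_vector_derivative[OF bounded_bilinear.bounded_linear_right[OF bounded_bilinear_scaleC, of "\<i> ^ j"] this]
    show ?thesis unfolding f_def by (simp add: scaleC_scaleC mult.commute del: shift_apply geo.simps)
  qed
  have start: "v t = f 0 t" if "t \<in> S" for t using v[OF that] by (simp add: f_def)
  have eq: "higher_deriv_on S j v t = f j t" if "t \<in> S" for j t
    using deriv limit start that by (intro higher_deriv_on_eqI[of j S f v j t]) auto
  then show "higher_deriv_on S j v t = \<i> ^ j *\<^sub>C (\<Sum>c\<in>C. exp_poly c M (\<lambda>m. geo c (shift m (x c)) j) t)"
    using t by (simp add: f_def)
  show "(higher_deriv_on S j v has_vector_derivative higher_deriv_on S (Suc j) v t) (at t within S)"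
    unfolding eq[OF t] by (rule has_vector_derivative_transform[OF t _ deriv]) (simp add: eq)
qed

lemma minus_i_power_i_power: "(- \<i>) ^ j *\<^sub>C (\<i> ^ j *\<^sub>C x) = (x :: 'a::complex_inner)"
  by (simp add: scaleC_scaleC power_mult_distrib[symmetric])

lemma exp_poly_at_0: "(\<And>m. m \<ge> M \<Longrightarrow> \<xi> m = 0) \<Longrightarrow> exp_poly c M \<xi> 0 = \<xi> 0"
proof (cases M)
  case (Suc M')
  have "(\<Sum>m<M. ((\<i> * of_real 0) ^ m / fact m) *\<^sub>C \<xi> m) = (\<Sum>m<M. if m = 0 then \<xi> 0 else 0)"
    by (intro sum.cong) auto
  then show ?thesis using Suc by (simp add: exp_poly_def)
qed (simp add: exp_poly_def)

lemma derived_chain_eq: "derived_chain c w h j = geo c (rev_chain w h) j"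
proof -
  let ?x = "\<lambda>_. rev_chain w h"
  have "higher_deriv_on UNIV j (elementary_solution c w h) 0 =
      \<i> ^ j *\<^sub>C (\<Sum>c\<in>{c}. exp_poly c (Suc h) (\<lambda>m. geo c (shift m (rev_chain w h)) j) 0)"
    by (rule higher_deriv_exp_poly[where x = ?x])
      (auto simp: rev_chain_def elementary_solution_exp_poly[of h "Suc h"])
  also have "(\<Sum>c\<in>{c}. exp_poly c (Suc h) (\<lambda>m. geo c (shift m (rev_chain w h)) j) 0) = geo c (rev_chain w h) j"
    by (simp add: exp_poly_at_0 shift_rev_chain del: shift_apply)
  finally show ?thesis by (simp only: derived_chain_def minus_i_power_i_power)
qed


section \<open>The local structure at a real eigenvalue\<close>

definition conv :: "(nat \<Rightarrow> 'a::complex_inner) \<Rightarrow> (nat \<Rightarrow> 'a) \<Rightarrow> nat \<Rightarrow> complex" where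
  "conv q w g = (\<Sum>j\<le>g. cinner (q j) (w (g - j)))"

lemma recenter_high: "D \<le> m \<Longrightarrow> recenter c D a m = 0"
  unfolding recenter_def by (intro sum.neutral) auto

text \<open>
  For real \<open>c\<close> the derived chain, paired with the coefficients of a polynomial at \<open>0\<close>, gives the
  convolution of the chain with the Taylor coefficients at \<open>c\<close>. This translates the definition of regularity
  into a statement about numerators.
\<close>

lemma conv_recenter_derived_chain:
  "conv (recenter (of_real c) D a) w g = (\<Sum>i<D. cinner (a i) (derived_chain (of_real c) w g i))"
proof -
  have "conv (recenter (of_real c) D a) w g =
      (\<Sum>m\<le>g. \<Sum>i<D. of_nat (i choose m) * of_real c ^ (i - m) * cinner (a i) (w (g - m)))"
    by (simp add: conv_def recenter_def cinner_sum_left cinner_scaleC_left)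
  also have "\<dots> = (\<Sum>i<D. cinner (a i) (derived_chain (of_real c) w g i))"
    by (subst sum.swap) (simp add: derived_chain_eq geo_rev_chain cinner_sum_right cinner_scaleC_right)
  finally show ?thesis .
qed

lemma pair_rev_chain:
  assumes q: "\<And>j. j \<ge> D \<Longrightarrow> q j = 0"
  shows "(\<Sum>j<D. cinner (q j) (rev_chain w h (g + j))) = (if g \<le> h then conv q w (h - g) else 0)"
proof (cases "g \<le> h")
  case True
  have "(\<Sum>j<D. cinner (q j) (rev_chain w h (g + j))) =
      (\<Sum>j\<in>{..<D} \<union> {..h - g}. cinner (q j) (rev_chain w h (g + j)))"
    using q by (intro sum.mono_neutral_left) auto
  also have "\<dots> = (\<Sum>j\<le>h - g. cinner (q j) (w (h - g - j)))"
    using True by (intro sum.mono_neutral_cong_right) (auto simp: rev_chain_def)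
  finally show ?thesis using True by (simp add: conv_def)
qed (simp add: rev_chain_def)

lemma triangle_swap:
  "(\<Sum>j\<le>P. \<Sum>r\<le>P - j. F j r) = (\<Sum>r\<le>P. \<Sum>j\<le>P - r. F j r)" for P :: nat
  by (simp add: sum.Sigma) (rule sum.reindex_bij_witness[of _ "\<lambda>(r, j). (j, r)" "\<lambda>(j, r). (r, j)"], auto)

definition chain_comb ::
  "nat \<Rightarrow> (nat \<Rightarrow> nat) \<Rightarrow> (nat \<Rightarrow> nat \<Rightarrow> 'a::complex_inner) \<Rightarrow> (nat \<Rightarrow> nat \<Rightarrow> complex) \<Rightarrow> nat \<Rightarrow> 'a" where
  "chain_comb N p w a m = (\<Sum>k=1..N. \<Sum>h\<le>p k. a k h *\<^sub>C rev_chain (w k) h m)"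

text \<open>
  At the highest index \<open>H\<close> of a nonzero coefficient only the eigenvectors \<open>w k 0\<close> contribute to the entry \<open>H\<close>, and these are
  independent.
\<close>

lemma chain_comb_unique:
  assumes sys: "chain_system F c N p w"
    and eq: "\<And>m. chain_comb N p w d m = 0" and k: "k \<in> {1..N}" "h \<le> p k"
  shows "d k h = 0"
proof (rule ccontr)
  assume nz: "d k h \<noteq> 0"
  let ?H = "{h. \<exists>k\<in>{1..N}. h \<le> p k \<and> d k h \<noteq> 0}"
  have fin: "finite ?H"
    by (rule finite_subset[of _ "\<Union>k\<in>{1..N}. {..p k}"]) auto
  have "h \<in> ?H" using nz k by blast
  then have ne: "?H \<noteq> {}" by blast
  define H where "H = Max ?H"
  obtain k0 where k0: "k0 \<in> {1..N}" "H \<le> p k0" "d k0 H \<noteq> 0" using Max_in[OF fin ne] unfolding H_def by blast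
  have above: "d k h = 0" if "k \<in> {1..N}" "h \<le> p k" "H < h" for k h
  proof (rule ccontr)
    assume "d k h \<noteq> 0"
    then have "h \<in> ?H" using that by blast
    then have "h \<le> H" unfolding H_def by (rule Max_ge[OF fin])
    then show False using that by simp
  qed
  let ?u = "\<lambda>k. if H \<le> p k then d k H else 0"
  have "chain_comb N p w d H = (\<Sum>k=1..N. ?u k *\<^sub>C w k 0)"
    unfolding chain_comb_def
  proof (intro sum.cong refl)
    fix k assume k: "k \<in> {1..N}"
    have "(\<Sum>h\<le>p k. d k h *\<^sub>C rev_chain (w k) h H) = (\<Sum>h\<le>p k. if h = H then d k H *\<^sub>C w k 0 else 0)"
      using above[OF k] by (intro sum.cong refl) (auto simp: rev_chain_def)
    then show "(\<Sum>h\<le>p k. d k h *\<^sub>C rev_chain (w k) h H) = ?u k *\<^sub>C w k 0" by auto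
  qed
  then have zero: "(\<Sum>k=1..N. ?u k *\<^sub>C w k 0) = 0" using eq by simp
  have inj: "inj_on (\<lambda>k. w k 0) {1..N}" and ind: "complex_vector.independent ((\<lambda>k. w k 0) ` {1..N})"
    using sys by (auto simp: chain_system_def)
  have "(\<Sum>v\<in>(\<lambda>k. w k 0) ` {1..N}. ?u (the_inv_into {1..N} (\<lambda>k. w k 0) v) *\<^sub>C v) = 0"
  proof -
    have "(\<Sum>k=1..N. ?u (the_inv_into {1..N} (\<lambda>k. w k 0) (w k 0)) *\<^sub>C w k 0) = (\<Sum>k=1..N. ?u k *\<^sub>C w k 0)"
      by (intro sum.cong refl) (simp only: the_inv_into_f_f[OF inj])
    then show ?thesis using zero by (simp only: sum.reindex[OF inj] comp_def)
  qed
  from complex_vector.independentD[OF ind _ _ this, of "w k0 0"] k0(1)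
  have "?u k0 = 0" by (simp only: the_inv_into_f_f[OF inj k0(1)] finite_imageI finite_atLeastAtMost subset_refl image_eqI)
  then show False using k0 by simp
qed

lemma pole_part_scaleC: "pole_part c M (\<lambda>m. a *\<^sub>C \<xi> m) z = a *\<^sub>C pole_part c M \<xi> z"
  by (simp add: pole_part_def complex_vector.scale_sum_right scaleC_scaleC mult_ac)

lemma pole_part_sum: "pole_part c M (\<lambda>m. \<Sum>i\<in>I. \<xi> i m) z = (\<Sum>i\<in>I. pole_part c M (\<xi> i) z)"
  by (induction I rule: infinite_finite_induct) (auto simp: pole_part_add)

lemma pole_part_diff: "pole_part c M (\<lambda>m. \<xi> m - \<eta> m) z = pole_part c M \<xi> z - pole_part c M \<eta> z"
  using pole_part_add[of c M "\<lambda>m. \<xi> m - \<eta> m" \<eta> z] by (simp add: algebra_simps)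

lemma vpoly_bounded:
  obtains K where "K \<ge> 0" "\<And>z. norm z \<le> r \<Longrightarrow> norm (vpoly D a z) \<le> K"
proof (rule that[of "\<Sum>i<D. \<bar>r\<bar> ^ i * norm (a i)"])
  show "0 \<le> (\<Sum>i<D. \<bar>r\<bar> ^ i * norm (a i))" by (simp add: sum_nonneg)
  fix z :: complex assume "norm z \<le> r"
  then show "norm (vpoly D a z) \<le> (\<Sum>i<D. \<bar>r\<bar> ^ i * norm (a i))"
    unfolding vpoly_def by (intro sum_norm_le) (auto simp: norm_power intro!: mult_right_mono power_mono)
qed

context linear_pencil
begin

text \<open>
  The principal part of the inverse determines the principal part of every partial fraction whose
  image under the pencil is a polynomial.
\<close>

lemma principal_part_coefficients:
  assumes acs: "adjoint_canonical_system (pencil A n) c N p w z"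
    and \<delta>: "\<delta> > 0" and q: "\<And>j. j \<ge> D \<Longrightarrow> q j = 0"
    and U: "\<And>t. 0 < t \<Longrightarrow> t < \<delta> \<Longrightarrow>
      pencil A n (c + of_real t) (pole_part c M \<xi> (c + of_real t) + B t) = vpoly D q (of_real t)"
    and B: "\<And>t. 0 < t \<Longrightarrow> t < \<delta> \<Longrightarrow> norm (B t) \<le> K"
    and M: "\<And>k. k \<in> {1..N} \<Longrightarrow> p k < M" and m: "m < M"
  shows "\<xi> m = chain_comb N p w (\<lambda>k h. conv q (z k) (p k - h)) m"
proof -
  let ?F = "pencil A n"
  have "\<forall>x. \<exists>r>0. \<exists>G. (\<forall>b\<in>ball c r. \<exists>D. (G has_derivative (\<lambda>h. h *\<^sub>C D)) (at b)) \<and>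
        (\<forall>b\<in>ball c r - {c}. bij (?F b) \<and> inv (?F b) x = principal_part c N p w z b x + G b)"
    using acs by (simp add: adjoint_canonical_system_def)
  then obtain r G where r: "\<And>x. r x > 0" and G1: "\<And>x b. b \<in> ball c (r x) \<Longrightarrow> \<exists>D. (G x has_derivative (\<lambda>h. h *\<^sub>C D)) (at b)"
    and G2: "\<And>x b. b \<in> ball c (r x) - {c} \<Longrightarrow> bij (?F b)"
    and G3: "\<And>x b. b \<in> ball c (r x) - {c} \<Longrightarrow> inv (?F b) x = principal_part c N p w z b x + G x b"
    by metis
  have "\<exists>d k. d > 0 \<and> (\<forall>b. dist b c < d \<longrightarrow> norm (G x b) \<le> k)" for x
  proof -
    have "isCont (G x) c" using G1[of c x] r[of x] has_derivative_continuous by auto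
    then show ?thesis using isCont_bounded_near by metis
  qed
  then obtain d \<kappa> where d: "\<And>x. d x > 0" and Gb: "\<And>x b. dist b c < d x \<Longrightarrow> norm (G x b) \<le> \<kappa> x"
    by metis
  define \<delta>' where "\<delta>' = Min (insert (min 1 \<delta>) ((\<lambda>j. min (r (q j)) (d (q j))) ` {..<Suc D}))"
  have \<delta>': "0 < \<delta>'" "\<delta>' \<le> 1" "\<delta>' \<le> \<delta>" "\<And>j. j < Suc D \<Longrightarrow> \<delta>' \<le> r (q j)" "\<And>j. j < Suc D \<Longrightarrow> \<delta>' \<le> d (q j)"
  proof -
    show "0 < \<delta>'" using r d \<delta> by (auto simp: \<delta>'_def)
    have *: "\<delta>' \<le> y" if "y \<in> insert (min 1 \<delta>) ((\<lambda>j. min (r (q j)) (d (q j))) ` {..<Suc D})" for y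
      unfolding \<delta>'_def using that by (intro Min_le) auto
    show "\<delta>' \<le> 1" "\<delta>' \<le> \<delta>" using *[of "min 1 \<delta>"] by auto
    show "\<delta>' \<le> r (q j)" "\<delta>' \<le> d (q j)" if "j < Suc D" for j
      using *[of "min (r (q j)) (d (q j))"] that by auto
  qed
  define V where "V k j s = (\<Sum>r\<le>s. cinner (q j) (z k (s - r)) *\<^sub>C w k r)" for k j s
  define \<eta> where "\<eta> m = (\<Sum>k=1..N. \<Sum>j<D. if j + m \<le> p k then V k j (p k - (j + m)) else 0)" for m
  (* \<eta> collects the negative powers of t in the product of the principal part with the polynomial,
     P the remaining ones. *)
  define P where "P t = (\<Sum>k=1..N. \<Sum>j<D. \<Sum>e\<le>p k. if e < j then of_real t ^ (j - e - 1) *\<^sub>C V k j (p k - e) else 0)" for t :: real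
  have pp: "(\<Sum>j<D. of_real t ^ j *\<^sub>C principal_part c N p w z (c + of_real t) (q j)) = pole_part c M \<eta> (c + of_real t) + P t"
    if t: "0 < t" for t :: real
  proof -
    let ?t = "of_real t :: complex"
    have t0: "?t \<noteq> 0" using t by simp
    have summand: "?t ^ j *\<^sub>C (\<Sum>s\<le>p k. (1 / ?t ^ (p k + 1 - s)) *\<^sub>C V k j s) =
        (\<Sum>m<M. (1 / ?t ^ Suc m) *\<^sub>C (if j + m \<le> p k then V k j (p k - (j + m)) else 0)) +
        (\<Sum>e\<le>p k. if e < j then ?t ^ (j - e - 1) *\<^sub>C V k j (p k - e) else 0)" if k: "k \<in> {1..N}" for k j
    proof -
      have "(\<Sum>s\<le>p k. (1 / ?t ^ (p k + 1 - s)) *\<^sub>C V k j s) =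
          (\<Sum>s<Suc (p k). (1 / ?t ^ (p k + 1 - (Suc (p k) - Suc s))) *\<^sub>C V k j (Suc (p k) - Suc s))"
        unfolding lessThan_Suc_atMost[symmetric] by (rule sum.nat_diff_reindex[symmetric])
      also have "\<dots> = (\<Sum>e\<le>p k. (1 / ?t ^ Suc e) *\<^sub>C V k j (p k - e))"
        unfolding lessThan_Suc_atMost by (intro sum.cong) (auto simp: Suc_diff_le)
      finally have "?t ^ j *\<^sub>C (\<Sum>s\<le>p k. (1 / ?t ^ (p k + 1 - s)) *\<^sub>C V k j s) =
          (\<Sum>e\<le>p k. (?t ^ j / ?t ^ Suc e) *\<^sub>C V k j (p k - e))"
        by (simp add: complex_vector.scale_sum_right scaleC_scaleC)
      also have "\<dots> = (\<Sum>e\<le>p k. (if j \<le> e then (1 / ?t ^ Suc (e - j)) *\<^sub>C V k j (p k - e) else 0) +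
          (if e < j then ?t ^ (j - e - 1) *\<^sub>C V k j (p k - e) else 0))"
      proof (intro sum.cong refl)
        fix e
        show "(?t ^ j / ?t ^ Suc e) *\<^sub>C V k j (p k - e) =
            (if j \<le> e then (1 / ?t ^ Suc (e - j)) *\<^sub>C V k j (p k - e) else 0) +
            (if e < j then ?t ^ (j - e - 1) *\<^sub>C V k j (p k - e) else 0)"
        proof (cases "j \<le> e")
          case True
          then have "?t ^ Suc e = ?t ^ j * ?t ^ Suc (e - j)" by (simp only: power_add[symmetric]) simp
          then show ?thesis using True t0 by simp
        next
          case False
          then have "?t ^ j = ?t ^ (j - e - 1) * ?t ^ Suc e" by (simp only: power_add[symmetric]) simp
          then show ?thesis using False t0 by (simp del: power_Suc)
        qed
      qed
      also have "\<dots> = (\<Sum>e\<le>p k. if j \<le> e then (1 / ?t ^ Suc (e - j)) *\<^sub>C V k j (p k - e) else 0) +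
          (\<Sum>e\<le>p k. if e < j then ?t ^ (j - e - 1) *\<^sub>C V k j (p k - e) else 0)"
        by (rule sum.distrib)
      also have "(\<Sum>e\<le>p k. if j \<le> e then (1 / ?t ^ Suc (e - j)) *\<^sub>C V k j (p k - e) else 0) =
          (\<Sum>e\<in>{j..p k}. (1 / ?t ^ Suc (e - j)) *\<^sub>C V k j (p k - e))"
        by (intro sum.mono_neutral_cong_right) auto
      also have "\<dots> = (\<Sum>m\<in>{m. m < M \<and> j + m \<le> p k}. (1 / ?t ^ Suc m) *\<^sub>C V k j (p k - (j + m)))"
        using M[OF k] by (intro sum.reindex_bij_witness[where i = "\<lambda>m. j + m" and j = "\<lambda>e. e - j"]) auto
      also have "\<dots> = (\<Sum>m<M. (1 / ?t ^ Suc m) *\<^sub>C (if j + m \<le> p k then V k j (p k - (j + m)) else 0))"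
        by (intro sum.mono_neutral_cong_left) auto
      finally show ?thesis .
    qed
    have "(\<Sum>j<D. ?t ^ j *\<^sub>C principal_part c N p w z (c + ?t) (q j)) =
        (\<Sum>j<D. \<Sum>k=1..N. ?t ^ j *\<^sub>C (\<Sum>s\<le>p k. (1 / ?t ^ (p k + 1 - s)) *\<^sub>C V k j s))"
      by (simp add: principal_part_def V_def complex_vector.scale_sum_right)
    also have "\<dots> = (\<Sum>k=1..N. \<Sum>j<D.
        (\<Sum>m<M. (1 / ?t ^ Suc m) *\<^sub>C (if j + m \<le> p k then V k j (p k - (j + m)) else 0)) +
        (\<Sum>e\<le>p k. if e < j then ?t ^ (j - e - 1) *\<^sub>C V k j (p k - e) else 0))"
      by (subst sum.swap) (intro sum.cong refl summand)
    also have "\<dots> = (\<Sum>k=1..N. \<Sum>j<D. \<Sum>m<M. (1 / ?t ^ Suc m) *\<^sub>C (if j + m \<le> p k then V k j (p k - (j + m)) else 0)) + P t"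
      by (simp add: sum.distrib P_def)
    also have "(\<Sum>k=1..N. \<Sum>j<D. \<Sum>m<M. (1 / ?t ^ Suc m) *\<^sub>C (if j + m \<le> p k then V k j (p k - (j + m)) else 0)) =
        pole_part c M \<eta> (c + ?t)"
    proof -
      have "(\<Sum>k=1..N. \<Sum>j<D. \<Sum>m<M. (1 / ?t ^ Suc m) *\<^sub>C (if j + m \<le> p k then V k j (p k - (j + m)) else 0)) =
        (\<Sum>k=1..N. \<Sum>m<M. \<Sum>j<D. (1 / ?t ^ Suc m) *\<^sub>C (if j + m \<le> p k then V k j (p k - (j + m)) else 0))"
        by (intro sum.cong refl sum.swap)
      also have "\<dots> = (\<Sum>m<M. \<Sum>k=1..N. \<Sum>j<D. (1 / ?t ^ Suc m) *\<^sub>C (if j + m \<le> p k then V k j (p k - (j + m)) else 0))"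
        by (rule sum.swap)
      finally show ?thesis
        by (simp add: pole_part_def \<eta>_def complex_vector.scale_sum_right del: power_Suc)
    qed
    finally show ?thesis .
  qed
  have eq: "pole_part c M \<xi> (c + of_real t) + B t =
      pole_part c M \<eta> (c + of_real t) + (P t + (\<Sum>j<D. of_real t ^ j *\<^sub>C G (q j) (c + of_real t)))"
    if t: "0 < t" "t < \<delta>'" for t :: real
  proof -
    let ?t = "of_real t :: complex"
    have near: "c + ?t \<in> ball c (r (q j)) - {c}" if "j < Suc D" for j
      using t \<delta>'(4)[OF that] by (auto simp: dist_norm)
    have bij: "bij (?F (c + ?t))" using G2[OF near[of 0]] by simp
    have "?F (c + ?t) (\<Sum>j<D. ?t ^ j *\<^sub>C inv (?F (c + ?t)) (q j)) = vpoly D q ?t"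
      using bij by (simp add: clinear_rules[OF pencil_clinear] vpoly_def bij_is_surj surj_f_inv_f)
    then have "?F (c + ?t) (pole_part c M \<xi> (c + ?t) + B t) = ?F (c + ?t) (\<Sum>j<D. ?t ^ j *\<^sub>C inv (?F (c + ?t)) (q j))"
      using U[of t] t \<delta>'(3) by simp
    then have "pole_part c M \<xi> (c + ?t) + B t = (\<Sum>j<D. ?t ^ j *\<^sub>C inv (?F (c + ?t)) (q j))"
      by (rule injD[OF bij_is_inj[OF bij]])
    also have "\<dots> = (\<Sum>j<D. ?t ^ j *\<^sub>C (principal_part c N p w z (c + ?t) (q j) + G (q j) (c + ?t)))"
      by (intro sum.cong refl) (simp add: G3[OF near])
    also have "\<dots> = (\<Sum>j<D. ?t ^ j *\<^sub>C principal_part c N p w z (c + ?t) (q j)) + (\<Sum>j<D. ?t ^ j *\<^sub>C G (q j) (c + ?t))"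
      by (simp add: scaleC_add_right sum.distrib)
    finally show ?thesis by (simp add: pp[OF t(1)] add.assoc)
  qed
  have pw: "norm (of_real t ^ i *\<^sub>C x) \<le> norm x" if "0 < t" "t < \<delta>'" for t :: real and i and x :: 'a
    using that \<delta>'(2) by (simp add: norm_power mult_left_le_one_le power_le_one)
  define KP where "KP = (\<Sum>k=1..N. \<Sum>j<D. \<Sum>e\<le>p k. norm (V k j (p k - e)))"
  have Pb: "norm (P t) \<le> KP" if t: "0 < t" "t < \<delta>'" for t
    unfolding P_def KP_def using pw[OF t] by (intro sum_norm_le) (auto)
  have Gbd: "norm (\<Sum>j<D. of_real t ^ j *\<^sub>C G (q j) (c + of_real t)) \<le> (\<Sum>j<D. \<kappa> (q j))" if t: "0 < t" "t < \<delta>'" for t :: real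
  proof (rule sum_norm_le)
    fix j assume "j \<in> {..<D}"
    then have "dist (c + of_real t) c < d (q j)" using t \<delta>'(5)[of j] by (simp add: dist_norm)
    then show "norm (of_real t ^ j *\<^sub>C G (q j) (c + of_real t)) \<le> \<kappa> (q j)"
      using pw[OF t, of j "G (q j) (c + of_real t)"] Gb[of "c + of_real t" "q j"] by linarith
  qed
  have "\<xi> m - \<eta> m = 0"
  proof (rule pole_part_bounded_eq_0[of \<delta>' m M c])
    fix t :: real assume t: "0 < t" "t < \<delta>'"
    have "pole_part c M (\<lambda>m. \<xi> m - \<eta> m) (c + of_real t) =
        P t + (\<Sum>j<D. of_real t ^ j *\<^sub>C G (q j) (c + of_real t)) - B t"
      using eq[OF t] by (simp add: pole_part_diff algebra_simps)
    also have "norm \<dots> \<le> KP + (\<Sum>j<D. \<kappa> (q j)) + K"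
      using Pb[OF t] Gbd[OF t] B[of t] t \<delta>'(3)
      by (intro order_trans[OF norm_triangle_ineq4] add_mono order_trans[OF norm_triangle_ineq]) auto
    finally show "norm (pole_part c M (\<lambda>m. \<xi> m - \<eta> m) (c + of_real t)) \<le> KP + (\<Sum>j<D. \<kappa> (q j)) + K" .
  qed (use \<delta>' m in auto)
  moreover have "\<eta> m = chain_comb N p w (\<lambda>k h. conv q (z k) (p k - h)) m"
    unfolding \<eta>_def chain_comb_def
  proof (rule sum.cong[OF refl])
    fix k assume "k \<in> {1..N}"
    show "(\<Sum>j<D. if j + m \<le> p k then V k j (p k - (j + m)) else 0) =
        (\<Sum>h\<le>p k. conv q (z k) (p k - h) *\<^sub>C rev_chain (w k) h m)"
    proof (cases "m \<le> p k")
      case False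
      then show ?thesis by (auto simp: rev_chain_def intro!: sum.neutral)
    next
      case True
      let ?P = "p k - m"
      have "(\<Sum>j<D. if j + m \<le> p k then V k j (p k - (j + m)) else 0) = (\<Sum>j\<le>?P. V k j (?P - j))"
      proof -
        have "(\<Sum>j<D. if j + m \<le> p k then V k j (p k - (j + m)) else 0) =
            (\<Sum>j<D + Suc ?P. if j \<le> ?P then V k j (?P - j) else 0)"
          using True q by (intro sum.mono_neutral_cong_left) (auto simp: V_def add.commute)
        also have "\<dots> = (\<Sum>j\<le>?P. V k j (?P - j))"
          by (intro sum.mono_neutral_cong_right) auto
        finally show ?thesis .
      qed
      also have "\<dots> = (\<Sum>r\<le>?P. \<Sum>j\<le>?P - r. cinner (q j) (z k (?P - j - r)) *\<^sub>C w k r)"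
        unfolding V_def by (rule triangle_swap)
      also have "\<dots> = (\<Sum>r\<le>?P. conv q (z k) (?P - r) *\<^sub>C w k r)"
        unfolding conv_def complex_vector.scale_sum_left by (intro sum.cong refl) (simp add: diff_right_commute add_ac)
      also have "\<dots> = (\<Sum>h\<in>{m..p k}. conv q (z k) (p k - h) *\<^sub>C rev_chain (w k) h m)"
        using True by (intro sum.reindex_bij_witness[where i = "\<lambda>h. h - m" and j = "\<lambda>r. m + r"])
          (auto simp: rev_chain_def)
      also have "\<dots> = (\<Sum>h\<le>p k. conv q (z k) (p k - h) *\<^sub>C rev_chain (w k) h m)"
        by (intro sum.mono_neutral_left) (auto simp: rev_chain_def)
      finally show ?thesis .
    qed
  qed
  ultimately show ?thesis by simp
qed

end


section \<open>Dissipativity and the residues at real eigenvalues\<close>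

locale dissipative_pencil = regular_pencil +
  assumes dissipative: "\<And>(b::real) x. Im (cinner (pencil A n (of_real b) x) x) \<le> 0"
begin

text \<open>
  Cauchy--Schwarz for the form of minus the imaginary part: moving the pencil to the other side of
  the inner product costs only square roots of the norms of the images.
\<close>

lemma pairing_bound:
  fixes b :: real
  defines "F \<equiv> pencil A n (of_real b)"
  shows "norm (cinner (F x) y) \<le> norm x * norm (F y) + 2 * sqrt (norm x * norm (F x)) * sqrt (norm y * norm (F y))"
proof -
  have F: "clinear F" unfolding F_def by (rule pencil_clinear)
  define \<Gamma> where "\<Gamma> x y = (\<i> / 2) * (cinner (F x) y - cinner x (F y))" for x y
  have self: "\<Gamma> x x = of_real (- Im (cinner (F x) x))" for x
  proof -
    have "cinner x (F x) = cnj (cinner (F x) x)" by (rule cinner_commute)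
    then show ?thesis by (simp add: \<Gamma>_def complex_eq_iff)
  qed
  have Re_self: "Re (\<Gamma> x x) \<le> norm x * norm (F x)" for x
  proof -
    have "Re (\<Gamma> x x) \<le> norm (cinner (F x) x)" using abs_Im_le_cmod[of "cinner (F x) x"] by (simp add: self)
    also have "\<dots> \<le> norm (F x) * norm x" by (rule norm_cinner_le)
    finally show ?thesis by (simp add: mult.commute)
  qed
  have nonneg: "0 \<le> Re (\<Gamma> x x)" for x using dissipative[of b x] by (simp add: self F_def)
  have "(norm (\<Gamma> x y))\<^sup>2 \<le> Re (\<Gamma> x x) * Re (\<Gamma> y y)"
  proof (rule Cauchy_Schwarz_semidefinite[OF _ _ _ nonneg])
    show "\<Gamma> x y = cnj (\<Gamma> y x)" for x y
      using cinner_commute[of "F x" y] cinner_commute[of x "F y"] by (simp add: \<Gamma>_def algebra_simps)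
  qed (simp_all add: \<Gamma>_def clinear_rules[OF F] cinner_add_left cinner_scaleC_left algebra_simps)
  also have "\<dots> \<le> (norm x * norm (F x)) * (norm y * norm (F y))"
    by (intro mult_mono Re_self nonneg) auto
  finally have "norm (\<Gamma> x y) \<le> sqrt (norm x * norm (F x)) * sqrt (norm y * norm (F y))"
    by (simp add: real_le_rsqrt real_sqrt_mult[symmetric])
  moreover have "cinner (F x) y = cinner x (F y) + (- 2 * \<i>) * \<Gamma> x y" by (simp add: \<Gamma>_def algebra_simps)
  then have "norm (cinner (F x) y) \<le> norm (cinner x (F y)) + 2 * norm (\<Gamma> x y)"
    by (metis (no_types, opaque_lifting) norm_triangle_ineq norm_mult norm_minus_cancel norm_ii mult.right_neutral
        norm_numeral mult_minus_left)
  moreover have "norm (cinner x (F y)) \<le> norm x * norm (F y)" by (rule norm_cinner_le)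
  ultimately show ?thesis by linarith
qed

end

context linear_pencil
begin

text \<open>
  The chain, as a polynomial of degree \<open>p\<close>, is \<open>s^(p + 1)\<close> times a pole part whose image under the pencil is a polynomial.
\<close>

lemma chain_image_small:
  assumes "chain (pencil A n) c p w"
  obtains K where "K \<ge> 0" "\<And>s::real. 0 < s \<Longrightarrow> s \<le> 1 \<Longrightarrow>
    norm (pencil A n (c + of_real s) (vpoly (Suc p) w (of_real s))) \<le> K * s ^ Suc p"
proof -
  obtain K where K: "K \<ge> 0" "\<And>z. norm z \<le> norm c + 1 \<Longrightarrow> norm (numer A n (geo c (rev_chain w p)) z) \<le> K"
    unfolding numer_vpoly using vpoly_bounded by metis
  show ?thesis
  proof (rule that[OF K(1)])
    fix s :: real assume s: "0 < s" "s \<le> 1"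
    let ?s = "of_real s :: complex"
    have "vpoly (Suc p) w ?s = (\<Sum>m<Suc p. ?s ^ (Suc p - Suc m) *\<^sub>C w (Suc p - Suc m))"
      unfolding vpoly_def by (rule sum.nat_diff_reindex[symmetric])
    also have "\<dots> = (\<Sum>m<Suc p. ?s ^ Suc p *\<^sub>C ((1 / (c + ?s - c) ^ Suc m) *\<^sub>C rev_chain w p m))"
    proof (intro sum.cong refl)
      fix m assume m: "m \<in> {..<Suc p}"
      then have "?s ^ Suc p = ?s ^ (Suc p - Suc m) * ?s ^ Suc m" by (simp only: power_add[symmetric]) auto
      then have "?s ^ Suc p * (1 / ?s ^ Suc m) = ?s ^ (Suc p - Suc m)" using s by (simp del: power_Suc)
      then show "?s ^ (Suc p - Suc m) *\<^sub>C w (Suc p - Suc m) = ?s ^ Suc p *\<^sub>C ((1 / (c + ?s - c) ^ Suc m) *\<^sub>C rev_chain w p m)"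
        using m by (simp add: scaleC_scaleC rev_chain_def del: power_Suc)
    qed
    also have "\<dots> = ?s ^ Suc p *\<^sub>C pole_part c (Suc p) (rev_chain w p) (c + ?s)"
      by (simp only: pole_part_def complex_vector.scale_sum_right)
    finally have "pencil A n (c + ?s) (vpoly (Suc p) w ?s) =
        ?s ^ Suc p *\<^sub>C pencil A n (c + ?s) (pole_part c (Suc p) (rev_chain w p) (c + ?s))"
      by (simp only: clinear_rules[OF pencil_clinear])
    also have "pencil A n (c + ?s) (pole_part c (Suc p) (rev_chain w p) (c + ?s)) = numer A n (geo c (rev_chain w p)) (c + ?s)"
      using s by (intro pencil_pole_part chain_root_seq[OF assms]) (auto simp: rev_chain_def)
    finally have "norm (pencil A n (c + ?s) (vpoly (Suc p) w ?s)) = s ^ Suc p * norm (numer A n (geo c (rev_chain w p)) (c + ?s))"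
      using s by (simp add: norm_mult norm_power del: power_Suc)
    also have "\<dots> \<le> s ^ Suc p * K"
      using s norm_triangle_ineq[of c ?s] by (intro mult_left_mono K(2)) auto
    finally show "norm (pencil A n (c + ?s) (vpoly (Suc p) w ?s)) \<le> K * s ^ Suc p" by (simp add: mult.commute)
  qed
qed

end

context dissipative_pencil
begin

text \<open>
  Along a chain of length \<open>p + 1\<close> the pencil is symmetric up to terms of half the order. With
  \<open>\<lambda> = c + \<tau>\<^sup>2\<close> all exponents become integers.
\<close>

lemma pairing_with_chain_small:
  fixes c :: real
  assumes chain: "chain (pencil A n) (of_real c) p w"
  obtains K where "K \<ge> 0" "\<And>\<tau>::real. \<And>x. 0 < \<tau> \<Longrightarrow> \<tau> \<le> 1 \<Longrightarrow>
    norm (cinner (pencil A n (of_real (c + \<tau>\<^sup>2)) x) (vpoly (Suc p) w (of_real (\<tau>\<^sup>2)))) \<le> K * norm x * \<tau> ^ p"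
proof -
  obtain K1 where K1: "K1 \<ge> 0" "\<And>s::real. 0 < s \<Longrightarrow> s \<le> 1 \<Longrightarrow>
    norm (pencil A n (of_real c + of_real s) (vpoly (Suc p) w (of_real s))) \<le> K1 * s ^ Suc p"
    using chain_image_small[OF chain] by blast
  obtain K2 where K2: "K2 \<ge> 0" "\<And>z. norm z \<le> 1 \<Longrightarrow> norm (vpoly (Suc p) w z) \<le> K2"
    using vpoly_bounded by metis
  obtain K3 where K3: "K3 \<ge> 0" "\<And>z x. norm z \<le> \<bar>c\<bar> + 1 \<Longrightarrow> norm (pencil A n z x) \<le> K3 * norm x"
    using pencil_bounded by metis
  show ?thesis
  proof (rule that[of "K1 + 2 * sqrt K3 * sqrt (K2 * K1)"])
    fix \<tau> :: real and x assume \<tau>: "0 < \<tau>" "\<tau> \<le> 1"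
    let ?F = "pencil A n (of_real (c + \<tau>\<^sup>2))"
    let ?w = "vpoly (Suc p) w (of_real (\<tau>\<^sup>2))"
    have s: "0 < \<tau>\<^sup>2" "\<tau>\<^sup>2 \<le> 1" using \<tau> by (auto simp: power_le_one)
    have Fw: "norm (?F ?w) \<le> K1 * (\<tau>\<^sup>2) ^ Suc p" using K1(2)[OF s] by simp
    have e: "(\<tau>\<^sup>2) ^ Suc p = (\<tau> ^ Suc p)\<^sup>2" by (simp only: power_mult[symmetric] mult.commute)
    have le1: "(\<tau>\<^sup>2) ^ Suc p \<le> \<tau> ^ p" unfolding power_mult[symmetric] using \<tau> by (intro power_decreasing) auto
    have le2: "\<tau> ^ Suc p \<le> \<tau> ^ p" using \<tau> by (intro power_decreasing) auto
    have nw: "norm ?w \<le> K2" using s by (intro K2(2)) (simp add: norm_power)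
    have nF: "norm (?F x) \<le> K3 * norm x"
    proof (rule K3(2))
      have "norm (of_real (c + \<tau>\<^sup>2) :: complex) = \<bar>c + \<tau>\<^sup>2\<bar>" by (rule norm_of_real)
      also have "\<dots> \<le> \<bar>c\<bar> + 1" using s by linarith
      finally show "norm (of_real (c + \<tau>\<^sup>2) :: complex) \<le> \<bar>c\<bar> + 1" .
    qed
    have e1: "norm x * norm (?F ?w) \<le> norm x * (K1 * \<tau> ^ p)"
      using le1 K1(1) by (intro mult_left_mono order_trans[OF Fw]) auto
    have e2: "sqrt (norm x * norm (?F x)) \<le> sqrt K3 * norm x"
    proof -
      have "sqrt (norm x * norm (?F x)) \<le> sqrt (norm x * (K3 * norm x))"
        using nF by (intro real_sqrt_le_mono mult_left_mono) auto
      also have "\<dots> = sqrt K3 * norm x" by (simp add: real_sqrt_mult)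
      finally show ?thesis .
    qed
    have e3: "sqrt (norm ?w * norm (?F ?w)) \<le> sqrt (K2 * K1) * \<tau> ^ p"
    proof -
      have "sqrt (norm ?w * norm (?F ?w)) \<le> sqrt (K2 * (K1 * (\<tau> ^ Suc p)\<^sup>2))"
        using nw Fw K2(1) unfolding e by (intro real_sqrt_le_mono mult_mono) auto
      also have "\<dots> = sqrt (K2 * K1) * \<tau> ^ Suc p" using \<tau> by (simp add: real_sqrt_mult)
      also have "\<dots> \<le> sqrt (K2 * K1) * \<tau> ^ p" using le2 K1(1) K2(1) by (intro mult_left_mono) auto
      finally show ?thesis .
    qed
    have "sqrt (norm x * norm (?F x)) * sqrt (norm ?w * norm (?F ?w)) \<le> (sqrt K3 * norm x) * (sqrt (K2 * K1) * \<tau> ^ p)"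
      using K3(1) by (intro mult_mono e2 e3) auto
    moreover have "norm (cinner (?F x) ?w) \<le> norm x * norm (?F ?w) + 2 * sqrt (norm x * norm (?F x)) * sqrt (norm ?w * norm (?F ?w))"
      by (rule pairing_bound)
    ultimately have "norm (cinner (?F x) ?w) \<le> norm x * (K1 * \<tau> ^ p) + 2 * ((sqrt K3 * norm x) * (sqrt (K2 * K1) * \<tau> ^ p))"
      using e1 by linarith
    then show "norm (cinner (?F x) ?w) \<le> (K1 + 2 * sqrt K3 * sqrt (K2 * K1)) * norm x * \<tau> ^ p"
      by (simp only: distrib_left distrib_right mult_ac)
  qed (use K1 K2 K3 in simp)
qed

text \<open>
  Up to a regular function the pole part is \<open>s^(-h-1)\<close> times the whole chain \<open>w1\<close>. If \<open>p1\<close> is at least \<open>p\<close>, the image of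
  \<open>w1\<close> is small enough by itself; otherwise the pencil is moved to the other chain, and the
  error is the geometric mean of two small quantities. Both cases use \<open>2 h \<le> p1\<close>.
\<close>

lemma pairing_half_chain_small:
  fixes c :: real
  assumes chain1: "chain (pencil A n) (of_real c) p1 w1" and chain2: "chain (pencil A n) (of_real c) p w"
    and h: "2 * h \<le> p1" and M: "h < M"
  obtains K where "K \<ge> 0" "\<And>\<tau>::real. 0 < \<tau> \<Longrightarrow> \<tau> \<le> 1 \<Longrightarrow>
    norm (cinner (pencil A n (of_real (c + \<tau>\<^sup>2)) (pole_part (of_real c) M (rev_chain w1 h) (of_real (c + \<tau>\<^sup>2))))
      (vpoly (Suc p) w (of_real (\<tau>\<^sup>2)))) \<le> K * \<tau> ^ p"
proof -
  obtain K1 where K1: "K1 \<ge> 0" "\<And>s::real. 0 < s \<Longrightarrow> s \<le> 1 \<Longrightarrow>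
    norm (pencil A n (of_real c + of_real s) (vpoly (Suc p1) w1 (of_real s))) \<le> K1 * s ^ Suc p1"
    using chain_image_small[OF chain1] by blast
  obtain K2 where K2: "K2 \<ge> 0" "\<And>s::real. 0 < s \<Longrightarrow> s \<le> 1 \<Longrightarrow>
    norm (pencil A n (of_real c + of_real s) (vpoly (Suc p) w (of_real s))) \<le> K2 * s ^ Suc p"
    using chain_image_small[OF chain2] by blast
  obtain L1 where L1: "L1 \<ge> 0" "\<And>z. norm z \<le> 1 \<Longrightarrow> norm (vpoly (Suc p1) w1 z) \<le> L1"
    using vpoly_bounded by metis
  obtain L2 where L2: "L2 \<ge> 0" "\<And>z. norm z \<le> 1 \<Longrightarrow> norm (vpoly (Suc p) w z) \<le> L2"
    using vpoly_bounded by metis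
  obtain L3 where L3: "L3 \<ge> 0" "\<And>z. norm z \<le> 1 \<Longrightarrow> norm (vpoly (p1 - h) (\<lambda>r. w1 (r + Suc h)) z) \<le> L3"
    using vpoly_bounded by metis
  obtain K3 where K3: "K3 \<ge> 0" "\<And>\<tau>::real. \<And>x. 0 < \<tau> \<Longrightarrow> \<tau> \<le> 1 \<Longrightarrow>
    norm (cinner (pencil A n (of_real (c + \<tau>\<^sup>2)) x) (vpoly (Suc p) w (of_real (\<tau>\<^sup>2)))) \<le> K3 * norm x * \<tau> ^ p"
    using pairing_with_chain_small[OF chain2] by blast
  define C where "C = K1 * L2 + (L1 * K2 + 2 * sqrt (L1 * K1) * sqrt (L2 * K2))"
  have C: "0 \<le> C" using K1 K2 L1 L2 by (simp add: C_def)
  show ?thesis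
  proof (rule that[of "C + K3 * L3"])
    fix \<tau> :: real assume \<tau>: "0 < \<tau>" "\<tau> \<le> 1"
    let ?F = "pencil A n (of_real (c + \<tau>\<^sup>2))"
    let ?s = "of_real (\<tau>\<^sup>2) :: complex"
    let ?w1 = "vpoly (Suc p1) w1 ?s"
    let ?w = "vpoly (Suc p) w ?s"
    let ?x = "vpoly (p1 - h) (\<lambda>r. w1 (r + Suc h)) ?s"
    have s: "0 < \<tau>\<^sup>2" "\<tau>\<^sup>2 \<le> 1" using \<tau> by (auto simp: power_le_one)
    have s0: "?s \<noteq> 0" using \<tau> by simp
    have ns: "norm ?s \<le> 1" using s by (simp add: norm_power)
    have e: "(\<tau>\<^sup>2) ^ Suc i = (\<tau> ^ Suc i)\<^sup>2" for i by (simp only: power_mult[symmetric] mult.commute)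
    have Fw1: "norm (?F ?w1) \<le> K1 * (\<tau> ^ Suc p1)\<^sup>2" using K1(2)[OF s] by (simp add: e[symmetric] del: power_Suc)
    have Fw: "norm (?F ?w) \<le> K2 * (\<tau> ^ Suc p)\<^sup>2" using K2(2)[OF s] by (simp add: e[symmetric] del: power_Suc)
    have nw1: "norm ?w1 \<le> L1" and nw: "norm ?w \<le> L2" and nx: "norm ?x \<le> L3"
      using L1(2)[OF ns] L2(2)[OF ns] L3(2)[OF ns] by auto
    have dec: "\<tau> ^ i \<le> \<tau> ^ (p + 2 * h + 2)" if "p + 2 * h + 2 \<le> i" for i
      using \<tau> that by (intro power_decreasing) auto
    have main: "norm (cinner (?F ?w1) ?w) \<le> C * \<tau> ^ (p + 2 * h + 2)"
    proof (cases "p \<le> p1")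
      case True
      have "norm (cinner (?F ?w1) ?w) \<le> norm (?F ?w1) * norm ?w" by (rule norm_cinner_le)
      also have "\<dots> \<le> (K1 * (\<tau> ^ Suc p1)\<^sup>2) * L2" using Fw1 nw K1(1) by (intro mult_mono) auto
      also have "\<dots> = K1 * L2 * \<tau> ^ (2 * Suc p1)" by (simp only: power_mult[symmetric] mult_ac)
      also have "\<dots> \<le> K1 * L2 * \<tau> ^ (p + 2 * h + 2)"
        using True h K1(1) L2(1) by (intro mult_left_mono dec) auto
      also have "\<dots> \<le> C * \<tau> ^ (p + 2 * h + 2)"
        using \<tau> K1(1) K2(1) L1(1) L2(1) by (intro mult_right_mono) (auto simp: C_def)
      finally show ?thesis .
    next
      case False
      have "norm ?w1 * norm (?F ?w) \<le> L1 * (K2 * (\<tau> ^ Suc p)\<^sup>2)"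
        using nw1 Fw L1(1) by (intro mult_mono) auto
      also have "\<dots> = L1 * K2 * \<tau> ^ (2 * Suc p)" by (simp only: power_mult[symmetric] mult_ac)
      also have "\<dots> \<le> L1 * K2 * \<tau> ^ (p + 2 * h + 2)"
        using False h L1(1) K2(1) by (intro mult_left_mono dec) auto
      finally have e1: "norm ?w1 * norm (?F ?w) \<le> L1 * K2 * \<tau> ^ (p + 2 * h + 2)" .
      have "sqrt (norm ?w1 * norm (?F ?w1)) * sqrt (norm ?w * norm (?F ?w)) \<le>
          sqrt (L1 * (K1 * (\<tau> ^ Suc p1)\<^sup>2)) * sqrt (L2 * (K2 * (\<tau> ^ Suc p)\<^sup>2))"
        using nw1 Fw1 nw Fw L1(1) L2(1) K1(1) K2(1)
        by (intro mult_mono real_sqrt_le_mono) auto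
      also have "\<dots> = sqrt (L1 * K1) * sqrt (L2 * K2) * \<tau> ^ (Suc p1 + Suc p)"
        using \<tau> by (simp add: real_sqrt_mult power_add)
      also have "\<dots> \<le> sqrt (L1 * K1) * sqrt (L2 * K2) * \<tau> ^ (p + 2 * h + 2)"
        using h L1(1) L2(1) K1(1) K2(1) by (intro mult_left_mono dec) auto
      finally have "norm (cinner (?F ?w1) ?w) \<le> L1 * K2 * \<tau> ^ (p + 2 * h + 2) +
          2 * (sqrt (L1 * K1) * sqrt (L2 * K2) * \<tau> ^ (p + 2 * h + 2))"
        using e1 pairing_bound[of "c + \<tau>\<^sup>2" ?w1 ?w] by linarith
      also have "\<dots> = (L1 * K2 + 2 * sqrt (L1 * K1) * sqrt (L2 * K2)) * \<tau> ^ (p + 2 * h + 2)"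
        by (simp only: distrib_left distrib_right mult_ac)
      also have "\<dots> \<le> C * \<tau> ^ (p + 2 * h + 2)"
        using \<tau> K1(1) L2(1) by (intro mult_right_mono) (auto simp: C_def)
      finally show ?thesis .
    qed
    have split: "pole_part (of_real c) M (rev_chain w1 h) (of_real (c + \<tau>\<^sup>2)) = (1 / ?s ^ Suc h) *\<^sub>C ?w1 - ?x"
    proof -
      have "pole_part (of_real c) M (rev_chain w1 h) (of_real (c + \<tau>\<^sup>2)) = (\<Sum>m<M. (1 / ?s ^ Suc m) *\<^sub>C rev_chain w1 h m)"
        by (simp add: pole_part_def)
      also have "\<dots> = (\<Sum>m<Suc h. (1 / ?s ^ Suc m) *\<^sub>C w1 (h - m))"
        using M by (intro sum.mono_neutral_cong_right) (auto simp: rev_chain_def)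
      also have "\<dots> = (\<Sum>r<Suc h. (1 / ?s ^ Suc (Suc h - Suc r)) *\<^sub>C w1 (h - (Suc h - Suc r)))"
        by (rule sum.nat_diff_reindex[symmetric])
      also have "\<dots> = (\<Sum>r<Suc h. ((1 / ?s ^ Suc h) * ?s ^ r) *\<^sub>C w1 r)"
      proof (intro sum.cong refl)
        fix r assume r: "r \<in> {..<Suc h}"
        then have "?s ^ Suc h = ?s ^ Suc (Suc h - Suc r) * ?s ^ r" by (simp only: power_add[symmetric]) auto
        then have "1 / ?s ^ Suc (Suc h - Suc r) = (1 / ?s ^ Suc h) * ?s ^ r" using s0 by (simp del: power_Suc)
        then show "(1 / ?s ^ Suc (Suc h - Suc r)) *\<^sub>C w1 (h - (Suc h - Suc r)) = ((1 / ?s ^ Suc h) * ?s ^ r) *\<^sub>C w1 r"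
          using r by simp
      qed
      finally have 1: "pole_part (of_real c) M (rev_chain w1 h) (of_real (c + \<tau>\<^sup>2)) = (\<Sum>r<Suc h. ((1 / ?s ^ Suc h) * ?s ^ r) *\<^sub>C w1 r)" .
      have set: "{..<Suc p1} = {..<Suc h} \<union> {Suc h..<Suc p1}" using h by auto
      have "?w1 = (\<Sum>r<Suc h. ?s ^ r *\<^sub>C w1 r) + (\<Sum>r\<in>{Suc h..<Suc p1}. ?s ^ r *\<^sub>C w1 r)"
        unfolding vpoly_def set by (rule sum.union_disjoint) auto
      also have "(\<Sum>r\<in>{Suc h..<Suc p1}. ?s ^ r *\<^sub>C w1 r) = ?s ^ Suc h *\<^sub>C ?x"
      proof -
        have "(\<Sum>r\<in>{Suc h..<Suc p1}. ?s ^ r *\<^sub>C w1 r) = (\<Sum>r<p1 - h. ?s ^ (r + Suc h) *\<^sub>C w1 (r + Suc h))"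
          using h by (intro sum.reindex_bij_witness[where i = "\<lambda>r. r + Suc h" and j = "\<lambda>r. r - Suc h"]) auto
        then show ?thesis
          by (simp add: vpoly_def complex_vector.scale_sum_right scaleC_scaleC power_add mult_ac)
      qed
      finally have "(1 / ?s ^ Suc h) *\<^sub>C ?w1 = (\<Sum>r<Suc h. ((1 / ?s ^ Suc h) * ?s ^ r) *\<^sub>C w1 r) + ?x"
        using s0 by (simp add: scaleC_add_right complex_vector.scale_sum_right scaleC_scaleC del: power_Suc sum.lessThan_Suc)
      then show ?thesis unfolding 1 by simp
    qed
    have "cinner (?F (pole_part (of_real c) M (rev_chain w1 h) (of_real (c + \<tau>\<^sup>2)))) ?w =
        (1 / ?s ^ Suc h) * cinner (?F ?w1) ?w - cinner (?F ?x) ?w"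
      unfolding split by (simp only: clinear_rules[OF pencil_clinear] cinner_diff_left cinner_scaleC_left)
    also have "norm \<dots> \<le> (1 / (\<tau>\<^sup>2) ^ Suc h) * norm (cinner (?F ?w1) ?w) + norm (cinner (?F ?x) ?w)"
      using s by (intro order_trans[OF norm_triangle_ineq4]) (simp add: norm_mult norm_divide norm_power del: power_Suc)
    finally have total: "norm (cinner (?F (pole_part (of_real c) M (rev_chain w1 h) (of_real (c + \<tau>\<^sup>2)))) ?w) \<le>
        (1 / (\<tau>\<^sup>2) ^ Suc h) * norm (cinner (?F ?w1) ?w) + norm (cinner (?F ?x) ?w)" .
    have "(1 / (\<tau>\<^sup>2) ^ Suc h) * norm (cinner (?F ?w1) ?w) \<le> (1 / (\<tau>\<^sup>2) ^ Suc h) * (C * \<tau> ^ (p + 2 * h + 2))"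
      using \<tau> by (intro mult_left_mono main) auto
    also have "\<dots> = C * \<tau> ^ p"
    proof -
      have "\<tau> ^ (p + 2 * h + 2) = \<tau> ^ p * (\<tau>\<^sup>2) ^ Suc h"
        unfolding power_mult[symmetric] power_add[symmetric] by (intro arg_cong[where f = "power \<tau>"]) simp
      then show ?thesis using \<tau> by (simp del: power_Suc)
    qed
    finally have m: "(1 / (\<tau>\<^sup>2) ^ Suc h) * norm (cinner (?F ?w1) ?w) \<le> C * \<tau> ^ p" .
    have "norm (cinner (?F ?x) ?w) \<le> K3 * L3 * \<tau> ^ p"
      using nx K3(1) \<tau> by (intro order_trans[OF K3(2)[OF \<tau>]] mult_right_mono mult_left_mono) auto
    then show "norm (cinner (?F (pole_part (of_real c) M (rev_chain w1 h) (of_real (c + \<tau>\<^sup>2)))) ?w) \<le> (C + K3 * L3) * \<tau> ^ p"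
      using total m by (simp only: distrib_right)
  qed (use C K3 L3 in simp)
qed

text \<open>
  If only first halves and middle vectors of chains occur in the pole of \<open>U\<close>, the numerator \<open>A U\<close> is orthogonal to
  the first halves of all chains: the two preceding estimates make its pairing with \<open>w k\<close> vanish to the order \<open>p k / 2\<close>.
\<close>

lemma conv_first_half_eq_0:
  fixes c :: real
  assumes chains: "\<And>k. k \<in> {1..N} \<Longrightarrow> chain (pencil A n) (of_real c) (p k) (w k)"
    and half: "\<And>k h. k \<in> {1..N} \<Longrightarrow> h \<le> p k \<Longrightarrow> a k h \<noteq> 0 \<Longrightarrow> 2 * h \<le> p k"
    and M: "\<And>k. k \<in> {1..N} \<Longrightarrow> p k < M"
    and \<delta>: "\<delta> > 0" and q: "\<And>j. j \<ge> D \<Longrightarrow> q j = 0"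
    and U: "\<And>t. 0 < t \<Longrightarrow> t < \<delta> \<Longrightarrow> pencil A n (of_real c + of_real t)
      (pole_part (of_real c) M (chain_comb N p w a) (of_real c + of_real t) + B t) = vpoly D q (of_real t)"
    and B: "\<And>t. 0 < t \<Longrightarrow> t < \<delta> \<Longrightarrow> norm (B t) \<le> K"
    and k: "k \<in> {1..N}" and g: "2 * g < p k"
  shows "conv q (w k) g = 0"
proof -
  let ?F = "\<lambda>\<tau>. pencil A n (of_real (c + \<tau>\<^sup>2))"
  let ?w = "\<lambda>\<tau>. vpoly (Suc (p k)) (w k) (of_real (\<tau>\<^sup>2))"
  let ?\<omega> = "\<lambda>k h \<tau>. pole_part (of_real c) M (rev_chain (w k) h) (of_real (c + \<tau>\<^sup>2))"
  obtain K1 where K1: "K1 \<ge> 0" "\<And>\<tau>::real. \<And>x. 0 < \<tau> \<Longrightarrow> \<tau> \<le> 1 \<Longrightarrow> norm (cinner (?F \<tau> x) (?w \<tau>)) \<le> K1 * norm x * \<tau> ^ p k"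
    using pairing_with_chain_small[OF chains[OF k]] by blast
  have "\<exists>L\<ge>0. \<forall>\<tau>. 0 < \<tau> \<longrightarrow> \<tau> \<le> 1 \<longrightarrow> norm (a i h) * norm (cinner (?F \<tau> (?\<omega> i h \<tau>)) (?w \<tau>)) \<le> L * \<tau> ^ p k"
    if i: "i \<in> {1..N}" "h \<le> p i" for i h
  proof (cases "a i h = 0")
    case False
    obtain L where L: "L \<ge> 0" "\<And>\<tau>::real. 0 < \<tau> \<Longrightarrow> \<tau> \<le> 1 \<Longrightarrow> norm (cinner (?F \<tau> (?\<omega> i h \<tau>)) (?w \<tau>)) \<le> L * \<tau> ^ p k"
      using pairing_half_chain_small[OF chains[OF i(1)] chains[OF k] half[OF i False], of M] M[OF i(1)] i(2)
      by (metis le_less_trans)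
    then show ?thesis by (intro exI[of _ "norm (a i h) * L"]) (auto simp: mult.assoc intro!: mult_left_mono)
  qed auto
  then obtain L where L: "\<And>i h \<tau>. i \<in> {1..N} \<Longrightarrow> h \<le> p i \<Longrightarrow> 0 < \<tau> \<Longrightarrow> \<tau> \<le> 1 \<Longrightarrow>
      norm (a i h) * norm (cinner (?F \<tau> (?\<omega> i h \<tau>)) (?w \<tau>)) \<le> L i h * \<tau> ^ p k"
    by metis
  define Q where "Q = (\<Sum>i=1..N. \<Sum>h\<le>p i. L i h) + K1 * K"
  have small: "norm (cinner (vpoly D q (of_real (\<tau>\<^sup>2))) (?w \<tau>)) \<le> Q * \<tau> ^ p k" if \<tau>: "0 < \<tau>" "\<tau> < min \<delta> 1" for \<tau> :: real
  proof -
    have "\<tau>\<^sup>2 \<le> \<tau>" using \<tau> by (simp add: power2_eq_square mult_left_le)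
    then have t: "0 < \<tau>\<^sup>2" "\<tau>\<^sup>2 < \<delta>" using \<tau> by auto
    have comb: "pole_part (of_real c) M (chain_comb N p w a) z =
        (\<Sum>i=1..N. \<Sum>h\<le>p i. a i h *\<^sub>C pole_part (of_real c) M (rev_chain (w i) h) z)" for z
      unfolding chain_comb_def[abs_def] pole_part_sum pole_part_scaleC ..
    have "vpoly D q (of_real (\<tau>\<^sup>2)) = ?F \<tau> ((\<Sum>i=1..N. \<Sum>h\<le>p i. a i h *\<^sub>C ?\<omega> i h \<tau>) + B (\<tau>\<^sup>2))"
      using U[OF t] unfolding comb by simp
    then have eq: "cinner (vpoly D q (of_real (\<tau>\<^sup>2))) (?w \<tau>) =
        (\<Sum>i=1..N. \<Sum>h\<le>p i. a i h * cinner (?F \<tau> (?\<omega> i h \<tau>)) (?w \<tau>)) + cinner (?F \<tau> (B (\<tau>\<^sup>2))) (?w \<tau>)"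
      by (simp only: clinear_rules[OF pencil_clinear] cinner_add_left cinner_sum_left cinner_scaleC_left)
    have "norm (cinner (vpoly D q (of_real (\<tau>\<^sup>2))) (?w \<tau>)) \<le> (\<Sum>i=1..N. \<Sum>h\<le>p i. L i h * \<tau> ^ p k) + K1 * K * \<tau> ^ p k"
      unfolding eq
    proof (rule order_trans[OF norm_triangle_ineq add_mono])
      show "norm (\<Sum>i=1..N. \<Sum>h\<le>p i. a i h * cinner (?F \<tau> (?\<omega> i h \<tau>)) (?w \<tau>)) \<le> (\<Sum>i=1..N. \<Sum>h\<le>p i. L i h * \<tau> ^ p k)"
        by (intro sum_norm_le) (use L \<tau> in \<open>auto simp: norm_mult\<close>)
      show "norm (cinner (?F \<tau> (B (\<tau>\<^sup>2))) (?w \<tau>)) \<le> K1 * K * \<tau> ^ p k"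
        using K1 B[OF t] \<tau> by (intro order_trans[OF K1(2)] mult_right_mono mult_left_mono) auto
    qed
    also have "\<dots> = Q * \<tau> ^ p k" by (simp only: Q_def distrib_right sum_distrib_right)
    finally show ?thesis .
  qed
  (* The powers of s = \<tau>^2 occur as the even powers of \<tau>. *)
  define E where "E = 2 * (D + Suc (p k))"
  define \<psi> where "\<psi> e = (\<Sum>j<D. \<Sum>r<Suc (p k). if e = 2 * (j + r) then cinner (q j) (w k r) else 0)" for e
  have expand: "(\<Sum>e<E. \<tau> ^ e *\<^sub>R \<psi> e) = cinner (vpoly D q (of_real (\<tau>\<^sup>2))) (?w \<tau>)" for \<tau> :: real
  proof -
    have "(\<Sum>e<E. \<tau> ^ e *\<^sub>R \<psi> e) = (\<Sum>e<E. \<Sum>j<D. \<Sum>r<Suc (p k). if e = 2 * (j + r) then \<tau> ^ e *\<^sub>R cinner (q j) (w k r) else 0)"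
      unfolding \<psi>_def scaleR_sum_right by (intro sum.cong refl) auto
    also have "\<dots> = (\<Sum>j<D. \<Sum>r<Suc (p k). \<Sum>e<E. if e = 2 * (j + r) then \<tau> ^ e *\<^sub>R cinner (q j) (w k r) else 0)"
      by (subst sum.swap) (intro sum.cong refl sum.swap)
    also have "\<dots> = (\<Sum>j<D. \<Sum>r<Suc (p k). \<tau> ^ (2 * (j + r)) *\<^sub>R cinner (q j) (w k r))"
      by (intro sum.cong refl) (auto simp: E_def)
    also have "\<dots> = cinner (vpoly D q (of_real (\<tau>\<^sup>2))) (?w \<tau>)"
      unfolding vpoly_def cinner_sum_left cinner_sum_right
      by (subst sum.swap, intro sum.cong refl) (simp add: cinner_scaleC_left cinner_scaleC_right power_mult power_add
          scaleR_conv_of_real del: sum.lessThan_Suc)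
    finally show ?thesis .
  qed
  have "\<psi> (2 * g) = 0"
  proof (cases "2 * g < E")
    case True
    show ?thesis
      by (rule coefficients_eq_0_if_small[where \<delta> = "min \<delta> 1" and D = E and K = Q and p = "p k"]) (use \<delta> small expand True g in auto)
  next
    case False
    then show ?thesis unfolding \<psi>_def by (intro sum.neutral ballI) (auto simp: E_def)
  qed
  moreover have "\<psi> (2 * g) = conv q (w k) g"
  proof -
    have "\<psi> (2 * g) = (\<Sum>j<D. if j \<le> g then cinner (q j) (w k (g - j)) else 0)"
      unfolding \<psi>_def
    proof (intro sum.cong refl)
      fix j
      show "(\<Sum>r<Suc (p k). if 2 * g = 2 * (j + r) then cinner (q j) (w k r) else 0) =
          (if j \<le> g then cinner (q j) (w k (g - j)) else 0)"
      proof (cases "j \<le> g")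
        case True
        have "(\<Sum>r<Suc (p k). if 2 * g = 2 * (j + r) then cinner (q j) (w k r) else 0) =
            (\<Sum>r<Suc (p k). if r = g - j then cinner (q j) (w k (g - j)) else 0)"
          using True by (intro sum.cong refl) auto
        then show ?thesis using True g by (simp del: sum.lessThan_Suc)
      next
        case False
        then show ?thesis by (auto intro!: sum.neutral)
      qed
    qed
    also have "\<dots> = (\<Sum>j\<in>{..<D} \<union> {..g}. if j \<le> g then cinner (q j) (w k (g - j)) else 0)"
      using q by (intro sum.mono_neutral_left) auto
    also have "\<dots> = conv q (w k) g"
      unfolding conv_def by (intro sum.mono_neutral_cong_right) auto
    finally show ?thesis .
  qed
  ultimately show ?thesis by simp
qed

end


section \<open>Uniqueness: half of the initial data determine the numerator\<close>

locale radiation_pencil = dissipative_pencil +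
  fixes l :: nat
    and N :: "real \<Rightarrow> nat"
    and p :: "real \<Rightarrow> nat \<Rightarrow> nat"
    and w :: "real \<Rightarrow> nat \<Rightarrow> nat \<Rightarrow> 'a"
    and \<epsilon> :: "real \<Rightarrow> nat \<Rightarrow> int"
  assumes n_even: "n = 2 * l"
    and definite_point: "\<exists>b::real. \<forall>x. cinner (pencil A n (of_real b) x) x = 0 \<longrightarrow> x = 0"
    and system: "\<And>c. eigenvalue (pencil A n) (of_real c) \<Longrightarrow>
      chain_system (pencil A n) (of_real c) (N c) (p c) (w c)"
    and signs: "\<And>c. eigenvalue (pencil A n) (of_real c) \<Longrightarrow>
      sign_characteristics (pencil A n) n c (N c) (p c) (w c) (\<epsilon> c)"
begin

lemma chains: "eigenvalue (pencil A n) (of_real c) \<Longrightarrow> k \<in> {1..N c} \<Longrightarrow> chain (pencil A n) (of_real c) (p c k) (w c k)"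
  using system by (auto simp: chain_system_def)

lemma sign_cases:
  assumes "eigenvalue (pencil A n) (of_real c)" "k \<in> {1..N c}"
  shows "(even (p c k) \<and> (\<epsilon> c k = 1 \<or> \<epsilon> c k = -1)) \<or> (odd (p c k) \<and> \<epsilon> c k = 0)"
  using signs[OF assms(1)] assms(2) unfolding sign_characteristics_def by (metis insertE singletonD)

text \<open>
  The sum with shift \<open>g\<close> is the coefficient of the pole of order \<open>g + 1\<close> at \<open>c\<close> in \<open>f\<close>. Orthogonality to first
  halves leaves only the middle vectors of chains of odd length; there \<open>coeff\<close> and \<open>middle\<close> turn the pairing with the chain
  into \<open>\<epsilon>\<close> times the coefficient, and only chains with \<open>\<epsilon> = \<sigma>\<close> contribute.
\<close>

lemma residue_at_real_eigenvalue:
  fixes c :: real and \<sigma> :: int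
  assumes eig: "eigenvalue (pencil A n) (of_real c)"
    and \<sigma>: "\<sigma> = 1 \<or> \<sigma> = -1"
    and allowed: "\<And>k h. k \<in> {1..N c} \<Longrightarrow> h \<le> p c k \<Longrightarrow> a k h \<noteq> 0 \<Longrightarrow> int h \<le> (int (p c k) + \<sigma> * \<epsilon> c k) div 2"
    and M: "\<And>k. k \<in> {1..N c} \<Longrightarrow> p c k < M"
    and \<delta>: "\<delta> > 0"
    and U: "\<And>t. 0 < t \<Longrightarrow> t < \<delta> \<Longrightarrow> pencil A n (of_real c + of_real t)
      (pole_part (of_real c) M (chain_comb (N c) (p c) (w c) a) (of_real c + of_real t) + B t) = vpoly n b (of_real c + of_real t)"
    and B: "\<And>t. 0 < t \<Longrightarrow> t < \<delta> \<Longrightarrow> norm (B t) \<le> K"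
  obtains r where "r \<ge> 0"
    "(\<Sum>j<n. cinner (recenter (of_real c) n b j) (chain_comb (N c) (p c) (w c) a j)) = of_real (of_int \<sigma> * r)"
    "\<And>g. g \<ge> 1 \<Longrightarrow> (\<Sum>j<n. cinner (recenter (of_real c) n b j) (chain_comb (N c) (p c) (w c) a (g + j))) = 0"
proof -
  define q where "q = recenter (of_real c) n b"
  define \<xi> where "\<xi> = chain_comb (N c) (p c) (w c) a"
  have q0: "q j = 0" if "j \<ge> n" for j using recenter_high[OF that] by (simp add: q_def)
  have U': "pencil A n (of_real c + of_real t) (pole_part (of_real c) M \<xi> (of_real c + of_real t) + B t) = vpoly n q (of_real t)"
    if "0 < t" "t < \<delta>" for t
    using U[OF that] vpoly_recenter[of n b "of_real c + of_real t" "of_real c"] by (simp add: \<xi>_def q_def)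
  have half: "2 * h \<le> p c k" if "k \<in> {1..N c}" "h \<le> p c k" "a k h \<noteq> 0" for k h
    using allowed[OF that] sign_cases[OF eig that(1)] \<sigma> by (auto elim!: evenE oddE)
  have first: "conv q (w c k) g = 0" if "k \<in> {1..N c}" "2 * g < p c k" for k g
  proof (rule conv_first_half_eq_0[where c = c and N = "N c" and p = "p c" and a = a and M = M and \<delta> = \<delta> and D = n and B = B and K = K])
    show "2 * h \<le> p c k" if "k \<in> {1..N c}" "h \<le> p c k" "a k h \<noteq> 0" for k h by (rule half[OF that])
  qed (use chains[OF eig] M \<delta> q0 U'[unfolded \<xi>_def] B that in auto)
  obtain z where acs: "adjoint_canonical_system (pencil A n) (of_real c) (N c) (p c) (w c) z"
    and sgn: "\<And>k. k \<in> {1..N c} \<Longrightarrow> even (p c k) \<Longrightarrow>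
      \<exists>a. \<forall>i<n. derived_chain (of_real c) (z k) (p c k div 2) i
                - of_int (\<epsilon> c k) *\<^sub>C derived_chain (of_real c) (w c k) (p c k div 2) i
              = (\<Sum>j=1..N c. \<Sum>h | int h \<le> (int (p c j) - 1) div 2.
                   a j h *\<^sub>C derived_chain (of_real c) (w c j) h i)"
    using signs[OF eig] unfolding sign_characteristics_def by meson
  have coeff: "a k h = conv q (z k) (p c k - h)" if "k \<in> {1..N c}" "h \<le> p c k" for k h
  proof -
    have "chain_comb (N c) (p c) (w c) (\<lambda>k h. a k h - conv q (z k) (p c k - h)) m = 0" for m
    proof (cases "m < M")
      case True
      have "\<xi> m = chain_comb (N c) (p c) (w c) (\<lambda>k h. conv q (z k) (p c k - h)) m"
        by (rule principal_part_coefficients[OF acs \<delta> q0 U' B M True])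
      then show ?thesis
        by (simp add: \<xi>_def chain_comb_def complex_vector.scale_left_diff_distrib sum_subtractf)
    next
      case False
      then have "rev_chain (w c k) h m = 0" if "k \<in> {1..N c}" "h \<le> p c k" for k h
        using M[OF that(1)] that(2) by (auto simp: rev_chain_def)
      then show ?thesis by (auto simp: chain_comb_def intro!: sum.neutral)
    qed
    from chain_comb_unique[OF system[OF eig] this that] show ?thesis by simp
  qed
  have middle: "conv q (z k) (p c k div 2) = of_int (\<epsilon> c k) * conv q (w c k) (p c k div 2)"
    if k: "k \<in> {1..N c}" "even (p c k)" for k
  proof -
    obtain d where d: "\<And>i. i < n \<Longrightarrow> derived_chain (of_real c) (z k) (p c k div 2) i
        = of_int (\<epsilon> c k) *\<^sub>C derived_chain (of_real c) (w c k) (p c k div 2) i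
        + (\<Sum>j=1..N c. \<Sum>h | int h \<le> (int (p c j) - 1) div 2. d j h *\<^sub>C derived_chain (of_real c) (w c j) h i)"
    proof -
      obtain d where "\<forall>i<n. derived_chain (of_real c) (z k) (p c k div 2) i
        - of_int (\<epsilon> c k) *\<^sub>C derived_chain (of_real c) (w c k) (p c k div 2) i
        = (\<Sum>j=1..N c. \<Sum>h | int h \<le> (int (p c j) - 1) div 2. d j h *\<^sub>C derived_chain (of_real c) (w c j) h i)"
        using sgn[OF k] by blast
      then show ?thesis by (intro that[of d]) (simp only: diff_eq_eq add.commute)
    qed
    have "conv q (z k) (p c k div 2) = (\<Sum>i<n. cinner (b i) (derived_chain (of_real c) (z k) (p c k div 2) i))"
      unfolding q_def by (rule conv_recenter_derived_chain)
    also have "\<dots> = (\<Sum>i<n. cnj (of_int (\<epsilon> c k)) * cinner (b i) (derived_chain (of_real c) (w c k) (p c k div 2) i) +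
        (\<Sum>j=1..N c. \<Sum>h | int h \<le> (int (p c j) - 1) div 2. cnj (d j h) * cinner (b i) (derived_chain (of_real c) (w c j) h i)))"
      by (intro sum.cong refl) (simp add: d cinner_add_right cinner_scaleC_right cinner_sum_right)
    also have "\<dots> = of_int (\<epsilon> c k) * conv q (w c k) (p c k div 2) +
        (\<Sum>i<n. \<Sum>j=1..N c. \<Sum>h | int h \<le> (int (p c j) - 1) div 2. cnj (d j h) * cinner (b i) (derived_chain (of_real c) (w c j) h i))"
      unfolding q_def conv_recenter_derived_chain sum.distrib by (simp add: sum_distrib_left)
    also have "(\<Sum>i<n. \<Sum>j=1..N c. \<Sum>h | int h \<le> (int (p c j) - 1) div 2. cnj (d j h) * cinner (b i) (derived_chain (of_real c) (w c j) h i))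
        = (\<Sum>j=1..N c. \<Sum>i<n. \<Sum>h | int h \<le> (int (p c j) - 1) div 2. cnj (d j h) * cinner (b i) (derived_chain (of_real c) (w c j) h i))"
      by (rule sum.swap)
    also have "\<dots> = (\<Sum>j=1..N c. \<Sum>h | int h \<le> (int (p c j) - 1) div 2. cnj (d j h) * conv q (w c j) h)"
      unfolding q_def conv_recenter_derived_chain sum_distrib_left by (intro sum.cong refl sum.swap)
    also have "\<dots> = 0"
    proof (intro sum.neutral ballI)
      fix j h assume "j \<in> {1..N c}" "h \<in> {h. int h \<le> (int (p c j) - 1) div 2}"
      then have "conv q (w c j) h = 0" by (intro first) auto
      then show "cnj (d j h) * conv q (w c j) h = 0" by simp
    qed
    finally show ?thesis by simp
  qed
  have pair: "(\<Sum>j<n. cinner (q j) (\<xi> (g + j))) =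
      (\<Sum>k=1..N c. \<Sum>h\<le>p c k. cnj (a k h) * (if g \<le> h then conv q (w c k) (h - g) else 0))" for g
  proof -
    have "(\<Sum>j<n. cinner (q j) (\<xi> (g + j))) =
        (\<Sum>j<n. \<Sum>k=1..N c. \<Sum>h\<le>p c k. cnj (a k h) * cinner (q j) (rev_chain (w c k) h (g + j)))"
      by (simp add: \<xi>_def chain_comb_def cinner_sum_right cinner_scaleC_right)
    also have "\<dots> = (\<Sum>k=1..N c. \<Sum>j<n. \<Sum>h\<le>p c k. cnj (a k h) * cinner (q j) (rev_chain (w c k) h (g + j)))"
      by (rule sum.swap)
    also have "\<dots> = (\<Sum>k=1..N c. \<Sum>h\<le>p c k. \<Sum>j<n. cnj (a k h) * cinner (q j) (rev_chain (w c k) h (g + j)))"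
      by (rule sum.cong[OF refl]) (rule sum.swap)
    finally show ?thesis by (simp add: sum_distrib_left[symmetric] pair_rev_chain[OF q0])
  qed
  define r where "r = (\<Sum>k=1..N c. \<Sum>h\<le>p c k. if 2 * h = p c k then (norm (a k h))\<^sup>2 else 0)"
  show ?thesis
  proof (rule that[of r])
    show "0 \<le> r" unfolding r_def by (intro sum_nonneg) auto
    have "(\<Sum>j<n. cinner (q j) (\<xi> (0 + j))) = (\<Sum>k=1..N c. \<Sum>h\<le>p c k. if 2 * h = p c k then of_int \<sigma> * of_real ((norm (a k h))\<^sup>2) else 0)"
      unfolding pair
    proof (rule sum.cong[OF refl], rule sum.cong[OF refl])
      fix k h assume k: "k \<in> {1..N c}" and "h \<in> {..p c k}"
      then have h: "h \<le> p c k" by simp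
      show "cnj (a k h) * (if 0 \<le> h then conv q (w c k) (h - 0) else 0) =
          (if 2 * h = p c k then of_int \<sigma> * of_real ((norm (a k h))\<^sup>2) else 0)"
      proof (cases "a k h = 0")
        case False
        note hh = half[OF k h False]
        show ?thesis
        proof (cases "2 * h = p c k")
          case True
          then have h2: "p c k div 2 = h" "p c k - h = h" by auto
          have ev: "even (p c k)" using True by (metis dvd_triv_left)
          have "\<epsilon> c k = 1 \<or> \<epsilon> c k = - 1" using sign_cases[OF eig k] ev by blast
          then have \<epsilon>: "\<epsilon> c k = \<sigma>"
            using allowed[OF k h False] \<sigma> True by (auto elim!: evenE)
          have "a k h = of_int \<sigma> * conv q (w c k) h"
            using coeff[OF k h] middle[OF k ev] by (simp add: h2 \<epsilon>)
          then have "conv q (w c k) h = of_int \<sigma> * a k h" using \<sigma> by auto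
          then show ?thesis using True complex_norm_square[of "a k h"] by (simp add: mult_ac)
        next
          case False
          then show ?thesis using first[OF k, of h] hh by simp
        qed
      qed simp
    qed
    also have "\<dots> = of_real (of_int \<sigma> * r)"
      by (simp add: r_def sum_distrib_left if_distrib cong: if_cong)
    finally show "(\<Sum>j<n. cinner (recenter (of_real c) n b j) (chain_comb (N c) (p c) (w c) a j)) = of_real (of_int \<sigma> * r)"
      by (simp add: q_def \<xi>_def)
    fix g :: nat assume g: "1 \<le> g"
    have "(\<Sum>j<n. cinner (q j) (\<xi> (g + j))) = 0"
      unfolding pair
    proof (intro sum.neutral ballI)
      fix k h assume k: "k \<in> {1..N c}" and "h \<in> {..p c k}"
      then have h: "h \<le> p c k" by simp
      show "cnj (a k h) * (if g \<le> h then conv q (w c k) (h - g) else 0) = 0"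
      proof (cases "a k h = 0 \<or> \<not> g \<le> h")
        case False
        then have gh: "g \<le> h" "a k h \<noteq> 0" by auto
        then have "2 * (h - g) < p c k" using half[OF k h gh(2)] g by arith
        then show ?thesis using first[OF k] by simp
      qed auto
    qed
    then show "(\<Sum>j<n. cinner (recenter (of_real c) n b j) (chain_comb (N c) (p c) (w c) a (g + j))) = 0"
      by (simp add: q_def \<xi>_def)
  qed
qed

text \<open>
  Let \<open>g\<close> be the order to which the numerator vanishes at a point \<open>\<beta>\<close> where the numerical range omits zero.
  After division by the \<open>g\<close>-th power both numerator and preimage converge, and the limit of the form is
  \<open>(A(\<beta>) u, u)\<close>, so the leading coefficient is zero.
\<close>

lemma numerator_eq_0:
  assumes U: "\<And>x::real. of_real x \<notin> S \<Longrightarrow> pencil A n (of_real x) (U x) = vpoly n b (of_real x)"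
    and S: "finite S"
    and zero: "\<And>x::real. of_real x \<notin> S \<Longrightarrow> cinner (vpoly n b (of_real x)) (U x) = 0"
    and i: "i < n"
  shows "b i = 0"
proof -
  obtain \<beta> :: real where \<beta>: "\<And>x. cinner (pencil A n (of_real \<beta>) x) x = 0 \<Longrightarrow> x = 0"
    using definite_point by blast
  have "\<not> eigenvalue (pencil A n) (of_real \<beta>)"
    using \<beta> by (auto simp: eigenvalue_def)
  then obtain \<delta> \<kappa> where \<delta>: "\<delta> > 0" "\<kappa> > 0" "\<And>z x. dist z (of_real \<beta>) < \<delta> \<Longrightarrow> \<kappa> * norm x \<le> norm (pencil A n z x)"
    using pencil_lower_bound_near by metis
  define q where "q = recenter (of_real \<beta>) n b"
  have q: "vpoly n b (of_real (\<beta> + t)) = vpoly n q (of_real t)" for t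
    using vpoly_recenter[of n b "of_real (\<beta> + t)" "of_real \<beta>"] by (simp add: q_def)
  have q_all: "q g = 0" if "g < n" for g
    using that
  proof (induction g rule: less_induct)
    case (less g)
    define Q where "Q t = (\<Sum>j\<in>{g..<n}. of_real t ^ (j - g) *\<^sub>C q j)" for t :: real
    have vq: "vpoly n q (of_real t) = of_real t ^ g *\<^sub>C Q t" for t :: real
    proof -
      have "vpoly n q (of_real t) = (\<Sum>j\<in>{g..<n}. of_real t ^ j *\<^sub>C q j)"
        unfolding vpoly_def using less by (intro sum.mono_neutral_right) auto
      then show ?thesis
        by (auto simp: Q_def complex_vector.scale_sum_right scaleC_scaleC power_add[symmetric])
    qed
    have "(Q \<longlongrightarrow> (\<Sum>j\<in>{g..<n}. of_real 0 ^ (j - g) *\<^sub>C q j)) (at_right 0)"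
      unfolding Q_def by (intro tendsto_intros tendsto_ident_at)
    moreover have "(\<Sum>j\<in>{g..<n}. (of_real 0 :: complex) ^ (j - g) *\<^sub>C q j) = (\<Sum>j\<in>{g..<n}. if j = g then q g else 0)"
      by (intro sum.cong) (auto simp: power_0_left)
    ultimately have Q: "(Q \<longlongrightarrow> q g) (at_right 0)" using less by simp
    obtain u where u: "pencil A n (of_real \<beta>) u = q g"
      using clinear_inj_inverse[OF pencil_clinear[of "of_real \<beta>"]] \<open>\<not> eigenvalue _ _\<close>
      unfolding eigenvalue_def by metis
    define V where "V t = (1 / of_real t ^ g) *\<^sub>C U (\<beta> + t)" for t :: real
    have ev: "eventually (\<lambda>t. 0 < t \<and> t < \<delta> \<and> of_real (\<beta> + t) \<notin> S) (at_right 0)"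
    proof -
      have fin: "finite ((\<lambda>t. of_real (\<beta> + t)) -` S :: real set)"
        by (rule finite_vimageI[OF S]) (auto intro: injI)
      then have "eventually (\<lambda>t. t \<notin> (\<lambda>t. of_real (\<beta> + t)) -` S) (at (0::real))"
        using islimpt_finite[OF fin, of 0] by (simp only: islimpt_iff_eventually not_not)
      then have "eventually (\<lambda>t. t \<notin> (\<lambda>t. of_real (\<beta> + t)) -` S) (at_right (0::real))"
        by (rule filter_leD[rotated]) (simp add: at_le)
      moreover have "eventually (\<lambda>t. 0 < t \<and> t < \<delta>) (at_right (0::real))"
        by (rule eventually_at_rightI[of 0 \<delta>]) (use \<delta> in auto)
      ultimately show ?thesis by eventually_elim auto
    qed
    have FV: "pencil A n (of_real (\<beta> + t)) (V t) = Q t" and QV: "cinner (Q t) (V t) = 0"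
      if "0 < t \<and> t < \<delta> \<and> of_real (\<beta> + t) \<notin> S" for t
    proof -
      have t: "0 < t" "of_real (\<beta> + t) \<notin> S" using that by auto
      have tg: "of_real t ^ g \<noteq> (0::complex)" using t by simp
      have "pencil A n (of_real (\<beta> + t)) (V t) = (1 / of_real t ^ g) *\<^sub>C (of_real t ^ g *\<^sub>C Q t)"
        unfolding V_def clinear_rules(2)[OF pencil_clinear] U[OF t(2)] q vq ..
      then show "pencil A n (of_real (\<beta> + t)) (V t) = Q t" using t by (simp add: scaleC_scaleC)
      have "of_real t ^ g * cinner (Q t) (U (\<beta> + t)) = 0"
        using zero[OF t(2)] unfolding q vq cinner_scaleC_left .
      then show "cinner (Q t) (V t) = 0" using t by (auto simp: V_def cinner_scaleC_right)
    qed
    have V: "(V \<longlongrightarrow> u) (at_right 0)"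
    proof -
      have "((\<lambda>t. pencil A n (of_real (\<beta> + t)) u) \<longlongrightarrow> pencil A n (of_real (\<beta> + 0)) u) (at_right 0)"
        unfolding pencil_def by (intro tendsto_intros tendsto_ident_at)
      then have "((\<lambda>t. norm (Q t - pencil A n (of_real (\<beta> + t)) u) / \<kappa>) \<longlongrightarrow> norm (q g - q g) / \<kappa>) (at_right 0)"
        using Q \<delta>(2) u by (intro tendsto_intros) auto
      then have "((\<lambda>t. norm (Q t - pencil A n (of_real (\<beta> + t)) u) / \<kappa>) \<longlongrightarrow> 0) (at_right 0)" by simp
      moreover have "eventually (\<lambda>t. norm (V t - u) \<le> norm (Q t - pencil A n (of_real (\<beta> + t)) u) / \<kappa>) (at_right 0)"
        using ev
      proof eventually_elim
        case (elim t)
        have "dist (of_real (\<beta> + t)) (of_real \<beta> :: complex) < \<delta>" using elim by (simp add: dist_norm)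
        from \<delta>(3)[OF this, of "V t - u"]
        have "\<kappa> * norm (V t - u) \<le> norm (Q t - pencil A n (of_real (\<beta> + t)) u)"
          by (simp only: clinear_rules[OF pencil_clinear] FV[OF elim])
        then show ?case using \<delta>(2) by (simp add: field_simps)
      qed
      ultimately have "((\<lambda>t. V t - u) \<longlongrightarrow> 0) (at_right 0)" by (rule Lim_null_comparison[rotated])
      then show ?thesis by (simp only: Lim_null[symmetric])
    qed
    have "((\<lambda>t. cinner (Q t) (V t)) \<longlongrightarrow> cinner (q g) u) (at_right 0)" by (intro tendsto_intros Q V)
    moreover have "((\<lambda>t. cinner (Q t) (V t)) \<longlongrightarrow> 0) (at_right 0)"
      by (rule tendsto_eventually) (use ev QV in \<open>auto elim: eventually_mono\<close>)
    ultimately have "cinner (q g) u = 0" by (rule tendsto_unique[OF trivial_limit_at_right_real])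
    then have "u = 0" using \<beta>[of u] u by simp
    then show "q g = 0" using u clinear_rules(3)[OF pencil_clinear] by metis
  qed
  have "vpoly n b z = 0" for z
    using vpoly_recenter[of n b z "of_real \<beta>"] q_all by (simp add: vpoly_def q_def)
  then show ?thesis using vpoly_eq_0_imp[of 1 n b i] i by simp
qed


text \<open>
  The heart of the uniqueness proof. The function \<open>f\<close> below is rational, has nonpositive imaginary
  part on the real axis and decays quadratically; by the assumption on the supports its poles lie
  in one closed half plane, and those on the axis are simple with residues of one sign.
\<close>

lemma half_data_determine:
  fixes \<sigma> :: int and x :: "complex \<Rightarrow> nat \<Rightarrow> 'a"
  assumes \<sigma>: "\<sigma> = 1 \<or> \<sigma> = -1" and S: "finite S"
    and root: "\<And>c. c \<in> S \<Longrightarrow> root_seq A n c (x c)" and fin: "\<And>c m. m \<ge> M \<Longrightarrow> x c m = 0"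
    and side: "\<And>c. c \<in> S \<Longrightarrow> of_int \<sigma> * Im c < 0 \<Longrightarrow> x c = (\<lambda>_. 0)"
    and real: "\<And>c. of_real c \<in> S \<Longrightarrow> eigenvalue (pencil A n) (of_real c) \<Longrightarrow>
      x (of_real c) = chain_comb (N c) (p c) (w c) (a c)"
    and allowed: "\<And>c k h. of_real c \<in> S \<Longrightarrow> eigenvalue (pencil A n) (of_real c) \<Longrightarrow> k \<in> {1..N c} \<Longrightarrow> h \<le> p c k \<Longrightarrow>
      a c k h \<noteq> 0 \<Longrightarrow> int h \<le> (int (p c k) + \<sigma> * \<epsilon> c k) div 2"
    and M: "\<And>c k. of_real c \<in> S \<Longrightarrow> eigenvalue (pencil A n) (of_real c) \<Longrightarrow> k \<in> {1..N c} \<Longrightarrow> p c k < M"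
    and zero: "\<And>j. j < l \<Longrightarrow> (\<Sum>c\<in>S. geo c (x c) j) = 0"
    and j: "j < n"
  shows "(\<Sum>c\<in>S. geo c (x c) j) = 0"
proof -
  define y where "y j = (\<Sum>c\<in>S. geo c (x c) j)" for j
  define b where "b = numer_coeff A n y"
  define u where "u = partial_fraction S M x"
  have pencil_u: "pencil A n z (u z) = vpoly n b z" if "z \<notin> S" for z
    using pencil_partial_fraction[OF that root fin] unfolding u_def b_def y_def[symmetric] numer_vpoly by simp
  have b_high: "b i = 0" if "l \<le> i" for i
    unfolding b_def by (rule numer_coeff_high[OF n_even _ that]) (simp add: y_def zero)
  define f where "f z = cinner (vpoly n b z) (u (cnj z))" for z
  define R0 where "R0 = {r::real. of_real r \<in> S}"
  have R0: "finite R0"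
  proof -
    have "R0 = of_real -` S" by (auto simp: R0_def)
    then show ?thesis using finite_vimageI[OF S, of "of_real :: real \<Rightarrow> complex"] by (simp add: inj_of_real)
  qed
  have "\<exists>\<rho>\<ge>0. (\<Sum>j<n. cinner (recenter (of_real r) n b j) (x (of_real r) j)) = of_real (of_int \<sigma> * \<rho>) \<and>
      (\<forall>g\<ge>1. (\<Sum>j<n. cinner (recenter (of_real r) n b j) (x (of_real r) (g + j))) = 0)" if r: "r \<in> R0" for r
  proof (cases "eigenvalue (pencil A n) (of_real r)")
    case False
    have "x (of_real r) m = 0" for m
      by (rule root_seq_eq_0[where M = M, OF root _ False]) (use fin r in \<open>auto simp: R0_def\<close>)
    then show ?thesis by (intro exI[of _ 0]) simp
  next
    case True
    have rS: "of_real r \<in> S" using r by (simp add: R0_def)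
    obtain \<delta>1 K where \<delta>1: "\<delta>1 > 0" "\<And>z. dist z (of_real r) < \<delta>1 \<Longrightarrow> norm (partial_fraction (S - {of_real r}) M x z) \<le> K"
      using isCont_bounded_near[OF partial_fraction_continuous[of "of_real r" "S - {of_real r}" M x]] by blast
    obtain \<delta>2 where \<delta>2: "\<delta>2 > 0" "\<And>z. z \<in> S \<Longrightarrow> z \<noteq> of_real r \<Longrightarrow> \<delta>2 \<le> dist (of_real r) z"
      using finite_set_avoid[OF S, of "of_real r"] by blast
    have res: thesis if "\<And>\<rho>. \<rho> \<ge> 0 \<Longrightarrow>
      (\<Sum>j<n. cinner (recenter (of_real r) n b j) (chain_comb (N r) (p r) (w r) (a r) j)) = of_real (of_int \<sigma> * \<rho>) \<Longrightarrow>
      (\<And>g. g \<ge> 1 \<Longrightarrow> (\<Sum>j<n. cinner (recenter (of_real r) n b j) (chain_comb (N r) (p r) (w r) (a r) (g + j))) = 0) \<Longrightarrow> thesis" for thesis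
    proof (rule residue_at_real_eigenvalue[where c = r and \<sigma> = \<sigma> and a = "a r" and M = M and \<delta> = "min \<delta>1 \<delta>2" and b = b
          and B = "\<lambda>t. partial_fraction (S - {of_real r}) M x (of_real r + of_real t)" and K = K])
      fix t :: real assume t: "0 < t" "t < min \<delta>1 \<delta>2"
      have d: "dist (of_real r + of_real t) (of_real r :: complex) = t" "dist (of_real r :: complex) (of_real r + of_real t) = t"
        using t by (auto simp: dist_norm)
      have nS: "of_real r + of_real t \<notin> S" using \<delta>2(2)[of "of_real r + of_real t"] d t by auto
      show "pencil A n (of_real r + of_real t)
        (pole_part (of_real r) M (chain_comb (N r) (p r) (w r) (a r)) (of_real r + of_real t) +
         partial_fraction (S - {of_real r}) M x (of_real r + of_real t)) = vpoly n b (of_real r + of_real t)"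
        using pencil_u[OF nS] partial_fraction_split[OF S, of M x "of_real r + of_real t" "of_real r"] rS real[OF rS True]
        by (simp add: u_def)
      show "norm (partial_fraction (S - {of_real r}) M x (of_real r + of_real t)) \<le> K"
        using \<delta>1(2) d t by simp
    qed (use True \<sigma> allowed[OF rS True] M[OF rS True] \<delta>1(1) \<delta>2(1) that in auto)
    show ?thesis unfolding real[OF rS True] by (rule res) blast
  qed
  then have "\<forall>r\<in>R0. \<exists>\<rho>. 0 \<le> \<rho> \<and>
      (\<Sum>j<n. cinner (recenter (of_real r) n b j) (x (of_real r) j)) = of_real (of_int \<sigma> * \<rho>) \<and>
      (\<forall>g\<ge>1. (\<Sum>j<n. cinner (recenter (of_real r) n b j) (x (of_real r) (g + j))) = 0)" by blast
  from bchoice[OF this] obtain \<rho> where \<rho>': "\<forall>r\<in>R0. 0 \<le> \<rho> r \<and>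
      (\<Sum>j<n. cinner (recenter (of_real r) n b j) (x (of_real r) j)) = of_real (of_int \<sigma> * \<rho> r) \<and>
      (\<forall>g\<ge>1. (\<Sum>j<n. cinner (recenter (of_real r) n b j) (x (of_real r) (g + j))) = 0)" by (rule exE)
  then have \<rho>: "\<And>r. r \<in> R0 \<Longrightarrow> 0 \<le> \<rho> r"
    "\<And>r. r \<in> R0 \<Longrightarrow> (\<Sum>j<n. cinner (recenter (of_real r) n b j) (x (of_real r) j)) = of_real (of_int \<sigma> * \<rho> r)"
    "\<And>r g. r \<in> R0 \<Longrightarrow> g \<ge> 1 \<Longrightarrow> (\<Sum>j<n. cinner (recenter (of_real r) n b j) (x (of_real r) (g + j))) = 0"
    by blast+
  define T where "T c z = (\<Sum>m<M. (1 / (z - cnj c) ^ Suc m) * cinner (vpoly n b z) (x c m))" for c z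
  have T: "cinner (vpoly n b z) (pole_part c M (x c) (cnj z)) = T c z" for c z
    unfolding T_def pole_part_def cinner_sum_right cinner_scaleC_right by simp
  define P where "P r z = (\<Sum>m<M. \<Sum>j<n. if m < j then (z - of_real r) ^ (j - m - 1) *
      cinner (recenter (of_real r) n b j) (x (of_real r) m) else 0)" for r z
  have T_real: "T (of_real r) z = of_real (of_int \<sigma> * \<rho> r) / (z - of_real r) + P r z"
    if r: "r \<in> R0" and z: "z \<noteq> of_real r" for r z
  proof -
    let ?d = "z - of_real r"
    let ?q = "recenter (of_real r) n b"
    let ?x = "x (of_real r)"
    have d: "?d \<noteq> 0" using z by simp
    have "T (of_real r) z = (\<Sum>m<M. \<Sum>j<n. (?d ^ j / ?d ^ Suc m) * cinner (?q j) (?x m))"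
      unfolding T_def vpoly_recenter[of n b z "of_real r"]
      by (simp add: vpoly_def cinner_sum_left cinner_scaleC_left sum_distrib_left)
    also have "\<dots> = (\<Sum>m<M. \<Sum>j<n. (if j \<le> m then (1 / ?d ^ Suc (m - j)) * cinner (?q j) (?x m) else 0) +
        (if m < j then ?d ^ (j - m - 1) * cinner (?q j) (?x m) else 0))"
    proof (rule sum.cong[OF refl], rule sum.cong[OF refl])
      fix m j
      show "(?d ^ j / ?d ^ Suc m) * cinner (?q j) (?x m) =
        (if j \<le> m then (1 / ?d ^ Suc (m - j)) * cinner (?q j) (?x m) else 0) +
        (if m < j then ?d ^ (j - m - 1) * cinner (?q j) (?x m) else 0)"
      proof (cases "j \<le> m")
        case True
        then have "?d ^ Suc m = ?d ^ j * ?d ^ Suc (m - j)" by (simp only: power_add[symmetric]) simp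
        then show ?thesis using True d by simp
      next
        case False
        then have "?d ^ j = ?d ^ (j - m - 1) * ?d ^ Suc m" by (simp only: power_add[symmetric]) simp
        then show ?thesis using False d by (simp del: power_Suc)
      qed
    qed
    also have "\<dots> = (\<Sum>m<M. \<Sum>j<n. if j \<le> m then (1 / ?d ^ Suc (m - j)) * cinner (?q j) (?x m) else 0) + P r z"
      by (simp only: sum.distrib P_def)
    also have "(\<Sum>m<M. \<Sum>j<n. if j \<le> m then (1 / ?d ^ Suc (m - j)) * cinner (?q j) (?x m) else 0) =
        (\<Sum>j<n. \<Sum>g<M. (1 / ?d ^ Suc g) * cinner (?q j) (?x (g + j)))"
    proof (subst sum.swap, rule sum.cong[OF refl])
      fix j
      have "(\<Sum>m<M. if j \<le> m then (1 / ?d ^ Suc (m - j)) * cinner (?q j) (?x m) else 0) =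
          (\<Sum>m\<in>{j..<M}. (1 / ?d ^ Suc (m - j)) * cinner (?q j) (?x m))"
        by (intro sum.mono_neutral_cong_right) auto
      also have "\<dots> = (\<Sum>g\<in>{g. g + j < M}. (1 / ?d ^ Suc g) * cinner (?q j) (?x (g + j)))"
        by (intro sum.reindex_bij_witness[where i = "\<lambda>g. g + j" and j = "\<lambda>m. m - j"]) auto
      also have "\<dots> = (\<Sum>g<M. (1 / ?d ^ Suc g) * cinner (?q j) (?x (g + j)))"
        using fin by (intro sum.mono_neutral_left) auto
      finally show "(\<Sum>m<M. if j \<le> m then (1 / ?d ^ Suc (m - j)) * cinner (?q j) (?x m) else 0) =
          (\<Sum>g<M. (1 / ?d ^ Suc g) * cinner (?q j) (?x (g + j)))" .
    qed
    also have "\<dots> = (\<Sum>g<M. (1 / ?d ^ Suc g) * (\<Sum>j<n. cinner (?q j) (?x (g + j))))"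
      by (subst sum.swap) (simp only: sum_distrib_left)
    also have "\<dots> = (\<Sum>g<M. if g = 0 then of_real (of_int \<sigma> * \<rho> r) / ?d else 0)"
    proof (rule sum.cong[OF refl])
      fix g
      show "(1 / ?d ^ Suc g) * (\<Sum>j<n. cinner (?q j) (?x (g + j))) = (if g = 0 then of_real (of_int \<sigma> * \<rho> r) / ?d else 0)"
        using \<rho>(2)[OF r] \<rho>(3)[OF r, of g] by (cases "g = 0") auto
    qed
    also have "\<dots> = of_real (of_int \<sigma> * \<rho> r) / ?d"
    proof (cases "M = 0")
      case True
      then show ?thesis using \<rho>(2)[OF r] fin by simp
    qed simp
    finally show ?thesis .
  qed
  (* Replacing z by s z reduces the case \<sigma> = -1 to the upper half plane; it changes the signs of the residues
     and reflects the poles. *)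
  define s where "s = (of_int \<sigma> :: real)"
  have s: "s * s = 1" "s = 1 \<or> s = -1" using \<sigma> by (auto simp: s_def)
  have s': "of_real s * of_real s = (1 :: complex)" by (metis s(1) of_real_mult of_real_1)
  define S1 where "S1 = {c \<in> S. 0 < s * Im c}"
  define G0 where "G0 z = (\<Sum>c\<in>S1. T c z) + (\<Sum>r\<in>R0. P r z)" for z
  have f_eq: "f z = G0 z + (\<Sum>r\<in>R0. of_real (s * \<rho> r) / (z - of_real r))" if z: "cnj z \<notin> S" for z
  proof -
    have "f z = (\<Sum>c\<in>S. T c z)"
      unfolding f_def u_def partial_fraction_def cinner_sum_right T ..
    also have "\<dots> = (\<Sum>c\<in>S1 \<union> of_real ` R0. T c z)"
    proof (rule sum.mono_neutral_right[OF S])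
      show "S1 \<union> of_real ` R0 \<subseteq> S" by (auto simp: S1_def R0_def)
      show "\<forall>c\<in>S - (S1 \<union> of_real ` R0). T c z = 0"
      proof
        fix c assume c: "c \<in> S - (S1 \<union> of_real ` R0)"
        have "Im c \<noteq> 0"
        proof
          assume "Im c = 0"
          then have "c = of_real (Re c)" by (simp add: complex_eq_iff)
          then have "c \<in> of_real ` R0" using c by (metis (mono_tags, lifting) DiffD1 R0_def imageI mem_Collect_eq)
          then show False using c by simp
        qed
        then have "s * Im c < 0" using c s(2) by (auto simp: S1_def)
        then have "x c = (\<lambda>_. 0)" using side[of c] c by (simp add: s_def)
        then show "T c z = 0" by (simp add: T_def)
      qed
    qed
    also have "\<dots> = (\<Sum>c\<in>S1. T c z) + (\<Sum>c\<in>of_real ` R0. T c z)"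
      using S R0 by (intro sum.union_disjoint) (auto simp: S1_def)
    also have "(\<Sum>c\<in>of_real ` R0. T c z) = (\<Sum>r\<in>R0. T (of_real r) z)"
      by (subst sum.reindex) (auto simp: inj_on_def)
    also have "\<dots> = (\<Sum>r\<in>R0. of_real (s * \<rho> r) / (z - of_real r) + P r z)"
    proof (rule sum.cong[OF refl])
      fix r assume r: "r \<in> R0"
      have "z \<noteq> of_real r" using z r by (auto simp: R0_def)
      from T_real[OF r this] show "T (of_real r) z = of_real (s * \<rho> r) / (z - of_real r) + P r z" by (simp add: s_def)
    qed
    finally show ?thesis by (simp add: G0_def sum.distrib)
  qed
  define R where "R = (\<lambda>r. s * r) ` R0"
  define G where "G z = G0 (of_real s * z)" for z
  have fs_eq: "f (of_real s * z) = G z + (\<Sum>c\<in>R. of_real (\<rho> (s * c)) / (z - of_real c))"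
    if z: "cnj (of_real s * z) \<notin> S" for z
  proof -
    have inj: "inj_on (\<lambda>r. s * r) R0" using s by (auto simp: inj_on_def)
    have "of_real (s * \<rho> r) / (of_real s * z - of_real r) = of_real (\<rho> (s * (s * r))) / (z - of_real (s * r))" for r
    proof -
      have e1: "of_real s * z - of_real r = of_real s * (z - of_real (s * r))"
        using s' by (simp add: right_diff_distrib mult.assoc[symmetric])
      have e2: "s * (s * r) = r" using s(1) by (simp only: mult.assoc[symmetric] mult_1_left)
      have "(of_real s :: complex) \<noteq> 0" using s by auto
      then show ?thesis unfolding e1 e2 by (simp del: of_real_mult add: of_real_mult[of s "\<rho> r"])
    qed
    then show ?thesis
      unfolding f_eq[OF z] R_def sum.reindex[OF inj] comp_def G_def by simp
  qed
  have real_S: "cnj (of_real s * of_real t) \<notin> S" if "t \<notin> R" for t :: real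
  proof
    assume "cnj (of_real s * of_real t) \<in> S"
    then have "s * t \<in> R0" by (simp add: R0_def)
    then have "s * (s * t) \<in> R" unfolding R_def by blast
    then show False using that s(1) by (simp add: mult.assoc[symmetric])
  qed
  have S1_ne: "of_real s * z \<noteq> cnj c" if "c \<in> S1" "0 \<le> Im z" for c z
  proof
    assume eq: "of_real s * z = cnj c"
    then have "Im (of_real s * z) = - Im c" by simp
    then have "s * Im z = - Im c" by simp
    then have "s * (s * Im z) = - (s * Im c)" by simp
    then have "Im z = - (s * Im c)" using s(1) by (simp add: mult.assoc[symmetric])
    then show False using that by (simp add: S1_def)
  qed
  have "(\<lambda>z. P r (of_real s * z)) holomorphic_on {z. 0 \<le> Im z}" for r
    unfolding P_def
  proof (intro holomorphic_on_sum)
    fix m j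
    show "(\<lambda>z. if m < j then (of_real s * z - of_real r) ^ (j - m - 1) *
      cinner (recenter (of_real r) n b j) (x (of_real r) m) else 0) holomorphic_on {z. 0 \<le> Im z}"
      by (cases "m < j") (auto intro!: holomorphic_intros)
  qed
  moreover have "(\<lambda>z. T c (of_real s * z)) holomorphic_on {z. 0 \<le> Im z}" if "c \<in> S1" for c
    unfolding T_def vpoly_def cinner_sum_left cinner_scaleC_left
    using S1_ne[OF that] by (intro holomorphic_intros) auto
  ultimately have holG: "G holomorphic_on {z. 0 \<le> Im z}"
    unfolding G_def G0_def by (intro holomorphic_on_add holomorphic_on_sum)
  have cont: "continuous_on {z. 0 \<le> Im z} G" by (rule holomorphic_on_imp_continuous_on[OF holG])
  have hol: "G holomorphic_on {z. 0 < Im z}" by (rule holomorphic_on_subset[OF holG]) auto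
  obtain B K where decay: "\<And>z. B \<le> norm z \<Longrightarrow> cnj z \<notin> S \<and> norm (f z) \<le> K / (norm z)\<^sup>2"
  proof -
    obtain r \<kappa> where r: "r \<ge> 1" "\<kappa> > 0" "\<And>z x. r \<le> norm z \<Longrightarrow> \<kappa> * norm z ^ n * norm x \<le> norm (pencil A n z x)"
      using pencil_lower_bound_infinity by metis
    define K1 where "K1 = (\<Sum>i<l. norm (b i))"
    (* The additional factor z makes the estimate uniform in l; for l = 0 the exponent l - 1 would be wrong. *)
    have qb: "norm (vpoly n b z) * norm z \<le> K1 * norm z ^ l" if z: "1 \<le> norm z" for z :: complex
    proof -
      have "vpoly n b z = (\<Sum>i<l. z ^ i *\<^sub>C b i)"
        unfolding vpoly_def using b_high n_even by (intro sum.mono_neutral_right) auto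
      then have "norm (vpoly n b z) \<le> (\<Sum>i<l. norm z ^ i * norm (b i))"
        by (simp add: sum_norm_le norm_power)
      then have "norm (vpoly n b z) * norm z \<le> (\<Sum>i<l. norm z ^ i * norm (b i)) * norm z"
        by (rule mult_right_mono) simp
      also have "\<dots> = (\<Sum>i<l. norm (b i) * norm z ^ Suc i)" by (simp add: sum_distrib_left sum_distrib_right mult_ac)
      also have "\<dots> \<le> (\<Sum>i<l. norm (b i) * norm z ^ l)"
        using z by (intro sum_mono mult_left_mono power_increasing) auto
      finally show ?thesis by (simp add: K1_def sum_distrib_right)
    qed
    define B where "B = max r (Max (insert 0 (norm ` S)) + 1)"
    show ?thesis
    proof (rule that[of B "K1 * K1 / \<kappa>"], rule conjI)
      fix z :: complex assume zB: "B \<le> norm z"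
      have z: "r \<le> norm z" "1 \<le> norm z" "0 < norm z" using zB r(1) by (auto simp: B_def)
      show nS: "cnj z \<notin> S"
      proof
        assume "cnj z \<in> S"
        then have "norm (cnj z) \<in> insert 0 (norm ` S)" by blast
        then have "norm (cnj z) \<le> Max (insert 0 (norm ` S))" using S by (intro Max_ge) simp_all
        then show False using zB by (simp add: B_def)
      qed
      have "norm (f z) \<le> norm (vpoly n b z) * norm (u (cnj z))" unfolding f_def by (rule norm_cinner_le)
      then have "norm (f z) * (norm z)\<^sup>2 \<le> (norm (vpoly n b z) * norm z) * (norm (u (cnj z)) * norm z)"
        using mult_right_mono[of _ _ "(norm z)\<^sup>2"] by (fastforce simp: power2_eq_square mult_ac)
      also have "\<dots> \<le> (K1 * norm z ^ l) * (K1 * norm z ^ l / (\<kappa> * norm z ^ n))"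
      proof (rule mult_mono[OF qb[OF z(2)]])
        have "\<kappa> * norm (cnj z) ^ n * norm (u (cnj z)) \<le> norm (vpoly n b (cnj z))"
          using r(3)[of "cnj z" "u (cnj z)"] z pencil_u[OF nS] by simp
        then have "(\<kappa> * norm z ^ n * norm (u (cnj z))) * norm z \<le> norm (vpoly n b (cnj z)) * norm (cnj z)"
          by (simp add: mult_right_mono)
        also have "\<dots> \<le> K1 * norm z ^ l" using qb[of "cnj z"] z by simp
        finally show "norm (u (cnj z)) * norm z \<le> K1 * norm z ^ l / (\<kappa> * norm z ^ n)"
          using r(2) z(3) by (simp add: field_simps)
      qed (auto simp: K1_def sum_nonneg)
      also have "\<dots> = K1 * K1 / \<kappa>"
      proof -
        have "norm z ^ n = norm z ^ l * norm z ^ l" by (simp add: n_even mult_2 power_add)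
        then show ?thesis using r(2) z(3) by (simp add: field_simps)
      qed
      finally show "norm (f z) \<le> K1 * K1 / \<kappa> / (norm z)\<^sup>2"
        using z(3) by (simp only: pos_le_divide_eq zero_less_power)
    qed
  qed
  have norm_s: "norm (of_real s * z) = norm z" for z :: complex using s(2) by (auto simp: norm_mult)
  have f_real: "f (of_real t) = cinner (pencil A n (of_real t) (u (of_real t))) (u (of_real t))" if "of_real t \<notin> S" for t :: real
    using pencil_u[OF that] by (simp add: f_def)
  have G_real: "G (of_real t) = 0" and \<rho>0: "c \<in> R \<Longrightarrow> \<rho> (s * c) = 0" for t c :: real
  proof -
    have R: "finite R" "\<And>c. c \<in> R \<Longrightarrow> 0 \<le> \<rho> (s * c)"
      using R0 \<rho>(1) s(1) by (auto simp: R_def mult.assoc[symmetric])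
    have decay': "norm (G z + (\<Sum>c\<in>R. of_real (\<rho> (s * c)) / (z - of_real c))) \<le> K / (norm z)\<^sup>2"
      if "0 \<le> Im z" "B \<le> norm z" for z
      using decay[of "of_real s * z"] fs_eq[of z] that by (simp add: norm_s)
    have im: "Im (G (of_real t) + (\<Sum>c\<in>R. of_real (\<rho> (s * c)) / (of_real t - of_real c))) \<le> 0" if "t \<notin> R" for t :: real
    proof -
      have "G (of_real t) + (\<Sum>c\<in>R. of_real (\<rho> (s * c)) / (of_real t - of_real c)) = f (of_real (s * t))"
        using fs_eq[OF real_S[OF that]] by simp
      then show ?thesis using dissipative[of "s * t" "u (of_real (s * t))"] f_real[of "s * t"] real_S[OF that] by simp
    qed
    show "G (of_real t) = 0" by (rule half_plane_rigidity(2)[OF R hol cont decay' im])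
    show "c \<in> R \<Longrightarrow> \<rho> (s * c) = 0" by (rule half_plane_rigidity(1)[OF R hol cont decay' im])
  qed
  have f0: "cinner (vpoly n b (of_real t)) (u (of_real t)) = 0" if t: "of_real t \<notin> S" for t :: real
  proof -
    have "cnj (of_real s * of_real (s * t)) \<notin> S" using t s' by (simp add: mult.assoc[symmetric])
    from fs_eq[OF this] have "f (of_real s * of_real (s * t)) = 0" using G_real[of "s * t"] \<rho>0 by simp
    then show ?thesis using s' by (simp add: f_def mult.assoc[symmetric])
  qed
  have "b i = 0" if "i < n" for i
    using numerator_eq_0[of S "\<lambda>t. u (of_real t)" b i] pencil_u S f0 that by blast
  then have "y j = 0" using numer_eq_0_imp[of y j] j by (simp add: b_def)
  then show ?thesis by (simp add: y_def)
qed

end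


section \<open>Solutions of the differential equation\<close>

text \<open>
  The function \<open>D^j u\<close> on the half line.
\<close>

definition momentum :: "nat \<Rightarrow> (real \<Rightarrow> 'a::complex_inner) \<Rightarrow> real \<Rightarrow> 'a" where
  "momentum j u t = (- \<i>) ^ j *\<^sub>C higher_deriv_on {0..} j u t"

lemma momentum_has_vector_derivative:
  assumes "solution A n u" "j < n" "0 \<le> t"
  shows "(momentum j u has_vector_derivative \<i> *\<^sub>C momentum (Suc j) u t) (at t within {0..})"
proof -
  have "(higher_deriv_on {0..} j u has_vector_derivative higher_deriv_on {0..} (Suc j) u t) (at t within {0..})"
    using assms by (simp add: solution_def)
  from bounded_linear.has_vector_derivative[OF bounded_bilinear.bounded_linear_right[OF bounded_bilinear_scaleC, of "(- \<i>) ^ j"] this]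
  have "(momentum j u has_vector_derivative (- \<i>) ^ j *\<^sub>C higher_deriv_on {0..} (Suc j) u t) (at t within {0..})"
    unfolding momentum_def .
  moreover have "(- \<i>) ^ j = \<i> * (- \<i>) ^ Suc j" by (simp add: mult.assoc[symmetric])
  ultimately show ?thesis by (simp only: momentum_def scaleC_scaleC)
qed

lemma higher_deriv_on_diff:
  assumes "solution A n u" "solution A n v" "j \<le> n" "0 \<le> t"
  shows "higher_deriv_on {0..} j (\<lambda>t. u t - v t) t = higher_deriv_on {0..} j u t - higher_deriv_on {0..} j v t"
proof (rule higher_deriv_on_eqI[where J = n and f = "\<lambda>j t. higher_deriv_on {0..} j u t - higher_deriv_on {0..} j v t"])
  fix j :: nat and t :: real assume "j < n" "t \<in> {0..}"
  then show "((\<lambda>t. higher_deriv_on {0..} j u t - higher_deriv_on {0..} j v t) has_vector_derivative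
      higher_deriv_on {0..} (Suc j) u t - higher_deriv_on {0..} (Suc j) v t) (at t within {0..})"
    using assms(1,2) by (intro has_vector_derivative_diff) (auto simp: solution_def)
qed (use assms at_within_Ici_neq_bot in \<open>auto simp: higher_deriv_on_0\<close>)

lemma momentum_diff:
  assumes "solution A n u" "solution A n v" "j \<le> n" "0 \<le> t"
  shows "momentum j (\<lambda>t. u t - v t) t = momentum j u t - momentum j v t"
  unfolding momentum_def by (simp add: higher_deriv_on_diff[OF assms] complex_vector.scale_right_diff_distrib)

lemma higher_deriv_on_cong:
  assumes "\<And>t. 0 \<le> t \<Longrightarrow> u t = v t" "0 \<le> t"
  shows "higher_deriv_on {0..} j u t = higher_deriv_on {0..} j v t"
  using assms(2)
proof (induction j arbitrary: t)
  case 0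
  then show ?case using assms(1) by (simp add: higher_deriv_on_0)
next
  case (Suc j)
  have "(higher_deriv_on {0..} j u has_vector_derivative D) (at t within {0..}) \<longleftrightarrow>
      (higher_deriv_on {0..} j v has_vector_derivative D) (at t within {0..})" for D
    using Suc by (intro iffI; elim has_vector_derivative_transform[rotated 2]) auto
  then show ?case by (simp add: higher_deriv_on_Suc vector_derivative_def)
qed

context linear_pencil
begin

lemma momentum_equation: "solution A n u \<Longrightarrow> 0 \<le> t \<Longrightarrow> (\<Sum>j\<le>n. A j (momentum j u t)) = 0"
  by (simp add: solution_def momentum_def A_rules)

lemma solution_diff:
  assumes "solution A n u" "solution A n v"
  shows "solution A n (\<lambda>t. u t - v t)"
proof -
  have eq: "higher_deriv_on {0..} j (\<lambda>t. u t - v t) t = higher_deriv_on {0..} j u t - higher_deriv_on {0..} j v t"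
    if "j \<le> n" "0 \<le> t" for j t
    using higher_deriv_on_diff[OF assms that] .
  have "(higher_deriv_on {0..} j (\<lambda>t. u t - v t) has_vector_derivative higher_deriv_on {0..} (Suc j) (\<lambda>t. u t - v t) t) (at t within {0..})"
    if "j < n" "0 \<le> t" for j t
  proof (rule has_vector_derivative_transform)
    show "((\<lambda>t. higher_deriv_on {0..} j u t - higher_deriv_on {0..} j v t) has_vector_derivative
        higher_deriv_on {0..} (Suc j) (\<lambda>t. u t - v t) t) (at t within {0..})"
      using assms that by (subst eq) (auto intro!: has_vector_derivative_diff simp: solution_def)
  qed (use that eq in auto)
  moreover have "(\<Sum>j\<le>n. (- \<i>) ^ j *\<^sub>C A j (higher_deriv_on {0..} j (\<lambda>t. u t - v t) t)) = 0" if "0 \<le> t" for t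
    using assms that
    by (simp add: eq A_rules complex_vector.scale_right_diff_distrib sum_subtractf solution_def)
  ultimately show ?thesis by (simp add: solution_def)
qed

lemma exp_poly_solution:
  assumes root: "\<And>c. c \<in> S \<Longrightarrow> root_seq A n c (x c)" and fin: "\<And>c m. m \<ge> M \<Longrightarrow> x c m = 0"
    and v: "\<And>t. 0 \<le> t \<Longrightarrow> v t = (\<Sum>c\<in>S. exp_poly c M (x c) t)"
  shows "solution A n v" and "momentum j v 0 = (\<Sum>c\<in>S. geo c (x c) j)"
proof -
  have v': "v t = (\<Sum>c\<in>S. exp_poly c M (x c) t)" if "t \<in> {0..}" for t using v that by simp
  note hd = higher_deriv_exp_poly[OF fin at_within_Ici_neq_bot v']
  have "(\<Sum>j\<le>n. (- \<i>) ^ j *\<^sub>C A j (higher_deriv_on {0..} j v t)) = 0" if t: "0 \<le> t" for t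
  proof -
    have "(\<Sum>j\<le>n. (- \<i>) ^ j *\<^sub>C A j (higher_deriv_on {0..} j v t)) =
        (\<Sum>j\<le>n. A j (\<Sum>c\<in>S. exp_poly c M (\<lambda>m. geo c (shift m (x c)) j) t))"
    proof (rule sum.cong[OF refl])
      fix j assume "j \<in> {..n}"
      then show "(- \<i>) ^ j *\<^sub>C A j (higher_deriv_on {0..} j v t) = A j (\<Sum>c\<in>S. exp_poly c M (\<lambda>m. geo c (shift m (x c)) j) t)"
        using t by (subst hd(1)) (auto simp only: A_rules(2) minus_i_power_i_power atLeast_iff atMost_iff)
    qed
    also have "\<dots> = (\<Sum>c\<in>S. \<Sum>j\<le>n. exp_poly c M (\<lambda>m. A j (geo c (shift m (x c)) j)) t)"
      by (subst sum.swap) (simp add: A_rules exp_poly_def del: shift_apply)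
    also have "\<dots> = (\<Sum>c\<in>S. exp_poly c M (\<lambda>m. \<Sum>j\<le>n. A j (geo c (shift m (x c)) j)) t)"
      by (simp only: exp_poly_sum)
    also have "\<dots> = 0"
    proof (rule sum.neutral, rule ballI)
      fix c assume "c \<in> S"
      then have "(\<lambda>m. \<Sum>j\<le>n. A j (geo c (shift m (x c)) j)) = (\<lambda>m. 0)" using root by (simp add: root_seq_def)
      then show "exp_poly c M (\<lambda>m. \<Sum>j\<le>n. A j (geo c (shift m (x c)) j)) t = 0" by (simp only: exp_poly_zero)
    qed
    finally show ?thesis .
  qed
  then show "solution A n v" using hd(2) by (simp add: solution_def)
  have "momentum j v 0 = (\<Sum>c\<in>S. exp_poly c M (\<lambda>m. geo c (shift m (x c)) j) 0)"
    unfolding momentum_def by (subst hd(1)) (simp_all only: atLeast_iff order_refl minus_i_power_i_power)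
  also have "\<dots> = (\<Sum>c\<in>S. geo c (x c) j)"
  proof (rule sum.cong[OF refl])
    fix c assume "c \<in> S"
    have "exp_poly c M (\<lambda>m. geo c (shift m (x c)) j) 0 = geo c (shift 0 (x c)) j"
    proof (rule exp_poly_at_0)
      fix m assume "M \<le> m"
      then have "shift m (x c) = (\<lambda>_. 0)" using fin by (auto simp: shift_def)
      then show "geo c (shift m (x c)) j = 0" by simp
    qed
    then show "exp_poly c M (\<lambda>m. geo c (shift m (x c)) j) 0 = geo c (x c) j" by simp
  qed
  finally show "momentum j v 0 = (\<Sum>c\<in>S. geo c (x c) j)" .
qed

end

context regular_pencil
begin

text \<open>An energy estimate in the manner of Gronwall gives uniqueness for the full initial value problem.\<close>

lemma solution_eq_0:
  assumes u: "solution A n u" and zero: "\<And>j. j < n \<Longrightarrow> momentum j u 0 = 0" and t: "0 \<le> t"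
  shows "u t = 0"
proof (cases "n = 0")
  case True
  then have "A n (u t) = 0" using momentum_equation[OF u t] by (simp add: momentum_def higher_deriv_on_0)
  then show ?thesis by (rule leading_inj)
next
  case False
  obtain \<kappa> where \<kappa>: "\<kappa> > 0" "\<And>x. \<kappa> * norm x \<le> norm (A n x)"
    using clinear_inj_lower_bound[OF lin[OF order_refl] leading_inj] by metis
  obtain C where C: "\<And>k x. k \<le> n \<Longrightarrow> norm (A k x) \<le> C k * norm x" "\<And>k. k \<le> n \<Longrightarrow> 0 \<le> C k"
    by (rule coefficients_bounded) blast
  define d where "d j t = momentum j u t" for j t
  define E where "E t = (\<Sum>j<n. (norm (d j t))\<^sup>2)" for t
  have dE: "norm (d j t) * norm (d k t) \<le> E t" if "j < n" "k < n" for j k t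
  proof -
    have "norm (d i t) \<le> sqrt (E t)" if "i < n" for i
      using that by (intro real_le_rsqrt) (auto simp: E_def intro!: member_le_sum)
    then have "norm (d j t) * norm (d k t) \<le> sqrt (E t) * sqrt (E t)"
      using that by (intro mult_mono) (auto simp: E_def sum_nonneg)
    then show ?thesis by (simp add: E_def sum_nonneg)
  qed
  define K0 where "K0 = (\<Sum>k<n. C k) / \<kappa>"
  have K0: "0 \<le> K0" unfolding K0_def using C(2) \<kappa>(1) by (intro divide_nonneg_pos sum_nonneg) auto
  have top: "norm (d n t) * norm (d j t) \<le> K0 * E t" if t: "0 \<le> t" and j: "j < n" for j t
  proof -
    have "A n (d n t) = - (\<Sum>k<n. A k (d k t))"
      using momentum_equation[OF u t] by (simp add: d_def lessThan_Suc_atMost[symmetric] eq_neg_iff_add_eq_0 add.commute)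
    then have "\<kappa> * norm (d n t) \<le> (\<Sum>k<n. C k * norm (d k t))"
      using \<kappa>(2)[of "d n t"] C(1) by (auto intro!: order_trans[OF \<kappa>(2)] sum_norm_le)
    then have "(\<kappa> * norm (d n t)) * norm (d j t) \<le> (\<Sum>k<n. C k * norm (d k t)) * norm (d j t)"
      by (rule mult_right_mono) simp
    also have "\<dots> = (\<Sum>k<n. C k * (norm (d k t) * norm (d j t)))" by (simp add: sum_distrib_right mult.assoc)
    also have "\<dots> \<le> (\<Sum>k<n. C k * E t)" using dE j C(2) by (intro sum_mono mult_left_mono) auto
    also have "\<dots> = (\<Sum>k<n. C k) * E t" by (rule sum_distrib_right[symmetric])
    finally show ?thesis using \<kappa>(1) by (simp add: K0_def field_simps)
  qed
  define K where "K = 2 * real n * (1 + K0)"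
  have deriv: "\<exists>E'. (E has_real_derivative E') (at t within {0..}) \<and> E' \<le> K * E t" if t: "0 \<le> t" for t
  proof (intro exI conjI)
    let ?E' = "\<Sum>j<n. 2 * Re (cinner (\<i> *\<^sub>C d (Suc j) t) (d j t))"
    have "((\<lambda>t. (norm (d j t))\<^sup>2) has_vector_derivative 2 * Re (cinner (\<i> *\<^sub>C d (Suc j) t) (d j t))) (at t within {0..})"
      if "j < n" for j
    proof -
      have dj: "(d j has_vector_derivative \<i> *\<^sub>C d (Suc j) t) (at t within {0..})"
        unfolding d_def[abs_def] by (rule momentum_has_vector_derivative[OF u that t])
      have "((\<lambda>t. Re (cinner (d j t) (d j t))) has_vector_derivative
          Re (cinner (d j t) (\<i> *\<^sub>C d (Suc j) t) + cinner (\<i> *\<^sub>C d (Suc j) t) (d j t))) (at t within {0..})"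
        by (intro bounded_linear.has_vector_derivative[OF bounded_linear_Re]
            bounded_bilinear.has_vector_derivative[OF bounded_bilinear_cinner] dj)
      moreover have "Re (cinner (d j t) (\<i> *\<^sub>C d (Suc j) t)) = Re (cinner (\<i> *\<^sub>C d (Suc j) t) (d j t))"
        using cinner_commute[of "d j t" "\<i> *\<^sub>C d (Suc j) t"] by simp
      moreover have "(\<lambda>t. Re (cinner (d j t) (d j t))) = (\<lambda>t. (norm (d j t))\<^sup>2)" by (simp add: cinner_self)
      ultimately show ?thesis by simp
    qed
    then have "((\<lambda>t. \<Sum>j<n. (norm (d j t))\<^sup>2) has_vector_derivative ?E') (at t within {0..})"
      by (intro has_vector_derivative_sum) auto
    then show "(E has_real_derivative ?E') (at t within {0..})"
      unfolding has_real_derivative_iff_has_vector_derivative E_def[abs_def] .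
    have "2 * Re (cinner (\<i> *\<^sub>C d (Suc j) t) (d j t)) \<le> 2 * ((1 + K0) * E t)" if j: "j < n" for j
    proof -
      have "Re (cinner (\<i> *\<^sub>C d (Suc j) t) (d j t)) \<le> norm (d (Suc j) t) * norm (d j t)"
        using norm_cinner_le[of "\<i> *\<^sub>C d (Suc j) t" "d j t"] complex_Re_le_cmod[of "cinner (\<i> *\<^sub>C d (Suc j) t) (d j t)"] by simp
      also have "\<dots> \<le> (1 + K0) * E t"
      proof (cases "Suc j = n")
        case True
        have "0 \<le> E t" by (simp add: E_def sum_nonneg)
        then show ?thesis using top[OF t j] True by (simp add: distrib_right)
      next
        case False
        have "0 \<le> K0 * E t" using K0 by (simp add: E_def sum_nonneg)
        then show ?thesis using dE[of "Suc j" j t] False j by (simp add: distrib_right)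
      qed
      finally show ?thesis by simp
    qed
    then have "?E' \<le> (\<Sum>j<n. 2 * ((1 + K0) * E t))" by (intro sum_mono) auto
    then show "?E' \<le> K * E t" by (simp add: K_def mult_ac)
  qed
  have "E t * exp (- K * t) \<le> E 0 * exp (- K * 0)"
  proof (cases "t = 0")
    case False
    show ?thesis
    proof (rule DERIV_nonpos_imp_decreasing_open[where f = "\<lambda>t. E t * exp (- K * t)"])
      show "0 \<le> t" using t .
      show "continuous_on {0..t} (\<lambda>t. E t * exp (- K * t))"
      proof (intro continuous_intros)
        have "continuous_on {0..} E" using deriv by (meson DERIV_continuous_on atLeast_iff)
        then show "continuous_on {0..t} E" by (rule continuous_on_subset) auto
      qed
      fix r assume r: "0 < r" "r < t"
      obtain E' where E': "(E has_real_derivative E') (at r within {0..})" "E' \<le> K * E r" using deriv[of r] r by auto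
      have "at r within {0..} = at r" using r by (intro at_within_interior) auto
      then have "((\<lambda>t. E t * exp (- K * t)) has_real_derivative (E' - K * E r) * exp (- K * r)) (at r)"
        using E'(1) by (auto intro!: derivative_eq_intros simp: algebra_simps)
      moreover have "(E' - K * E r) * exp (- K * r) \<le> 0" using E'(2) by (simp add: mult_nonpos_nonneg)
      ultimately show "\<exists>D. ((\<lambda>t. E t * exp (- K * t)) has_real_derivative D) (at r) \<and> D \<le> 0" by blast
    qed
  qed simp
  moreover have "E 0 = 0" using zero by (simp add: E_def d_def)
  ultimately have "E t * exp (- K * t) \<le> 0" by simp
  then have "E t \<le> 0" by (simp add: mult_le_0_iff not_le[symmetric])
  then have "(\<Sum>j<n. (norm (d j t))\<^sup>2) = 0" unfolding E_def by (intro antisym) (auto simp: sum_nonneg)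
  then have "d 0 t = 0" using False by (simp add: sum_nonneg_eq_0_iff)
  then show ?thesis by (simp add: d_def momentum_def higher_deriv_on_0)
qed

text \<open>
  Along a solution the function \<open>exp (-\<i>zt) A(z)\<^sup>-\<^sup>1 numer\<close> has derivative \<open>-\<i> exp (-\<i>zt) u(t)\<close>; for a
  decaying solution this bounds the resolvent of its numerator in the open lower half plane, without
  Laplace integrals.
\<close>

lemma decaying_solution_bound:
  assumes u: "solution A n u" and lim: "\<And>j. j < n \<Longrightarrow> ((\<lambda>t. momentum j u t) \<longlongrightarrow> 0) at_top"
    and n0: "0 < n" and \<epsilon>: "\<epsilon> > 0"
  obtains K where "K \<ge> 0" "\<And>z U. Im z < 0 \<Longrightarrow> \<not> eigenvalue (pencil A n) z \<Longrightarrow>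
    pencil A n z U = numer A n (\<lambda>j. momentum j u 0) z \<Longrightarrow> norm U \<le> K + \<epsilon> / (- Im z)"
proof -
  define d where "d j t = momentum j u t" for j t
  have d_deriv: "(d j has_vector_derivative \<i> *\<^sub>C d (Suc j) t) (at t within {0..})" if "j < n" "0 \<le> t" for j t
    unfolding d_def[abs_def] by (rule momentum_has_vector_derivative[OF u that])
  have "eventually (\<lambda>t. norm (d 0 t) < \<epsilon>) at_top"
    using order_tendstoD(2)[OF tendsto_norm[OF lim[OF n0]], of \<epsilon>] \<epsilon> by (simp add: d_def)
  then obtain T0 where T0: "\<And>t. t \<ge> T0 \<Longrightarrow> norm (d 0 t) < \<epsilon>" by (auto simp: eventually_at_top_linorder)
  define T where "T = max T0 1"
  have T: "T > 0" "\<And>t. t \<ge> T \<Longrightarrow> norm (d 0 t) \<le> \<epsilon>" using T0 by (auto simp: T_def less_imp_le)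
  have cont: "continuous_on {0..} (d 0)"
    using d_deriv[OF n0] by (meson atLeast_iff continuous_on_eq_continuous_within has_vector_derivative_continuous)
  have "compact (d 0 ` {0..T})"
    by (rule compact_continuous_image[OF continuous_on_subset[OF cont]]) auto
  then obtain C where C: "\<And>t. 0 \<le> t \<Longrightarrow> t \<le> T \<Longrightarrow> norm (d 0 t) \<le> C"
    by (metis (no_types, lifting) atLeastAtMost_iff bounded_iff compact_imp_bounded imageI)
  have C0: "0 \<le> C" using C[of 0] T(1) norm_ge_zero[of "d 0 0"] by linarith
  show ?thesis
  proof (rule that[of "C * T"])
    show "0 \<le> C * T" using C0 T(1) by simp
    fix z U assume z: "Im z < 0" and ne: "\<not> eigenvalue (pencil A n) z"
      and U: "pencil A n z U = numer A n (\<lambda>j. momentum j u 0) z"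
    define \<eta> where "\<eta> = - Im z"
    have \<eta>: "\<eta> > 0" using z by (simp add: \<eta>_def)
    obtain V where V: "clinear V" "\<And>x. V (pencil A n z x) = x"
      using clinear_inj_inverse[OF pencil_clinear] ne unfolding eigenvalue_def by metis
    define Q where "Q t = numer A n (\<lambda>j. d j t) z" for t
    define \<psi> where "\<psi> t = exp (- \<i> * z * of_real t) *\<^sub>C V (Q t)" for t
    have norm_exp: "norm (exp (- \<i> * z * of_real t)) = exp (- \<eta> * t)" for t
      by (simp add: \<eta>_def)
    have \<psi>': "(\<psi> has_vector_derivative exp (- \<i> * z * of_real t) *\<^sub>C (- \<i> *\<^sub>C d 0 t)) (at t within {0..})"
      if t: "0 \<le> t" for t
    proof -
      have E: "((\<lambda>t. exp (- \<i> * z * of_real t)) has_vector_derivative - \<i> * z * exp (- \<i> * z * of_real t)) (at t within {0..})"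
        by (auto intro!: derivative_eq_intros has_vector_derivative_real_field)
      define Q' where "Q' = numer A n (\<lambda>j. \<i> *\<^sub>C d (Suc j) t) z"
      have "(Q has_vector_derivative Q') (at t within {0..})"
        unfolding Q_def[abs_def] Q'_def numer_def
      proof (intro has_vector_derivative_sum)
        fix k assume "k \<in> {..n}"
        then have k: "k \<le> n" by simp
        show "((\<lambda>t. A k (\<Sum>j<k. z ^ (k - 1 - j) *\<^sub>C d j t)) has_vector_derivative
            A k (\<Sum>j<k. z ^ (k - 1 - j) *\<^sub>C (\<i> *\<^sub>C d (Suc j) t))) (at t within {0..})"
          using k by (intro bounded_linear.has_vector_derivative[OF clinear_bounded_linear[OF lin[OF k]]] has_vector_derivative_sum
              bounded_linear.has_vector_derivative[OF bounded_bilinear.bounded_linear_right[OF bounded_bilinear_scaleC]]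
              d_deriv t) auto
      qed
      then have VQ: "((\<lambda>t. V (Q t)) has_vector_derivative V Q') (at t within {0..})"
        by (rule bounded_linear.has_vector_derivative[OF clinear_bounded_linear[OF V(1)]])
      have "Q' + (- \<i> * z) *\<^sub>C Q t = - \<i> *\<^sub>C pencil A n z (d 0 t)"
      proof -
        have "(\<Sum>j<k. z ^ (k - 1 - j) *\<^sub>C (\<i> *\<^sub>C d (Suc j) t)) + (- \<i> * z) *\<^sub>C (\<Sum>j<k. z ^ (k - 1 - j) *\<^sub>C d j t) =
            \<i> *\<^sub>C d k t - \<i> *\<^sub>C (z ^ k *\<^sub>C d 0 t)" for k
        proof -
          have "(\<Sum>j<k. z ^ (k - 1 - j) *\<^sub>C (\<i> *\<^sub>C d (Suc j) t)) + (- \<i> * z) *\<^sub>C (\<Sum>j<k. z ^ (k - 1 - j) *\<^sub>C d j t) =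
              (\<Sum>j<k. \<i> *\<^sub>C (z ^ (k - Suc j) *\<^sub>C d (Suc j) t) - \<i> *\<^sub>C (z ^ (k - j) *\<^sub>C d j t))"
            unfolding complex_vector.scale_sum_right sum.distrib[symmetric]
          proof (rule sum.cong[OF refl])
            fix j assume "j \<in> {..<k}"
            then have "z ^ (k - j) = z * z ^ (k - 1 - j)" by (simp flip: power_Suc add: Suc_diff_Suc)
            then show "z ^ (k - 1 - j) *\<^sub>C \<i> *\<^sub>C d (Suc j) t + (- \<i> * z) *\<^sub>C z ^ (k - 1 - j) *\<^sub>C d j t =
                \<i> *\<^sub>C z ^ (k - Suc j) *\<^sub>C d (Suc j) t - \<i> *\<^sub>C z ^ (k - j) *\<^sub>C d j t"
              by (simp add: scaleC_scaleC mult_ac complex_vector.scale_minus_left)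
          qed
          also have "\<dots> = \<i> *\<^sub>C (z ^ (k - k) *\<^sub>C d k t) - \<i> *\<^sub>C (z ^ (k - 0) *\<^sub>C d 0 t)"
            by (rule sum_lessThan_telescope)
          finally show ?thesis by simp
        qed
        note telescope = this
        have "Q' + (- \<i> * z) *\<^sub>C Q t = (\<Sum>k\<le>n. A k ((\<Sum>j<k. z ^ (k - 1 - j) *\<^sub>C (\<i> *\<^sub>C d (Suc j) t)) +
            (- \<i> * z) *\<^sub>C (\<Sum>j<k. z ^ (k - 1 - j) *\<^sub>C d j t)))"
          unfolding Q'_def Q_def numer_def complex_vector.scale_sum_right[of _ _ "{..n}"] sum.distrib[symmetric]
          by (rule sum.cong[OF refl]) (simp only: A_rules(1,2) atMost_iff)
        also have "\<dots> = (\<Sum>k\<le>n. \<i> *\<^sub>C A k (d k t) - \<i> *\<^sub>C (z ^ k *\<^sub>C A k (d 0 t)))"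
          unfolding telescope by (rule sum.cong[OF refl]) (simp only: A_rules(2,5) atMost_iff)
        also have "\<dots> = \<i> *\<^sub>C (\<Sum>k\<le>n. A k (d k t)) - \<i> *\<^sub>C pencil A n z (d 0 t)"
          by (simp only: sum_subtractf complex_vector.scale_sum_right pencil_def)
        also have "(\<Sum>k\<le>n. A k (d k t)) = 0" using momentum_equation[OF u t] by (simp add: d_def)
        finally show ?thesis by (simp add: complex_vector.scale_minus_left)
      qed
      then have "V Q' + (- \<i> * z) *\<^sub>C V (Q t) = - \<i> *\<^sub>C d 0 t"
        by (metis V(2) clinear_rules(1,2)[OF V(1)])
      moreover have "(\<psi> has_vector_derivative exp (- \<i> * z * of_real t) *\<^sub>C V Q' + (- \<i> * z * exp (- \<i> * z * of_real t)) *\<^sub>C V (Q t)) (at t within {0..})"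
        unfolding \<psi>_def[abs_def] by (rule has_vector_derivative_scaleC[OF E VQ])
      moreover have "exp (- \<i> * z * of_real t) *\<^sub>C V Q' + (- \<i> * z * exp (- \<i> * z * of_real t)) *\<^sub>C V (Q t) =
          exp (- \<i> * z * of_real t) *\<^sub>C (V Q' + (- \<i> * z) *\<^sub>C V (Q t))"
        by (simp only: scaleC_add_right scaleC_scaleC mult.commute)
      ultimately show ?thesis by simp
    qed
    have cont\<psi>: "continuous_on {0..} \<psi>"
      using \<psi>' by (meson atLeast_iff continuous_on_eq_continuous_within has_vector_derivative_continuous)
    have \<psi>'_at: "(\<psi> has_vector_derivative exp (- \<i> * z * of_real t) *\<^sub>C (- \<i> *\<^sub>C d 0 t)) (at t)" if "0 < t" for t
    proof -
      have "at t within {0..} = at t" using that by (intro at_within_interior) auto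
      then show ?thesis using \<psi>'[of t] that by simp
    qed
    have step1: "norm (\<psi> T - \<psi> 0) \<le> C * T - C * 0"
    proof (rule differentiable_bound_general[OF T(1)])
      show "continuous_on {0..T} \<psi>" by (rule continuous_on_subset[OF cont\<psi>]) auto
      show "continuous_on {0..T} (\<lambda>t. C * t)" by (intro continuous_intros)
      fix t assume t: "0 < t" "t < T"
      show "(\<psi> has_vector_derivative exp (- \<i> * z * of_real t) *\<^sub>C (- \<i> *\<^sub>C d 0 t)) (at t)" by (rule \<psi>'_at[OF t(1)])
      show "((\<lambda>t. C * t) has_vector_derivative C) (at t)"
        unfolding has_real_derivative_iff_has_vector_derivative[symmetric] by (auto intro!: derivative_eq_intros)
      have "exp (- \<eta> * t) * norm (d 0 t) \<le> 1 * C"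
        using \<eta> t C[of t] by (intro mult_mono) auto
      then show "norm (exp (- \<i> * z * of_real t) *\<^sub>C (- \<i> *\<^sub>C d 0 t)) \<le> C" by (simp only: norm_scaleC norm_exp) simp
    qed
    have step2: "norm (\<psi> t - \<psi> T) \<le> \<epsilon> / \<eta>" if t: "T < t" for t
    proof -
      have "norm (\<psi> t - \<psi> T) \<le> (- (\<epsilon> / \<eta>) * exp (- \<eta> * t)) - (- (\<epsilon> / \<eta>) * exp (- \<eta> * T))"
      proof (rule differentiable_bound_general[OF t])
        show "continuous_on {T..t} \<psi>" by (rule continuous_on_subset[OF cont\<psi>]) (use T(1) in auto)
        show "continuous_on {T..t} (\<lambda>t. - (\<epsilon> / \<eta>) * exp (- \<eta> * t))" by (intro continuous_intros)
        fix r assume r: "T < r" "r < t"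
        show "(\<psi> has_vector_derivative exp (- \<i> * z * of_real r) *\<^sub>C (- \<i> *\<^sub>C d 0 r)) (at r)" using r T(1) by (intro \<psi>'_at) simp
        show "((\<lambda>t. - (\<epsilon> / \<eta>) * exp (- \<eta> * t)) has_vector_derivative \<epsilon> * exp (- \<eta> * r)) (at r)"
          unfolding has_real_derivative_iff_has_vector_derivative[symmetric] using \<eta> by (auto intro!: derivative_eq_intros)
        have "exp (- \<eta> * r) * norm (d 0 r) \<le> exp (- \<eta> * r) * \<epsilon>" using T(2)[of r] r by (intro mult_left_mono) auto
        then show "norm (exp (- \<i> * z * of_real r) *\<^sub>C (- \<i> *\<^sub>C d 0 r)) \<le> \<epsilon> * exp (- \<eta> * r)"
          by (simp only: norm_scaleC norm_exp) (simp add: mult.commute)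
      qed
      also have "\<dots> \<le> \<epsilon> / \<eta>"
      proof -
        have "(\<epsilon> / \<eta>) * exp (- \<eta> * T) \<le> (\<epsilon> / \<eta>) * 1" using \<epsilon> \<eta> T(1) by (intro mult_left_mono) auto
        moreover have "0 \<le> (\<epsilon> / \<eta>) * exp (- \<eta> * t)" using \<epsilon> \<eta> by simp
        ultimately show ?thesis by linarith
      qed
      finally show ?thesis .
    qed
    have \<psi>_lim: "(\<psi> \<longlongrightarrow> 0) at_top"
    proof -
      have "(Q \<longlongrightarrow> (\<Sum>k\<le>n. A k (\<Sum>j<k. z ^ (k - 1 - j) *\<^sub>C 0))) at_top"
        unfolding Q_def[abs_def] numer_def
      proof (intro tendsto_sum)
        fix k assume "k \<in> {..n}"
        then have k: "k \<le> n" by simp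
        show "((\<lambda>t. A k (\<Sum>j<k. z ^ (k - 1 - j) *\<^sub>C d j t)) \<longlongrightarrow> A k (\<Sum>j<k. z ^ (k - 1 - j) *\<^sub>C 0)) at_top"
          using k lim unfolding d_def
          by (intro bounded_linear.tendsto[OF clinear_bounded_linear[OF lin[OF k]]] tendsto_intros) auto
      qed
      then have "((\<lambda>t. V (Q t)) \<longlongrightarrow> V 0) at_top"
        by (intro bounded_linear.tendsto[OF clinear_bounded_linear[OF V(1)]]) (simp add: A_rules)
      then have "((\<lambda>t. norm (V (Q t))) \<longlongrightarrow> 0) at_top" by (simp add: clinear_rules[OF V(1)] tendsto_norm_zero)
      moreover have "eventually (\<lambda>t. norm (\<psi> t) \<le> norm (V (Q t))) at_top"
        using eventually_ge_at_top[of 0]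
      proof eventually_elim
        case (elim t)
        have "norm (\<psi> t) = exp (- \<eta> * t) * norm (V (Q t))" by (simp only: \<psi>_def norm_scaleC norm_exp)
        also have "\<dots> \<le> 1 * norm (V (Q t))" using elim \<eta> by (intro mult_right_mono) auto
        finally show ?case by simp
      qed
      ultimately show ?thesis by (rule Lim_null_comparison[rotated])
    qed
    have "((\<lambda>t. norm (\<psi> 0 - \<psi> t)) \<longlongrightarrow> norm (\<psi> 0 - 0)) at_top" by (intro tendsto_intros \<psi>_lim)
    moreover have "eventually (\<lambda>t. norm (\<psi> 0 - \<psi> t) \<le> C * T + \<epsilon> / \<eta>) at_top"
      using eventually_gt_at_top[of T]
    proof eventually_elim
      case (elim t)
      have "norm (\<psi> 0 - \<psi> t) \<le> norm (\<psi> T - \<psi> 0) + norm (\<psi> t - \<psi> T)"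
        using norm_triangle_ineq[of "\<psi> 0 - \<psi> T" "\<psi> T - \<psi> t"] by (simp add: norm_minus_commute)
      then show ?case using step1 step2[OF elim] by simp
    qed
    ultimately have "norm (\<psi> 0) \<le> C * T + \<epsilon> / \<eta>" by (intro tendsto_upperbound[of _ _ at_top]) auto
    moreover have "\<psi> 0 = U" using U V(2)[of U] by (simp add: \<psi>_def Q_def d_def)
    ultimately show "norm U \<le> C * T + \<epsilon> / (- Im z)" by (simp add: \<eta>_def)
  qed
qed

end


section \<open>Existence and uniqueness\<close>

lemma exp_poly_tendsto_0:
  assumes "0 < Im c"
  shows "(exp_poly c M \<xi> \<longlongrightarrow> 0) at_top"
proof -
  have "((\<lambda>t. exp (\<i> * c * of_real t) * ((\<i> * of_real t) ^ m / fact m)) \<longlongrightarrow> 0) at_top" for m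
  proof (rule tendsto_norm_zero_cancel)
    have "((\<lambda>t. (Im c * t) ^ m / exp (Im c * t)) \<longlongrightarrow> 0) at_top"
      by (rule filterlim_compose[OF tendsto_power_div_exp_0])
        (use assms in \<open>auto intro!: filterlim_tendsto_pos_mult_at_top filterlim_ident\<close>)
    then have "((\<lambda>t. (1 / (Im c ^ m * fact m)) * ((Im c * t) ^ m / exp (Im c * t))) \<longlongrightarrow> (1 / (Im c ^ m * fact m)) * 0) at_top"
      by (intro tendsto_intros)
    moreover have "eventually (\<lambda>t. (1 / (Im c ^ m * fact m)) * ((Im c * t) ^ m / exp (Im c * t)) =
        norm (exp (\<i> * c * of_real t) * ((\<i> * of_real t) ^ m / fact m))) at_top"
      using eventually_gt_at_top[of 0]
    proof eventually_elim
      case (elim t)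
      have "norm (exp (\<i> * c * of_real t)) = 1 / exp (Im c * t)" by (simp add: exp_minus field_simps)
      then show ?case using elim assms by (simp add: norm_mult norm_divide norm_power power_mult_distrib)
    qed
    ultimately show "((\<lambda>t. norm (exp (\<i> * c * of_real t) * ((\<i> * of_real t) ^ m / fact m))) \<longlongrightarrow> 0) at_top"
      by (simp add: tendsto_cong)
  qed
  then have "((\<lambda>t. \<Sum>m<M. (exp (\<i> * c * of_real t) * ((\<i> * of_real t) ^ m / fact m)) *\<^sub>C \<xi> m) \<longlongrightarrow> (\<Sum>m<M. 0 *\<^sub>C \<xi> m)) at_top"
    by (intro tendsto_intros)
  then show ?thesis by (simp add: exp_poly_def[abs_def] complex_vector.scale_sum_right scaleC_scaleC)
qed

text \<open>
  A choice of root sequences and adjoint systems. The number \<open>M\<close> is at least the length of every chain in question, so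
  that it serves as the common cutoff in all sums.
\<close>

locale decomposed_pencil = radiation_pencil +
  fixes S :: "complex set" and M :: nat and R :: "(nat \<Rightarrow> 'a) \<Rightarrow> complex \<Rightarrow> nat \<Rightarrow> 'a"
    and z :: "real \<Rightarrow> nat \<Rightarrow> nat \<Rightarrow> 'a"
  assumes finite_S: "finite S"
    and eigenvalue_S: "\<And>c. eigenvalue (pencil A n) c \<Longrightarrow> c \<in> S"
    and R_root: "\<And>y c. recurrence A n y \<Longrightarrow> root_seq A n c (R y c)"
    and R_high: "\<And>y c m. recurrence A n y \<Longrightarrow> m \<ge> M \<Longrightarrow> R y c m = 0"
    and R_sum: "\<And>y j. recurrence A n y \<Longrightarrow> y j = (\<Sum>c\<in>S. geo c (R y c) j)"
    and R_add: "\<And>y y' c m. R (\<lambda>j. y j + y' j) c m = R y c m + R y' c m"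
    and R_scaleC: "\<And>a y c m. R (\<lambda>j. a *\<^sub>C y j) c m = a *\<^sub>C R y c m"
    and adjoint: "\<And>c. eigenvalue (pencil A n) (of_real c) \<Longrightarrow>
      adjoint_canonical_system (pencil A n) (of_real c) (N c) (p c) (w c) (z c)"
    and M_large: "\<And>c k. eigenvalue (pencil A n) (of_real c) \<Longrightarrow> k \<in> {1..N c} \<Longrightarrow> p c k < M"
begin

lemma R_diff: "R (\<lambda>j. y j - y' j) c m = R y c m - R y' c m"
proof -
  have "(\<lambda>j. y j - y' j) = (\<lambda>j. y j + (-1) *\<^sub>C y' j)" by (simp add: complex_vector.scale_minus_left)
  then show ?thesis by (simp only: R_add R_scaleC) (simp add: complex_vector.scale_minus_left)
qed

text \<open>
  By \<open>R_real\<close> these are the coefficients of a solution in the elementary solutions of a real eigenvalue. The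
  formula makes them linear in \<open>y\<close>.
\<close>

definition coef :: "(nat \<Rightarrow> 'a) \<Rightarrow> real \<Rightarrow> nat \<Rightarrow> nat \<Rightarrow> complex" where
  "coef y c k h = conv (recenter (of_real c) n (numer_coeff A n y)) (z c k) (p c k - h)"

lemma coef_add: "coef (\<lambda>j. y j + y' j) c k h = coef y c k h + coef y' c k h"
  by (simp add: coef_def conv_def recenter_def numer_coeff_add cinner_sum_left cinner_scaleC_left
      cinner_add_left scaleC_add_right sum.distrib distrib_left)

lemma coef_scaleC: "coef (\<lambda>j. a *\<^sub>C y j) c k h = a * coef y c k h"
  by (simp add: coef_def conv_def recenter_def numer_coeff_scaleC cinner_sum_left cinner_scaleC_left
      sum_distrib_left mult_ac)

lemma coef_diff: "coef (\<lambda>j. y j - y' j) c k h = coef y c k h - coef y' c k h"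
proof -
  have "(\<lambda>j. y j - y' j) = (\<lambda>j. y j + (-1) *\<^sub>C y' j)" by (simp add: complex_vector.scale_minus_left)
  then show ?thesis by (simp only: coef_add coef_scaleC) simp
qed

lemma R_real:
  assumes y: "recurrence A n y" and eig: "eigenvalue (pencil A n) (of_real c)"
  shows "R y (of_real c) = chain_comb (N c) (p c) (w c) (coef y c)"
proof
  fix m
  show "R y (of_real c) m = chain_comb (N c) (p c) (w c) (coef y c) m"
  proof (cases "m < M")
    case True
    obtain \<delta>1 K where \<delta>1: "\<delta>1 > 0" "\<And>b. dist b (of_real c) < \<delta>1 \<Longrightarrow> norm (partial_fraction (S - {of_real c}) M (R y) b) \<le> K"
      using isCont_bounded_near[OF partial_fraction_continuous[of "of_real c" "S - {of_real c}" M "R y"]] by blast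
    obtain \<delta>2 where \<delta>2: "\<delta>2 > 0" "\<And>b. b \<in> S \<Longrightarrow> b \<noteq> of_real c \<Longrightarrow> \<delta>2 \<le> dist (of_real c) b"
      using finite_set_avoid[OF finite_S, of "of_real c"] by blast
    let ?q = "recenter (of_real c) n (numer_coeff A n y)"
    have "R y (of_real c) m = chain_comb (N c) (p c) (w c) (\<lambda>k h. conv ?q (z c k) (p c k - h)) m"
    proof (rule principal_part_coefficients[OF adjoint[OF eig], where \<delta> = "min \<delta>1 \<delta>2" and D = n and M = M and K = K
          and B = "\<lambda>t. partial_fraction (S - {of_real c}) M (R y) (of_real c + of_real t)"])
      fix t :: real assume t: "0 < t" "t < min \<delta>1 \<delta>2"
      have d: "dist (of_real c + of_real t) (of_real c :: complex) = t" "dist (of_real c :: complex) (of_real c + of_real t) = t"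
        using t by (auto simp: dist_norm)
      have nS: "of_real c + of_real t \<notin> S" using \<delta>2(2)[of "of_real c + of_real t"] d t by auto
      have "pencil A n (of_real c + of_real t) (partial_fraction S M (R y) (of_real c + of_real t)) = numer A n y (of_real c + of_real t)"
        using pencil_partial_fraction[OF nS R_root[OF y] R_high[OF y]] by (simp flip: R_sum[OF y])
      also have "\<dots> = vpoly n ?q (of_real t)"
        using vpoly_recenter[of n "numer_coeff A n y" "of_real c + of_real t" "of_real c"] by (simp add: numer_vpoly)
      finally show "pencil A n (of_real c + of_real t) (pole_part (of_real c) M (R y (of_real c)) (of_real c + of_real t) +
          partial_fraction (S - {of_real c}) M (R y) (of_real c + of_real t)) = vpoly n ?q (of_real t)"
        using partial_fraction_split[OF finite_S, of M "R y" "of_real c + of_real t" "of_real c"] eigenvalue_S[OF eig] by simp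
      show "norm (partial_fraction (S - {of_real c}) M (R y) (of_real c + of_real t)) \<le> K"
        using \<delta>1(2) d t by simp
    qed (use \<delta>1(1) \<delta>2(1) recenter_high M_large[OF eig] True in auto)
    then show ?thesis by (simp only: coef_def[abs_def])
  next
    case False
    have "rev_chain (w c k) h m = 0" if "k \<in> {1..N c}" "h \<le> p c k" for k h
      using M_large[OF eig that(1)] that(2) False by (auto simp: rev_chain_def)
    then have "chain_comb (N c) (p c) (w c) (coef y c) m = 0" by (auto simp: chain_comb_def intro!: sum.neutral)
    then show ?thesis using R_high[OF y] False by simp
  qed
qed

lemma R_non_eigenvalue: "recurrence A n y \<Longrightarrow> \<not> eigenvalue (pencil A n) c \<Longrightarrow> R y c = (\<lambda>_. 0)"
  using root_seq_eq_0[OF R_root R_high] by blast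

lemma chain_comb_root_seq:
  assumes "eigenvalue (pencil A n) (of_real c)"
  shows "root_seq A n (of_real c) (chain_comb (N c) (p c) (w c) a)"
  unfolding chain_comb_def[abs_def]
  by (intro root_seq_sum root_seq_scaleC chain_root_seq[OF chains[OF assms]]) auto

lemma chain_comb_high:
  assumes "eigenvalue (pencil A n) (of_real c)" "M \<le> m"
  shows "chain_comb (N c) (p c) (w c) a m = 0"
  unfolding chain_comb_def
proof (intro sum.neutral ballI)
  fix k h assume "k \<in> {1..N c}" "h \<in> {..p c k}"
  then show "a k h *\<^sub>C rev_chain (w c k) h m = 0" using M_large[OF assms(1), of k] assms(2) by (auto simp: rev_chain_def)
qed

text \<open>
  The data of solutions that satisfy the radiation principle, as shown by \<open>outgoing_radiates\<close> and
  \<open>radiates_outgoing\<close>.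
\<close>

definition outgoing :: "(nat \<Rightarrow> 'a) \<Rightarrow> bool" where
  "outgoing y \<longleftrightarrow> recurrence A n y \<and> (\<forall>c. Im c < 0 \<longrightarrow> R y c = (\<lambda>_. 0)) \<and>
     (\<forall>c k h. eigenvalue (pencil A n) (of_real c) \<longrightarrow> k \<in> {1..N c} \<longrightarrow> h \<le> p c k \<longrightarrow> coef y c k h \<noteq> 0 \<longrightarrow>
        int h \<le> (int (p c k) + \<epsilon> c k) div 2)"

lemma outgoing_diff: "outgoing y \<Longrightarrow> outgoing y' \<Longrightarrow> outgoing (\<lambda>j. y j - y' j)"
  unfolding outgoing_def using recurrence_diff[of y y']
  by (auto simp: R_diff[abs_def] coef_diff) (metis diff_0_right)

lemma outgoing_eq_0:
  assumes out: "outgoing y" and half: "\<And>j. j < l \<Longrightarrow> y j = 0" and j: "j < n"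
  shows "y j = 0"
proof -
  have y: "recurrence A n y" using out by (simp add: outgoing_def)
  have "(\<Sum>c\<in>S. geo c (R y c) j) = 0"
  proof (rule half_data_determine[where \<sigma> = 1 and M = M and a = "coef y"])
    show "(\<Sum>c\<in>S. geo c (R y c) j) = 0" if "j < l" for j using half[OF that] R_sum[OF y, of j] by simp
  qed (use finite_S R_root[OF y] R_high[OF y] out R_real[OF y] M_large j in \<open>auto simp: outgoing_def\<close>)
  then show ?thesis using R_sum[OF y, of j] by simp
qed

text \<open>
  The kernel of \<open>reflect\<close> consists of outgoing solutions, and its values are admissible for the opposite
  signs: it keeps the part growing at infinity, drops the decaying part and moves the excluded upper parts of the real
  chains down by \<open>cut\<close>, the number of admitted vectors. As many vectors are excluded as are admitted for the sign
  \<open>-\<epsilon>\<close>, so the upper part fits exactly.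
\<close>

definition cut :: "real \<Rightarrow> nat \<Rightarrow> nat" where
  "cut c k = nat ((int (p c k) + \<epsilon> c k) div 2 + 1)"

definition reflect_coef :: "(nat \<Rightarrow> 'a) \<Rightarrow> real \<Rightarrow> nat \<Rightarrow> nat \<Rightarrow> complex" where
  "reflect_coef y c k h = (if h + cut c k \<le> p c k then coef y c k (h + cut c k) else 0)"

definition reflect_root :: "(nat \<Rightarrow> 'a) \<Rightarrow> complex \<Rightarrow> nat \<Rightarrow> 'a" where
  "reflect_root y c m = (if Im c < 0 then R y c m
     else if Im c = 0 \<and> eigenvalue (pencil A n) c
       then chain_comb (N (Re c)) (p (Re c)) (w (Re c)) (reflect_coef y (Re c)) m
     else 0)"

definition reflect :: "(nat \<Rightarrow> 'a) \<Rightarrow> nat \<Rightarrow> 'a" where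
  "reflect y j = (\<Sum>c\<in>S. geo c (reflect_root y c) j)"

lemma reflect_root_add: "reflect_root (\<lambda>j. y j + y' j) c m = reflect_root y c m + reflect_root y' c m"
proof -
  have "reflect_coef (\<lambda>j. y j + y' j) = (\<lambda>c k h. reflect_coef y c k h + reflect_coef y' c k h)"
    by (simp add: reflect_coef_def coef_add fun_eq_iff)
  then show ?thesis
    by (simp add: reflect_root_def R_add chain_comb_def scaleC_add_left sum.distrib)
qed

lemma reflect_root_scaleC: "reflect_root (\<lambda>j. a *\<^sub>C y j) c m = a *\<^sub>C reflect_root y c m"
proof -
  have "reflect_coef (\<lambda>j. a *\<^sub>C y j) = (\<lambda>c k h. a * reflect_coef y c k h)"
    by (simp add: reflect_coef_def coef_scaleC fun_eq_iff)
  then show ?thesis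
    by (simp add: reflect_root_def R_scaleC chain_comb_def complex_vector.scale_sum_right scaleC_scaleC)
qed

lemma reflect_add: "reflect (\<lambda>j. y j + y' j) j = reflect y j + reflect y' j"
  unfolding reflect_def by (simp add: reflect_root_add[abs_def] geo_add sum.distrib)

lemma reflect_scaleC: "reflect (\<lambda>j. a *\<^sub>C y j) j = a *\<^sub>C reflect y j"
  unfolding reflect_def by (simp add: reflect_root_scaleC[abs_def] geo_scaleC complex_vector.scale_sum_right)

lemma reflect_diff: "reflect (\<lambda>j. y j - y' j) j = reflect y j - reflect y' j"
proof -
  have "(\<lambda>j. y j - y' j) = (\<lambda>j. y j + (-1) *\<^sub>C y' j)" by (simp add: complex_vector.scale_minus_left)
  then show ?thesis by (simp only: reflect_add reflect_scaleC) (simp add: complex_vector.scale_minus_left)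
qed

lemma cut_bounds:
  assumes "eigenvalue (pencil A n) (of_real c)" "k \<in> {1..N c}"
  shows "int (cut c k) = (int (p c k) + \<epsilon> c k) div 2 + 1"
    and "h + cut c k \<le> p c k \<Longrightarrow> int h \<le> (int (p c k) - \<epsilon> c k) div 2"
  using sign_cases[OF assms] unfolding cut_def by (auto elim!: evenE oddE)

lemma reflect_root_root_seq: "recurrence A n y \<Longrightarrow> root_seq A n c (reflect_root y c)"
proof -
  assume y: "recurrence A n y"
  consider "Im c < 0" | "Im c = 0" "eigenvalue (pencil A n) c" | "0 \<le> Im c" "\<not> (Im c = 0 \<and> eigenvalue (pencil A n) c)"
    by linarith
  then show ?thesis
  proof cases
    case 1
    then show ?thesis using R_root[OF y] by (simp add: reflect_root_def[abs_def])
  next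
    case 2
    then have c: "c = of_real (Re c)" by (simp add: complex_eq_iff)
    have "root_seq A n (of_real (Re c)) (chain_comb (N (Re c)) (p (Re c)) (w (Re c)) (reflect_coef y (Re c)))"
      by (rule chain_comb_root_seq) (use 2 c in simp)
    moreover have "reflect_root y c = chain_comb (N (Re c)) (p (Re c)) (w (Re c)) (reflect_coef y (Re c))"
      using 2 by (simp add: reflect_root_def[abs_def])
    ultimately show ?thesis using c by simp
  next
    case 3
    then have "reflect_root y c = (\<lambda>_. 0)" by (auto simp: reflect_root_def[abs_def])
    then show ?thesis by (simp add: root_seq_zero)
  qed
qed

lemma reflect_root_high:
  assumes y: "recurrence A n y" and m: "M \<le> m"
  shows "reflect_root y c m = 0"
proof (cases "Im c = 0 \<and> eigenvalue (pencil A n) c")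
  case True
  then have "eigenvalue (pencil A n) (of_real (Re c))" by (simp add: complex_eq_iff complex_is_Real_iff)
  then show ?thesis using True chain_comb_high m by (simp add: reflect_root_def)
qed (use R_high[OF y m] in \<open>auto simp: reflect_root_def\<close>)

lemma reflect_eq_0_imp_outgoing:
  assumes y: "recurrence A n y" and 0: "\<And>j. j < n \<Longrightarrow> reflect y j = 0"
  shows "outgoing y"
proof -
  have X: "reflect_root y c m = 0" if "c \<in> S" for c m
    using root_decomposition_unique[OF finite_S eigenvalue_S reflect_root_root_seq[OF y] reflect_root_high[OF y] _ that] 0
    by (simp add: reflect_def)
  have "R y c m = 0" if "Im c < 0" for c m
  proof (cases "c \<in> S")
    case True
    then show ?thesis using X[OF True, of m] that by (simp add: reflect_root_def)
  next
    case False
    then show ?thesis using R_non_eigenvalue[OF y] eigenvalue_S by metis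
  qed
  moreover have "int h \<le> (int (p c k) + \<epsilon> c k) div 2"
    if eig: "eigenvalue (pencil A n) (of_real c)" and k: "k \<in> {1..N c}" and h: "h \<le> p c k" and nz: "coef y c k h \<noteq> 0" for c k h
  proof (rule ccontr)
    assume "\<not> ?thesis"
    then have "cut c k \<le> h" using cut_bounds(1)[OF eig k] by linarith
    then have e: "h - cut c k + cut c k = h" by simp
    have "chain_comb (N c) (p c) (w c) (reflect_coef y c) m = 0" for m
      using X[OF eigenvalue_S[OF eig], of m] eig by (simp add: reflect_root_def)
    from chain_comb_unique[OF system[OF eig] this k, of "h - cut c k"]
    have "reflect_coef y c k (h - cut c k) = 0" using h by simp
    then show False using h nz by (simp add: reflect_coef_def e)
  qed
  ultimately show ?thesis using y by (auto simp: outgoing_def)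
qed

lemma reflect_half_eq_0:
  assumes y: "recurrence A n y" and half: "\<And>j. j < l \<Longrightarrow> reflect y j = 0" and j: "j < n"
  shows "reflect y j = 0"
  unfolding reflect_def
proof (rule half_data_determine[where \<sigma> = "-1" and M = M and a = "reflect_coef y"])
  show "reflect_root y c = (\<lambda>_. 0)" if "of_int (- 1) * Im c < 0" for c
    using that by (auto simp: reflect_root_def)
  show "reflect_root y (of_real c) = chain_comb (N c) (p c) (w c) (reflect_coef y c)"
    if "eigenvalue (pencil A n) (of_real c)" for c using that by (simp add: reflect_root_def[abs_def])
  show "int h \<le> (int (p c k) + - 1 * \<epsilon> c k) div 2"
    if "eigenvalue (pencil A n) (of_real c)" "k \<in> {1..N c}" "reflect_coef y c k h \<noteq> 0" for c k h
    using cut_bounds(2)[OF that(1,2), of h] that(3) by (auto simp: reflect_coef_def split: if_splits)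
  show "(\<Sum>c\<in>S. geo c (reflect_root y c) j) = 0" if "j < l" for j using half[OF that] by (simp add: reflect_def)
qed (use finite_S reflect_root_root_seq[OF y] reflect_root_high[OF y] M_large j in auto)

text \<open>
  The solutions with vanishing first half of the data are parametrized by their second half \<open>\<tau>\<close> through \<open>P\<close>, and \<open>\<Theta>\<close> sends \<open>\<tau>\<close>
  to the first half of the reflected solution. If that is zero then the reflected solution is zero, the solution itself is
  outgoing, and so it is zero. Thus \<open>\<Theta>\<close> is injective on a finite-dimensional space, hence onto.
\<close>

lemma outgoing_exists:
  fixes \<phi> :: "nat \<Rightarrow> 'a"
  obtains y where "outgoing y" "\<And>j. j < l \<Longrightarrow> y j = \<phi> j"
proof -
  obtain E :: "'a set" where E: "finite E" "\<And>x. x = (\<Sum>e\<in>E. cinner x e *\<^sub>C e)"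
    using orthonormal_basis by metis
  define B where "B = (\<lambda>(i, e :: 'a). \<lambda>j. if j = i then e else 0) ` ({..<l} \<times> E)"
  have finB: "finite B" using E(1) by (simp add: B_def)
  have span: "y \<in> seqv.span B \<longleftrightarrow> (\<forall>j\<ge>l. y j = 0)" for y :: "nat \<Rightarrow> 'a"
  proof
    have "seqv.subspace {y :: nat \<Rightarrow> 'a. \<forall>j\<ge>l. y j = 0}"
      by (rule seqv.subspaceI) auto
    moreover have "B \<subseteq> {y. \<forall>j\<ge>l. y j = 0}" by (auto simp: B_def)
    ultimately show "y \<in> seqv.span B \<Longrightarrow> \<forall>j\<ge>l. y j = 0" using seqv.span_minimal by blast
  next
    assume y: "\<forall>j\<ge>l. y j = 0"
    have "y = (\<Sum>(i, e)\<in>{..<l} \<times> E. (\<lambda>j. cinner (y i) e *\<^sub>C (if j = i then e else 0)))"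
    proof
      fix j
      have "(\<Sum>(i, e)\<in>{..<l} \<times> E. (\<lambda>j. cinner (y i) e *\<^sub>C (if j = i then e else 0))) j =
          (\<Sum>i<l. \<Sum>e\<in>E. cinner (y i) e *\<^sub>C (if j = i then e else 0))"
        by (simp only: sum_fun_apply case_prod_unfold sum.cartesian_product)
      also have "\<dots> = (\<Sum>i<l. if i = j then \<Sum>e\<in>E. cinner (y i) e *\<^sub>C e else 0)"
        by (intro sum.cong refl) auto
      also have "\<dots> = y j" using E(2)[of "y j"] y by (cases "j < l") auto
      finally show "y j = (\<Sum>(i, e)\<in>{..<l} \<times> E. (\<lambda>j. cinner (y i) e *\<^sub>C (if j = i then e else 0))) j" by simp
    qed
    also have "\<dots> \<in> seqv.span B"
      unfolding case_prod_unfold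
      by (intro seqv.span_sum seqv.span_scale seqv.span_base) (auto simp: B_def)
    finally show "y \<in> seqv.span B" .
  qed
  define P where "P \<tau> = ext (\<lambda>j. if j < l then 0 else \<tau> (j - l))" for \<tau>
  have P_rec: "recurrence A n (P \<tau>)" for \<tau> by (simp add: P_def ext_recurrence)
  have ln: "j < n" "j + l < n" if "j < l" for j using that n_even by auto
  have P_low: "P \<tau> j = 0" if "j < l" for \<tau> j using that by (simp add: P_def ext_less[OF ln(1)])
  have P_high: "P \<tau> (j + l) = \<tau> j" if "j < l" for \<tau> j using that by (simp add: P_def ext_less[OF ln(2)])
  have P_add: "P (\<lambda>j. \<sigma> j + \<tau> j) = (\<lambda>j. P \<sigma> j + P \<tau> j)" for \<sigma> \<tau>
  proof -
    have "(\<lambda>j. if j < l then 0 else \<sigma> (j - l) + \<tau> (j - l)) =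
        (\<lambda>j. (if j < l then 0 else \<sigma> (j - l)) + (if j < l then 0 else \<tau> (j - l)))" by auto
    then show ?thesis by (simp only: P_def ext_add[abs_def])
  qed
  have P_scaleC: "P (\<lambda>j. a *\<^sub>C \<tau> j) = (\<lambda>j. a *\<^sub>C P \<tau> j)" for a \<tau>
  proof -
    have "(\<lambda>j. if j < l then 0 else a *\<^sub>C \<tau> (j - l)) = (\<lambda>j. a *\<^sub>C (if j < l then 0 else \<tau> (j - l)))" by auto
    then show ?thesis by (simp only: P_def ext_scaleC[abs_def])
  qed
  define \<Theta> where "\<Theta> \<tau> j = (if j < l then reflect (P \<tau>) j else 0)" for \<tau> j
  have lin\<Theta>: "Vector_Spaces.linear (\<lambda>a (y :: nat \<Rightarrow> 'a) j. a *\<^sub>C y j) (\<lambda>a (y :: nat \<Rightarrow> 'a) j. a *\<^sub>C y j) \<Theta>"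
    by unfold_locales (auto simp: \<Theta>_def plus_fun_def P_add P_scaleC reflect_add reflect_scaleC)
  have "\<Theta> ` seqv.span B = seqv.span B"
  proof (rule seqv.linear_inj_span_surj[OF lin\<Theta> finB])
    show "\<Theta> ` seqv.span B \<subseteq> seqv.span B" by (auto simp: span \<Theta>_def)
    show "inj_on \<Theta> (seqv.span B)"
    proof (rule inj_onI)
      fix \<sigma> \<tau> assume \<sigma>: "\<sigma> \<in> seqv.span B" and \<tau>: "\<tau> \<in> seqv.span B" and eq: "\<Theta> \<sigma> = \<Theta> \<tau>"
      define y where "y = (\<lambda>j. P \<sigma> j - P \<tau> j)"
      have y: "recurrence A n y" unfolding y_def by (rule recurrence_diff[OF P_rec P_rec])
      have half: "reflect y j = 0" if "j < l" for j
        using fun_cong[OF eq, of j] that by (simp add: \<Theta>_def y_def reflect_diff)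
      have "outgoing y" by (rule reflect_eq_0_imp_outgoing[OF y reflect_half_eq_0[OF y half]])
      moreover have "y j = 0" if "j < l" for j using that by (simp add: y_def P_low)
      ultimately have y0: "y j = 0" if "j < n" for j using outgoing_eq_0 that by blast
      show "\<sigma> = \<tau>"
      proof
        fix j
        show "\<sigma> j = \<tau> j"
        proof (cases "j < l")
          case True
          then have "y (j + l) = 0" using y0 ln(2) by blast
          then show ?thesis using P_high[OF True] by (simp add: y_def)
        next
          case False
          then show ?thesis using \<sigma> \<tau> by (simp add: span)
        qed
      qed
    qed
  qed
  moreover have "(\<lambda>j. if j < l then reflect (ext \<phi>) j else 0) \<in> seqv.span B" by (simp add: span)
  ultimately obtain \<tau> where \<tau>: "(\<lambda>j. if j < l then reflect (ext \<phi>) j else 0) = \<Theta> \<tau>" by blast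
  define y where "y = (\<lambda>j. ext \<phi> j - P \<tau> j)"
  have y: "recurrence A n y" unfolding y_def by (rule recurrence_diff[OF ext_recurrence P_rec])
  have half: "reflect y j = 0" if "j < l" for j
    using fun_cong[OF \<tau>, of j] that by (simp add: \<Theta>_def y_def reflect_diff)
  have "outgoing y" by (rule reflect_eq_0_imp_outgoing[OF y reflect_half_eq_0[OF y half]])
  moreover have "y j = \<phi> j" if "j < l" for j using that by (simp add: y_def P_low ext_less[OF ln(1)])
  ultimately show ?thesis by (rule that)
qed

definition real_spectrum :: "real set" where
  "real_spectrum = {c. eigenvalue (pencil A n) (of_real c)}"

lemma finite_real_spectrum: "finite real_spectrum"
proof (rule finite_subset)
  show "real_spectrum \<subseteq> of_real -` S" using eigenvalue_S by (auto simp: real_spectrum_def)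
  show "finite (of_real -` S :: real set)" by (rule finite_vimageI[OF finite_S]) (rule inj_of_real)
qed

lemma allowed_le:
  assumes "eigenvalue (pencil A n) (of_real c)" "k \<in> {1..N c}" "int h \<le> (int (p c k) + \<epsilon> c k) div 2"
  shows "h \<le> p c k"
  using sign_cases[OF assms(1,2)] assms(3) by (auto elim!: evenE oddE)

lemma elementary_solutions_sum:
  assumes I: "I \<subseteq> {(c, k, h). eigenvalue (pencil A n) (of_real c) \<and> k \<in> {1..N c} \<and> h \<le> p c k}"
  shows "(\<Sum>(c, k, h)\<in>I. a c k h *\<^sub>C elementary_solution (of_real c) (w c k) h t) =
    (\<Sum>c\<in>real_spectrum. exp_poly (of_real c) M
      (chain_comb (N c) (p c) (w c) (\<lambda>k h. if (c, k, h) \<in> I then a c k h else 0)) t)"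
proof -
  let ?J = "Sigma real_spectrum (\<lambda>c. Sigma {1..N c} (\<lambda>k. {..p c k}))"
  let ?a = "\<lambda>c k h. if (c, k, h) \<in> I then a c k h else 0"
  have fin: "finite ?J" using finite_real_spectrum by (intro finite_SigmaI) auto
  have sub: "I \<subseteq> ?J" using I by (auto simp: real_spectrum_def)
  have "(\<Sum>(c, k, h)\<in>I. a c k h *\<^sub>C elementary_solution (of_real c) (w c k) h t) =
      (\<Sum>(c, k, h)\<in>?J. ?a c k h *\<^sub>C elementary_solution (of_real c) (w c k) h t)"
    by (rule sum.mono_neutral_cong_left[OF fin sub]) auto
  also have "\<dots> = (\<Sum>c\<in>real_spectrum. \<Sum>(k, h)\<in>Sigma {1..N c} (\<lambda>k. {..p c k}). ?a c k h *\<^sub>C elementary_solution (of_real c) (w c k) h t)"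
    using finite_real_spectrum by (subst sum.Sigma) (auto simp: case_prod_unfold)
  also have "\<dots> = (\<Sum>c\<in>real_spectrum. \<Sum>k=1..N c. \<Sum>h\<le>p c k. ?a c k h *\<^sub>C elementary_solution (of_real c) (w c k) h t)"
    by (rule sum.cong[OF refl], subst sum.Sigma) (auto simp: case_prod_unfold)
  also have "\<dots> = (\<Sum>c\<in>real_spectrum. exp_poly (of_real c) M (chain_comb (N c) (p c) (w c) (?a c)) t)"
    unfolding chain_comb_def[abs_def] exp_poly_sum exp_poly_scaleC
  proof (rule sum.cong[OF refl], rule sum.cong[OF refl], rule sum.cong[OF refl])
    fix c k h assume "c \<in> real_spectrum" "k \<in> {1..N c}" "h \<in> {..p c k}"
    then have "h < M" using M_large[of c k] by (auto simp: real_spectrum_def)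
    then show "?a c k h *\<^sub>C elementary_solution (of_real c) (w c k) h t = ?a c k h *\<^sub>C exp_poly (of_real c) M (rev_chain (w c k) h) t"
      by (simp only: elementary_solution_exp_poly)
  qed
  finally show ?thesis .
qed

lemma outgoing_radiates:
  assumes out: "outgoing y"
    and v: "\<And>t. v t = (\<Sum>c\<in>S. exp_poly c M (R y c) t)"
  shows "solution A n v" "momentum j v 0 = y j" "radiation_principle (pencil A n) n N p w \<epsilon> v"
proof -
  have y: "recurrence A n y" using out by (simp add: outgoing_def)
  note sol = exp_poly_solution[where S = S and x = "R y" and M = M and v = v, OF R_root[OF y] R_high[OF y] v]
  show "solution A n v" using sol(1) by simp
  show "momentum j v 0 = y j" using sol(2)[of j] R_sum[OF y, of j] by simp
  let ?Sp = "{c \<in> S. 0 < Im c}"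
  define v0 where "v0 t = (\<Sum>c\<in>?Sp. exp_poly c M (R y c) t)" for t
  define v1 where "v1 t = (\<Sum>c\<in>real_spectrum. exp_poly (of_real c) M (R y (of_real c)) t)" for t
  have split: "v t = v1 t + v0 t" for t
  proof -
    have "v t = (\<Sum>c\<in>of_real ` real_spectrum \<union> ?Sp. exp_poly c M (R y c) t)"
      unfolding v
    proof (rule sum.mono_neutral_right[OF finite_S])
      show "of_real ` real_spectrum \<union> ?Sp \<subseteq> S" using eigenvalue_S by (auto simp: real_spectrum_def)
      show "\<forall>c\<in>S - (of_real ` real_spectrum \<union> ?Sp). exp_poly c M (R y c) t = 0"
      proof
        fix c assume c: "c \<in> S - (of_real ` real_spectrum \<union> ?Sp)"
        have "R y c = (\<lambda>_. 0)"
        proof (cases "Im c < 0")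
          case True
          then show ?thesis using out by (simp add: outgoing_def)
        next
          case False
          then have "Im c = 0" using c by auto
          then have "c = of_real (Re c)" by (simp add: complex_eq_iff)
          then have "\<not> eigenvalue (pencil A n) c" using c unfolding real_spectrum_def
            by (metis (mono_tags, lifting) DiffD2 UnCI image_eqI mem_Collect_eq)
          then show ?thesis by (rule R_non_eigenvalue[OF y])
        qed
        then show "exp_poly c M (R y c) t = 0" by simp
      qed
    qed
    also have "\<dots> = (\<Sum>c\<in>of_real ` real_spectrum. exp_poly c M (R y c) t) + v0 t"
      unfolding v0_def using finite_S finite_real_spectrum by (intro sum.union_disjoint) auto
    also have "(\<Sum>c\<in>of_real ` real_spectrum. exp_poly c M (R y c) t) = v1 t"
      by (subst sum.reindex) (auto simp: inj_on_def v1_def)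
    finally show ?thesis .
  qed
  have decay: "(higher_deriv_on {0..} j v0 \<longlongrightarrow> 0) at_top" for j
  proof (rule Lim_transform_eventually)
    have "((\<lambda>t. \<i> ^ j *\<^sub>C (\<Sum>c\<in>?Sp. exp_poly c M (\<lambda>m. geo c (shift m (R y c)) j) t)) \<longlongrightarrow> \<i> ^ j *\<^sub>C (\<Sum>c\<in>?Sp. 0)) at_top"
      by (intro tendsto_intros exp_poly_tendsto_0) auto
    then show "((\<lambda>t. \<i> ^ j *\<^sub>C (\<Sum>c\<in>?Sp. exp_poly c M (\<lambda>m. geo c (shift m (R y c)) j) t)) \<longlongrightarrow> 0) at_top" by simp
    show "eventually (\<lambda>t. \<i> ^ j *\<^sub>C (\<Sum>c\<in>?Sp. exp_poly c M (\<lambda>m. geo c (shift m (R y c)) j) t) = higher_deriv_on {0..} j v0 t) at_top"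
      using eventually_ge_at_top[of 0]
    proof eventually_elim
      case (elim t)
      show ?case
        by (rule higher_deriv_exp_poly(1)[OF R_high[OF y] at_within_Ici_neq_bot, symmetric]) (use elim in \<open>auto simp: v0_def\<close>)
    qed
  qed
  let ?I = "{(c, k, h). eigenvalue (pencil A n) (of_real c) \<and> k \<in> {1..N c} \<and> h \<le> p c k \<and> coef y c k h \<noteq> 0}"
  have finI: "finite ?I"
    by (rule finite_subset[of _ "Sigma real_spectrum (\<lambda>c. Sigma {1..N c} (\<lambda>k. {..p c k}))"])
      (use finite_real_spectrum in \<open>auto simp: real_spectrum_def intro!: finite_SigmaI\<close>)
  have "?I \<subseteq> {(c, k, h). eigenvalue (pencil A n) (of_real c) \<and> k \<in> {1..N c} \<and> int h \<le> (int (p c k) + \<epsilon> c k) div 2}"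
    using out by (auto simp: outgoing_def)
  moreover have "v1 t = (\<Sum>(c, k, h)\<in>?I. coef y c k h *\<^sub>C elementary_solution (of_real c) (w c k) h t)" for t
  proof -
    have "(\<Sum>(c, k, h)\<in>?I. coef y c k h *\<^sub>C elementary_solution (of_real c) (w c k) h t) =
        (\<Sum>c\<in>real_spectrum. exp_poly (of_real c) M
          (chain_comb (N c) (p c) (w c) (\<lambda>k h. if (c, k, h) \<in> ?I then coef y c k h else 0)) t)"
      by (rule elementary_solutions_sum) auto
    also have "\<dots> = v1 t"
      unfolding v1_def
    proof (rule sum.cong[OF refl])
      fix c assume "c \<in> real_spectrum"
      then have eig: "eigenvalue (pencil A n) (of_real c)" by (simp add: real_spectrum_def)
      have "chain_comb (N c) (p c) (w c) (\<lambda>k h. if (c, k, h) \<in> ?I then coef y c k h else 0) = R y (of_real c)"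
        unfolding R_real[OF y eig] chain_comb_def[abs_def] using eig by (intro ext sum.cong refl) auto
      then show "exp_poly (of_real c) M (chain_comb (N c) (p c) (w c) (\<lambda>k h. if (c, k, h) \<in> ?I then coef y c k h else 0)) t =
          exp_poly (of_real c) M (R y (of_real c)) t" by simp
    qed
    finally show ?thesis by simp
  qed
  ultimately show "radiation_principle (pencil A n) n N p w \<epsilon> v"
    unfolding radiation_principle_def using split decay finI by blast
qed

lemma numer_cong: "(\<And>j. j < n \<Longrightarrow> y j = y' j) \<Longrightarrow> numer A n y b = numer A n y' b"
  unfolding numer_def by (intro sum.cong refl arg_cong[where f = "A _"]) auto

text \<open>
  After subtraction of its elementary part a solution decays with its derivatives. The bound for
  decaying solutions excludes poles of the remaining partial fraction in the closed lower half plane, so there the root sequences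
  of the solution are those of the elementary part.
\<close>

lemma radiates_outgoing:
  assumes u: "solution A n u" and rad: "radiation_principle (pencil A n) n N p w \<epsilon> u"
  shows "outgoing (ext (\<lambda>j. momentum j u 0))"
proof -
  define y where "y = ext (\<lambda>j. momentum j u 0)"
  have y: "recurrence A n y" by (simp add: y_def ext_recurrence)
  have y_low: "y j = momentum j u 0" if "j < n" for j using that by (simp add: y_def ext_less)
  obtain v1 v0 I a where v: "\<And>t. 0 \<le> t \<Longrightarrow> u t = v1 t + v0 t"
    and v0: "\<And>j. j < n \<Longrightarrow> (higher_deriv_on {0..} j v0 \<longlongrightarrow> 0) at_top"
    and I: "finite I" "I \<subseteq> {(c, k, h). eigenvalue (pencil A n) (of_real c) \<and> k \<in> {1..N c} \<and> int h \<le> (int (p c k) + \<epsilon> c k) div 2}"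
    and v1: "\<And>t. 0 \<le> t \<Longrightarrow> v1 t = (\<Sum>(c, k, h)\<in>I. a c k h *\<^sub>C elementary_solution (of_real c) (w c k) h t)"
    using rad unfolding radiation_principle_def by blast
  define a' where "a' c k h = (if (c, k, h) \<in> I then a c k h else 0)" for c k h
  define x1 where "x1 c = (if Im c = 0 \<and> eigenvalue (pencil A n) c
    then chain_comb (N (Re c)) (p (Re c)) (w (Re c)) (a' (Re c)) else (\<lambda>_. 0))" for c
  have x1_real: "x1 (of_real c) = chain_comb (N c) (p c) (w c) (a' c)" if "eigenvalue (pencil A n) (of_real c)" for c
    using that by (simp add: x1_def)
  have x1_other: "x1 c = (\<lambda>_. 0)" if "c \<notin> of_real ` real_spectrum" for c
  proof -
    have "\<not> (Im c = 0 \<and> eigenvalue (pencil A n) c)"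
    proof
      assume c: "Im c = 0 \<and> eigenvalue (pencil A n) c"
      then have "c = of_real (Re c)" by (simp add: complex_eq_iff)
      then have "Re c \<in> real_spectrum" using c by (simp add: real_spectrum_def)
      then show False using that \<open>c = of_real (Re c)\<close> by (metis imageI)
    qed
    then show ?thesis unfolding x1_def by (rule if_not_P)
  qed
  have x1_root: "root_seq A n c (x1 c)" and x1_high: "M \<le> m \<Longrightarrow> x1 c m = 0" for c m
  proof -
    have "root_seq A n c (x1 c) \<and> (M \<le> m \<longrightarrow> x1 c m = 0)"
    proof (cases "c \<in> of_real ` real_spectrum")
      case True
      then obtain r where r: "c = of_real r" "eigenvalue (pencil A n) (of_real r)" by (auto simp: real_spectrum_def)
      then show ?thesis using chain_comb_root_seq[OF r(2)] chain_comb_high[OF r(2)] by (simp add: x1_real)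
    next
      case False
      then show ?thesis by (simp add: x1_other root_seq_zero)
    qed
    then show "root_seq A n c (x1 c)" and "M \<le> m \<Longrightarrow> x1 c m = 0" by auto
  qed
  have v1_exp: "v1 t = (\<Sum>c\<in>S. exp_poly c M (x1 c) t)" if "0 \<le> t" for t
  proof -
    have "I \<subseteq> {(c, k, h). eigenvalue (pencil A n) (of_real c) \<and> k \<in> {1..N c} \<and> h \<le> p c k}"
      using I(2) allowed_le by fastforce
    then have "v1 t = (\<Sum>c\<in>real_spectrum. exp_poly (of_real c) M (x1 (of_real c)) t)"
      unfolding v1[OF that] by (subst elementary_solutions_sum)
        (auto simp: x1_real real_spectrum_def a'_def[abs_def] intro!: sum.cong)
    also have "\<dots> = (\<Sum>c\<in>of_real ` real_spectrum. exp_poly c M (x1 c) t)"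
      by (subst sum.reindex) (auto simp: inj_on_def)
    also have "\<dots> = (\<Sum>c\<in>S. exp_poly c M (x1 c) t)"
      using finite_S eigenvalue_S x1_other by (intro sum.mono_neutral_left) (auto simp: real_spectrum_def)
    finally show ?thesis .
  qed
  define y1 where "y1 j = (\<Sum>c\<in>S. geo c (x1 c) j)" for j
  have v1_sol: "solution A n v1" and v1_mom: "momentum j v1 0 = y1 j" for j
    using exp_poly_solution[OF x1_root x1_high v1_exp] by (auto simp: y1_def)
  define u0 where "u0 t = u t - v1 t" for t
  have u0_sol: "solution A n u0" unfolding u0_def[abs_def] by (rule solution_diff[OF u v1_sol])
  have u0_mom: "momentum j u0 0 = y j - y1 j" if "j < n" for j
    using momentum_diff[OF u v1_sol, of j 0] that by (simp add: u0_def[abs_def] y_low v1_mom)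
  have u0_lim: "((\<lambda>t. momentum j u0 t) \<longlongrightarrow> 0) at_top" if "j < n" for j
  proof (rule Lim_transform_eventually)
    have "((\<lambda>t. (- \<i>) ^ j *\<^sub>C higher_deriv_on {0..} j v0 t) \<longlongrightarrow> (- \<i>) ^ j *\<^sub>C 0) at_top"
      by (intro tendsto_intros v0 that)
    then show "((\<lambda>t. (- \<i>) ^ j *\<^sub>C higher_deriv_on {0..} j v0 t) \<longlongrightarrow> 0) at_top" by simp
    show "eventually (\<lambda>t. (- \<i>) ^ j *\<^sub>C higher_deriv_on {0..} j v0 t = momentum j u0 t) at_top"
      using eventually_ge_at_top[of 0]
    proof eventually_elim
      case (elim t)
      have "higher_deriv_on {0..} j v0 t = higher_deriv_on {0..} j u0 t"
        by (rule higher_deriv_on_cong) (use v elim in \<open>auto simp: u0_def\<close>)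
      then show ?case by (simp add: momentum_def)
    qed
  qed
  define x0 where "x0 c m = R y c m - x1 c m" for c m
  have x0_root: "root_seq A n c (x0 c)" for c
    unfolding x0_def[abs_def] by (rule root_seq_diff[OF R_root[OF y] x1_root])
  have x0_high: "x0 c m = 0" if "M \<le> m" for c m using R_high[OF y that] x1_high[OF that] by (simp add: x0_def)
  have x0_pencil: "pencil A n b (partial_fraction S M x0 b) = numer A n (\<lambda>j. momentum j u0 0) b" if "b \<notin> S" for b
  proof -
    have "(\<Sum>c\<in>S. geo c (x0 c) j) = y j - y1 j" for j
      unfolding x0_def[abs_def] geo_diff sum_subtractf by (simp add: y1_def flip: R_sum[OF y])
    then have "pencil A n b (partial_fraction S M x0 b) = numer A n (\<lambda>j. y j - y1 j) b"
      using pencil_partial_fraction[OF that x0_root x0_high] by simp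
    also have "\<dots> = numer A n (\<lambda>j. momentum j u0 0) b" by (rule numer_cong) (simp add: u0_mom)
    finally show ?thesis .
  qed
  have x0_zero: "x0 c m = 0" if c: "c \<in> S" "Im c \<le> 0" and n0: "0 < n" for c m
  proof (cases "m < M")
    case True
    obtain \<delta>1 K1 where \<delta>1: "\<delta>1 > 0" "K1 \<ge> 0" "\<And>b. dist b c < \<delta>1 \<Longrightarrow> norm (partial_fraction (S - {c}) M x0 b) \<le> K1"
      using isCont_bounded_near[OF partial_fraction_continuous[of c "S - {c}" M x0]] by blast
    obtain \<delta>2 where \<delta>2: "\<delta>2 > 0" "\<And>b. b \<in> S \<Longrightarrow> b \<noteq> c \<Longrightarrow> \<delta>2 \<le> dist c b"
      using finite_set_avoid[OF finite_S, of c] by blast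
    (* The pole is approached from below, where the bound applies. *)
    show ?thesis
    proof (rule pole_part_small_eq_0[of "- \<i>" 1 m M c])
      fix e :: real assume e: "e > 0"
      obtain K where K: "K \<ge> 0" "\<And>b U. Im b < 0 \<Longrightarrow> \<not> eigenvalue (pencil A n) b \<Longrightarrow>
        pencil A n b U = numer A n (\<lambda>j. momentum j u0 0) b \<Longrightarrow> norm U \<le> K + (e / 2) / (- Im b)"
        using decaying_solution_bound[OF u0_sol u0_lim n0, of "e / 2"] e by auto
      define L where "L = K + K1 + 1"
      have L: "L > 0" using K(1) \<delta>1(2) by (simp add: L_def)
      show "\<exists>\<delta>'>0. \<forall>t. 0 < t \<longrightarrow> t < \<delta>' \<longrightarrow> t * norm (pole_part c M (x0 c) (c + of_real t * (- \<i>))) \<le> e"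
      proof (intro exI[of _ "min (min \<delta>1 \<delta>2) (e / (2 * L))"] conjI allI impI)
        show "0 < min (min \<delta>1 \<delta>2) (e / (2 * L))" using \<delta>1 \<delta>2 e L by simp
        fix t assume t: "0 < t" "t < min (min \<delta>1 \<delta>2) (e / (2 * L))"
        define b where "b = c + of_real t * (- \<i>)"
        have d: "dist b c = t" "dist c b = t" using t by (auto simp: b_def dist_norm norm_mult)
        then have bS: "b \<notin> S" using \<delta>2(2)[of b] t by auto
        have Imb: "Im b = Im c - t" by (simp add: b_def)
        have "norm (partial_fraction S M x0 b) \<le> K + (e / 2) / (- Im b)"
          using K(2)[of b] Imb c(2) t eigenvalue_S bS x0_pencil[OF bS] by (metis diff_less_eq le_less_trans less_add_same_cancel1 add_0)
        also have "(e / 2) / (- Im b) \<le> (e / 2) / t"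
          using Imb c(2) t e by (intro divide_left_mono mult_pos_pos) auto
        finally have U: "norm (partial_fraction S M x0 b) \<le> K + (e / 2) / t" by simp
        have "pole_part c M (x0 c) b = partial_fraction S M x0 b - partial_fraction (S - {c}) M x0 b"
          using partial_fraction_split[OF finite_S, of M x0 b c] c by simp
        then have "norm (pole_part c M (x0 c) b) \<le> K + (e / 2) / t + K1"
          using norm_triangle_ineq4[of "partial_fraction S M x0 b" "partial_fraction (S - {c}) M x0 b"] U \<delta>1(3)[of b] d t by simp
        then have "t * norm (pole_part c M (x0 c) b) \<le> t * (K + (e / 2) / t + K1)"
          using t by (intro mult_left_mono) auto
        also have "\<dots> = t * (K + K1) + e / 2" using t by (simp add: field_simps)
        also have "t * (K + K1) \<le> (e / (2 * L)) * L"
          using t K(1) \<delta>1(2) by (intro mult_mono) (auto simp: L_def)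
        also have "\<dots> = e / 2" using L by simp
        finally show "t * norm (pole_part c M (x0 c) (c + of_real t * (- \<i>))) \<le> e" by (simp add: b_def)
      qed
    qed (use True in auto)
  qed (simp add: x0_high)
  show ?thesis
  proof (cases "n = 0")
    case True
    then have "\<not> eigenvalue (pencil A n) c" for c
      using leading_inj by (auto simp: eigenvalue_def pencil_def)
    then show ?thesis using y R_non_eigenvalue[OF y] unfolding outgoing_def y_def[symmetric] by blast
  next
    case False
    then have x0: "R y c m = x1 c m" if "c \<in> S" "Im c \<le> 0" for c m using x0_zero[OF that, of m] by (simp add: x0_def)
    have "R y c = (\<lambda>_. 0)" if c: "Im c < 0" for c
    proof (cases "c \<in> S")
      case True
      have "c \<notin> of_real ` real_spectrum" using c by auto
      from x1_other[OF this] show ?thesis using x0[OF True] c by auto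
    next
      case False
      then show ?thesis using R_non_eigenvalue[OF y] eigenvalue_S by blast
    qed
    moreover have "int h \<le> (int (p c k) + \<epsilon> c k) div 2"
      if eig: "eigenvalue (pencil A n) (of_real c)" and k: "k \<in> {1..N c}" "h \<le> p c k" and nz: "coef y c k h \<noteq> 0" for c k h
    proof -
      have "chain_comb (N c) (p c) (w c) (\<lambda>k h. coef y c k h - a' c k h) m = 0" for m
      proof -
        have "chain_comb (N c) (p c) (w c) (\<lambda>k h. coef y c k h - a' c k h) m =
            chain_comb (N c) (p c) (w c) (coef y c) m - chain_comb (N c) (p c) (w c) (a' c) m"
          by (simp add: chain_comb_def complex_vector.scale_left_diff_distrib sum_subtractf)
        also have "\<dots> = R y (of_real c) m - x1 (of_real c) m" by (simp only: R_real[OF y eig] x1_real[OF eig])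
        finally show ?thesis using x0[OF eigenvalue_S[OF eig]] by simp
      qed
      from chain_comb_unique[OF system[OF eig] this k] have "a' c k h \<noteq> 0" using nz by simp
      then have "(c, k, h) \<in> I" by (auto simp: a'_def split: if_splits)
      then show ?thesis using I(2) by auto
    qed
    ultimately show ?thesis using y unfolding outgoing_def y_def[symmetric] by blast
  qed
qed

lemma radiation_problem_uniquely_solvable:
  fixes \<phi> :: "nat \<Rightarrow> 'a"
  shows "\<exists>v. (solution A n v \<and> (\<forall>j<l. momentum j v 0 = \<phi> j) \<and> radiation_principle (pencil A n) n N p w \<epsilon> v) \<and>
    (\<forall>u. solution A n u \<and> (\<forall>j<l. momentum j u 0 = \<phi> j) \<and> radiation_principle (pencil A n) n N p w \<epsilon> u \<longrightarrow>
      (\<forall>t\<ge>0. u t = v t))"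
proof -
  obtain y where y: "outgoing y" "\<And>j. j < l \<Longrightarrow> y j = \<phi> j" using outgoing_exists by blast
  define v where "v t = (\<Sum>c\<in>S. exp_poly c M (R y c) t)" for t
  note v = outgoing_radiates[OF y(1) v_def]
  have "u t = v t" if u: "solution A n u" "\<forall>j<l. momentum j u 0 = \<phi> j" "radiation_principle (pencil A n) n N p w \<epsilon> u" and t: "0 \<le> t" for u t
  proof -
    define Y where "Y = (\<lambda>j. ext (\<lambda>j. momentum j u 0) j - ext (\<lambda>j. momentum j v 0) j)"
    have Y: "outgoing Y" unfolding Y_def
      by (rule outgoing_diff[OF radiates_outgoing[OF u(1,3)] radiates_outgoing[OF v(1) v(3)]])
    have Y_low: "Y j = momentum j (\<lambda>t. u t - v t) 0" if "j < n" for j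
      using momentum_diff[OF u(1) v(1), of j 0] that by (simp add: Y_def ext_less)
    have "Y j = 0" if "j < l" for j
    proof -
      have "j < n" using that n_even by simp
      then show ?thesis using that u(2) v(2) y(2) by (simp add: Y_def ext_less)
    qed
    then have "momentum j (\<lambda>t. u t - v t) 0 = 0" if "j < n" for j
      using outgoing_eq_0[OF Y _ that] Y_low[OF that] by simp
    then have "u t - v t = 0" by (rule solution_eq_0[OF solution_diff[OF u(1) v(1)] _ t])
    then show ?thesis by simp
  qed
  moreover have "momentum j v 0 = \<phi> j" if "j < l" for j using v(2)[of j] y(2)[OF that] by simp
  ultimately show ?thesis using v(1,3) by blast
qed

end

theorem theorem7p5:
  fixes A :: "nat \<Rightarrow> 'a::fin_complex_hilbert \<Rightarrow> 'a"
    and l n :: nat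
    and N :: "real \<Rightarrow> nat"
    and p :: "real \<Rightarrow> nat \<Rightarrow> nat"
    and w :: "real \<Rightarrow> nat \<Rightarrow> nat \<Rightarrow> 'a"
    and \<epsilon> :: "real \<Rightarrow> nat \<Rightarrow> int"
    and \<phi> :: "nat \<Rightarrow> 'a"
  assumes n: "n = 2 * l"
    and lin: "\<And>k. k \<le> n \<Longrightarrow> Vector_Spaces.linear (*\<^sub>C) (*\<^sub>C) (A k)"
    and i: "\<And>x (b::real). Im (cinner (pencil A n (of_real b) x) x) \<le> 0"
    and ii: "{x. A n x = 0} = {0}"
    and iii: "\<exists>b::real. 0 \<notin> numerical_range (pencil A n (of_real b))"
    and regular: "\<And>c. eigenvalue (pencil A n) (of_real c) \<Longrightarrow>
          regular_canonical_system (pencil A n) n c (N c) (p c) (w c)"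
    and signs: "\<And>c. eigenvalue (pencil A n) (of_real c) \<Longrightarrow>
          sign_characteristics (pencil A n) n c (N c) (p c) (w c) (\<epsilon> c)"
  shows "\<exists>v. (solution A n v \<and> (\<forall>j<l. (- \<i>) ^ j *\<^sub>C higher_deriv_on {0..} j v 0 = \<phi> j) \<and>
               radiation_principle (pencil A n) n N p w \<epsilon> v) \<and>
           (\<forall>u. solution A n u \<and> (\<forall>j<l. (- \<i>) ^ j *\<^sub>C higher_deriv_on {0..} j u 0 = \<phi> j) \<and>
               radiation_principle (pencil A n) n N p w \<epsilon> u \<longrightarrow> (\<forall>t\<ge>0. u t = v t))"
proof -
  interpret regular_pencil A n
    by (intro regular_pencil.intro linear_pencil.intro regular_pencil_axioms.intro) (use lin ii in auto)
  obtain b :: real where b: "0 \<notin> numerical_range (pencil A n (of_real b))" using iii by blast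
  have definite: "x = 0" if zero: "cinner (pencil A n (of_real b) x) x = 0" for x
  proof (rule ccontr)
    assume "x \<noteq> 0"
    let ?u = "of_real (1 / norm x) *\<^sub>C x"
    have "norm ?u = 1" using \<open>x \<noteq> 0\<close> by (simp add: norm_divide)
    moreover have "cinner (pencil A n (of_real b) ?u) ?u = 0"
      by (simp only: clinear_rules(2)[OF pencil_clinear] cinner_scaleC_left cinner_scaleC_right zero mult_zero_right)
    ultimately have "0 \<in> numerical_range (pencil A n (of_real b))"
      unfolding numerical_range_def by (metis (mono_tags, lifting) mem_Collect_eq)
    then show False using b by simp
  qed
  interpret radiation_pencil A n l N p w \<epsilon>
  proof unfold_locales
    fix c assume eig: "eigenvalue (pencil A n) (of_real c)"
    show "chain_system (pencil A n) (of_real c) (N c) (p c) (w c)"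
      using regular[OF eig] by (simp add: regular_canonical_system_def canonical_system_def)
  qed (use n i definite signs in auto)
  obtain S M0 R where dec: "finite S" "\<And>c. eigenvalue (pencil A n) c \<Longrightarrow> c \<in> S"
    "\<And>y c. recurrence A n y \<Longrightarrow> root_seq A n c (R y c)"
    "\<And>y c m. recurrence A n y \<Longrightarrow> m \<ge> M0 \<Longrightarrow> R y c m = 0"
    "\<And>y j. recurrence A n y \<Longrightarrow> y j = (\<Sum>c\<in>S. geo c (R y c) j)"
    "\<And>y z c m. R (\<lambda>j. y j + z j) c m = R y c m + R z c m"
    "\<And>a y c m. R (\<lambda>j. a *\<^sub>C y j) c m = a *\<^sub>C R y c m"
    by (rule root_decomposition) blast
  have "\<forall>c. \<exists>z. eigenvalue (pencil A n) (of_real c) \<longrightarrow>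
      adjoint_canonical_system (pencil A n) (of_real c) (N c) (p c) (w c) z"
    using signs unfolding sign_characteristics_def by blast
  from choice[OF this] obtain z where z: "\<And>c. eigenvalue (pencil A n) (of_real c) \<Longrightarrow>
      adjoint_canonical_system (pencil A n) (of_real c) (N c) (p c) (w c) (z c)" by blast
  define C where "C = {c::real. of_real c \<in> S}"
  have finC: "finite C"
  proof -
    have "C = of_real -` S" by (auto simp: C_def)
    then show ?thesis using finite_vimageI[OF dec(1) inj_of_real] by simp
  qed
  define M where "M = M0 + (\<Sum>c\<in>C. \<Sum>k=1..N c. Suc (p c k))"
  have M: "p c k < M" if "eigenvalue (pencil A n) (of_real c)" "k \<in> {1..N c}" for c k
  proof -
    have "Suc (p c k) \<le> (\<Sum>k=1..N c. Suc (p c k))" using that(2) by (intro member_le_sum) auto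
    also have "\<dots> \<le> (\<Sum>c\<in>C. \<Sum>k=1..N c. Suc (p c k))"
      using dec(2)[OF that(1)] finC by (intro member_le_sum[of c C "\<lambda>c. \<Sum>k=1..N c. Suc (p c k)"]) (auto simp: C_def)
    finally show ?thesis by (simp add: M_def)
  qed
  interpret decomposed_pencil A n l N p w \<epsilon> S M R z
    by unfold_locales (use dec(1-3,5-7) z M in \<open>auto simp: M_def intro: dec(4)\<close>)
  show ?thesis
    using radiation_problem_uniquely_solvable[of \<phi>] unfolding momentum_def .
qed

end
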